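(* Let $n\ge2$ and let $\ell$ be a prime with $\ell\equiv3$ or $5\pmod 8$. Let $K_n$ be the $n$-th layer of the anti-cyclotomic $\mathbb{Z}_2$-extension of $K_0=\mathbb{Q}(i)$. Let $L/\mathbb{Q}$ be a cyclic extension of degree $\ell$ such that every prime ramified in $L/\mathbb{Q}$ is congruent to $3\pmod4$ and $\ell$ is unramified in $L/\mathbb{Q}$, and let $L_n=K_nL$ (a cyclic degree $\ell$ extension of $K_n$). Let $E_m$ be the unit group of $K_m$, $U_m=E_m/E_m^\ell$, and $U_n^{rel}=\ker\left(N_{K_n/K_{n-1}}:U_n\to U_{n-1}\right)$. Then either every class in $U_n^{rel}$ is represented by a unit lying in $N_{L_n/K_n}(L_n^\times)$, or the only class in $U_n^{rel}$ represented by a unit in $N_{L_n/K_n}(L_n^\times)$ is the trivial class (i.e. the only relative units that are norms are $\ell$-th powers).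
   Context: The anti-cyclotomic $\mathbb{Z}_2$-extension of $K_0$ is the $\mathbb{Z}_2$-extension of $K_0$ which is Galois over $\mathbb{Q}$ with dihedral Galois group; its $n$-th layer $K_n$ is the intermediate field with $[K_n:K_0]=2^n$. Since $\ell$-th powers of units are norms from a degree $\ell$ extension, whether a class in $U_n$ consists of norms from $L_n$ is independent of the representative. *)

theory Defs
  imports
    "HOL-Analysis.Analysis"
    "HOL-Algebra.Algebra"
    "HOL-Algebra.Finite_Extensions"
    "HOL-Algebra.Algebraic_Closure_Type"
begin

text \<open>All number fields live inside the complex numbers, viewed as a HOL-Algebra ring; a field
  is a set of complex numbers that is a \<^const>\<open>subfield\<close> of that ring.\<close>

abbreviation CC :: "complex ring" where
  "CC \<equiv> ring_of_type_algebra"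

abbreviation as_ring :: "complex set \<Rightarrow> complex ring" where
  "as_ring E \<equiv> CC\<lparr>carrier := E\<rparr>"

definition adjoin :: "complex set \<Rightarrow> complex set \<Rightarrow> complex set" where
  "adjoin F S = generate_field CC (F \<union> S)"

definition compositum :: "complex set \<Rightarrow> complex set \<Rightarrow> complex set" where
  "compositum E F = generate_field CC (E \<union> F)"

definition extension :: "complex set \<Rightarrow> complex set \<Rightarrow> bool" where
  "extension F E \<longleftrightarrow> subfield F CC \<and> subfield E CC \<and> F \<subseteq> E"

definition extension_degree :: "complex set \<Rightarrow> complex set \<Rightarrow> nat \<Rightarrow> bool" where
  "extension_degree F E d \<longleftrightarrow> extension F E \<and> ring.dimension CC d F E"


section \<open>Galois theory\<close>

text \<open>Elements of the Galois group are extensional functions on the top field (undefined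
  outside it), as in \<^const>\<open>BijGroup\<close>, so that an automorphism is a single HOL function.\<close>

definition gal_group :: "complex set \<Rightarrow> complex set \<Rightarrow> (complex \<Rightarrow> complex) monoid" where
  "gal_group F E = (BijGroup E)\<lparr>carrier :=
     {\<sigma> \<in> Bij E. \<sigma> \<in> ring_hom (as_ring E) (as_ring E) \<and> (\<forall>x\<in>F. \<sigma> x = x)}\<rparr>"

text \<open>Possibly infinite Galois extensions: algebraic, with the bottom field as fixed field.\<close>

definition galois_extension :: "complex set \<Rightarrow> complex set \<Rightarrow> bool" where
  "galois_extension F E \<longleftrightarrow> extension F E \<and>
     (\<forall>x\<in>E. ring.algebraic CC F x) \<and>
     {x \<in> E. \<forall>\<sigma>\<in>carrier (gal_group F E). \<sigma> x = x} = F"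

text \<open>The basic open sets are the cosets of the subgroups fixing a finite subextension
  pointwise.\<close>

definition krull_topology :: "complex set \<Rightarrow> complex set \<Rightarrow> (complex \<Rightarrow> complex) topology" where
  "krull_topology F E = topology_generated_by
     {{\<tau> \<in> carrier (gal_group F E). \<forall>x\<in>M. \<tau> x = \<sigma> x} | \<sigma> M.
        \<sigma> \<in> carrier (gal_group F E) \<and> extension F M \<and> ring.finite_dimension CC F M \<and> M \<subseteq> E}"

definition topgroup_iso ::
  "('a, 'm) monoid_scheme \<Rightarrow> 'a topology \<Rightarrow> ('b, 'n) monoid_scheme \<Rightarrow> 'b topology \<Rightarrow> bool" where
  "topgroup_iso G T H S \<longleftrightarrow> (\<exists>\<phi> \<in> iso G H. homeomorphic_map T S \<phi>)"

definition cyclic_extension :: "complex set \<Rightarrow> complex set \<Rightarrow> nat \<Rightarrow> bool" where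
  "cyclic_extension F E d \<longleftrightarrow>
     galois_extension F E \<and> extension_degree F E d \<and> cyclic_group (gal_group F E)"


section \<open>The anti-cyclotomic extension\<close>

text \<open>The additive group of 2-adic integers, as the inverse limit of the groups of integers
  modulo \<open>2 ^ n\<close>: the \<open>n\<close>-th entry is the representative in \<open>{0..<2 ^ n}\<close>.\<close>

definition two_adic_int :: "(nat \<Rightarrow> int) monoid" where
  "two_adic_int = \<lparr>
     carrier = {x. \<forall>n. x n \<in> {0..<2 ^ n} \<and> x (Suc n) mod 2 ^ n = x n},
     monoid.mult = (\<lambda>x y n. (x n + y n) mod 2 ^ n),
     one = (\<lambda>n. 0)\<rparr>"

definition two_adic_topology :: "(nat \<Rightarrow> int) topology" where
  "two_adic_topology = subtopology
     (product_topology (\<lambda>n. discrete_topology {0..<2 ^ n}) UNIV) (carrier two_adic_int)"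

text \<open>The dihedral group of an abelian group, i.e. its semidirect product with a group of
  order 2 acting by inversion; \<open>True\<close> marks the reflections.\<close>

definition dihedral_group :: "('a, 'm) monoid_scheme \<Rightarrow> ('a \<times> bool) monoid" where
  "dihedral_group A = \<lparr>
     carrier = carrier A \<times> UNIV,
     monoid.mult = (\<lambda>(a, s) (b, t). (a \<otimes>\<^bsub>A\<^esub> (if s then inv\<^bsub>A\<^esub> b else b), s \<noteq> t)),
     one = (\<one>\<^bsub>A\<^esub>, False)\<rparr>"

definition Z2_extension :: "complex set \<Rightarrow> complex set \<Rightarrow> bool" where
  "Z2_extension F E \<longleftrightarrow> galois_extension F E \<and>
     topgroup_iso (gal_group F E) (krull_topology F E) two_adic_int two_adic_topology"

definition anticyclotomic_Z2_extension :: "complex set \<Rightarrow> complex set \<Rightarrow> bool" where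
  "anticyclotomic_Z2_extension F E \<longleftrightarrow> Z2_extension F E \<and> galois_extension \<rat> E \<and>
     topgroup_iso (gal_group \<rat> E) (krull_topology \<rat> E)
       (dihedral_group two_adic_int) (prod_topology two_adic_topology (discrete_topology UNIV))"

definition is_layer :: "complex set \<Rightarrow> complex set \<Rightarrow> nat \<Rightarrow> complex set \<Rightarrow> bool" where
  "is_layer F E n M \<longleftrightarrow> extension_degree F M (2 ^ n) \<and> M \<subseteq> E"


section \<open>Integers, ramification, units and norms\<close>

definition ring_of_integers :: "complex set \<Rightarrow> complex ring" where
  "ring_of_integers E = as_ring {x \<in> E. algebraic_int x}"

text \<open>A rational prime ramifies if some prime ideal occurs with exponent at least 2 in the
  factorisation of the ideal it generates; \<open>divides\<close> is divisibility in the monoid of ideals.\<close>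

definition ramified :: "nat \<Rightarrow> complex set \<Rightarrow> bool" where
  "ramified p E \<longleftrightarrow> (\<exists>P. primeideal P (ring_of_integers E) \<and>
     (P [^]\<^bsub>ideals_set (ring_of_integers E)\<^esub> (2::nat))
       divides\<^bsub>ideals_set (ring_of_integers E)\<^esub> (PIdl\<^bsub>ring_of_integers E\<^esub> (of_nat p)))"

definition embeddings :: "complex set \<Rightarrow> complex set \<Rightarrow> (complex \<Rightarrow> complex) set" where
  "embeddings F E = {\<sigma> \<in> extensional E. \<sigma> \<in> ring_hom (as_ring E) CC \<and> (\<forall>x\<in>F. \<sigma> x = x)}"

text \<open>The relative norm from \<open>E\<close> down to \<open>F\<close>, for a finite extension.\<close>

definition field_norm :: "complex set \<Rightarrow> complex set \<Rightarrow> complex \<Rightarrow> complex" where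
  "field_norm F E x = (\<Prod>\<sigma>\<in>embeddings F E. \<sigma> x)"

definition unit_group :: "complex set \<Rightarrow> complex monoid" where
  "unit_group E = units_of (ring_of_integers E)"

definition powers :: "('a, 'm) monoid_scheme \<Rightarrow> nat \<Rightarrow> 'a set" where
  "powers G l = (\<lambda>u. u [^]\<^bsub>G\<^esub> l) ` carrier G"

definition unit_classes :: "nat \<Rightarrow> complex set \<Rightarrow> complex set monoid" where
  "unit_classes l E = unit_group E Mod powers (unit_group E) l"

text \<open>The map induced by the norm on classes of units modulo \<open>l\<close>-th powers; all units in a class
  have norms in the same class, so the image below is a singleton.\<close>

definition norm_on_classes ::
  "nat \<Rightarrow> complex set \<Rightarrow> complex set \<Rightarrow> complex set \<Rightarrow> complex set" where
  "norm_on_classes l F E c =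
     the_elem ((\<lambda>u. powers (unit_group F) l #>\<^bsub>unit_group F\<^esub> field_norm F E u) ` c)"

definition relative_classes :: "nat \<Rightarrow> complex set \<Rightarrow> complex set \<Rightarrow> complex set set" where
  "relative_classes l F E =
     kernel (unit_classes l E) (unit_classes l F) (norm_on_classes l F E)"

definition represented_by_norm :: "complex set \<Rightarrow> complex set \<Rightarrow> complex set \<Rightarrow> bool" where
  "represented_by_norm F E c \<longleftrightarrow> (\<exists>u\<in>c. u \<in> field_norm F E ` (E - {0}))"

end

theory Submission
  imports Defs "HOL-Number_Theory.Number_Theory" "Jordan_Normal_Form.Char_Poly"
begin

text \<open>The Galois group of \<open>K\<^sub>n / \<rat>\<close> is dihedral, generated by a generator \<open>s\<close> of \<open>Gal(K\<^sub>n / K\<^sub>0)\<close> and complex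
  conjugation. The relative classes that are norms form a submodule \<open>W\<close> of \<open>V = U\<^sub>n\<^sup>r\<^sup>e\<^sup>l\<close> over \<open>\<int>/l\<close>, on which
  \<open>s\<close> has order \<open>2\<^sup>n\<close> with \<open>s\<close> to the power \<open>2 ^ (n - 1)\<close> acting as \<open>-1\<close>; so the cyclic group \<open>\<langle>s\<rangle>\<close> acts freely on the
  nonzero elements. Counting orbits of the dihedral group shows \<open>2 ^ (n + 1)\<close> divides \<open>|W| - 1\<close>, and since
  \<open>l \<equiv> 3, 5 (mod 8)\<close> this forces \<open>|W|\<close> to be a power of \<open>l ^ (2 ^ (n - 1))\<close>. On the other hand, the logarithmic
  embedding bounds \<open>|V|\<close> by \<open>l ^ (2 ^ (n - 1))\<close>, so \<open>W\<close> is trivial or all of \<open>V\<close>. The norms are stable under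
  the dihedral group because its elements extend to \<open>L\<^sub>n\<close>.\<close>

hide_const (open) up_ring.coeff up_ring.monom Polynomials.degree Polynomials.lead_coeff

section \<open>Dihedral modules over a prime field\<close>

text \<open>The obstacle in the orbit count is that reflections do have fixed points. Since n \<ge>
  2, the rotation \<open>j\<close> by 2^(n-2) satisfies j^2 = -1 and anticommutes with every
  reflection, so it exchanges the two eigenspaces of the reflection. Each of the 2^n reflections
  therefore fixes exactly sqrt |W| elements. This number is odd, say 2b + 1, and the nonzero fixed
  points contribute 2^n * 2b in all, a multiple of 2^(n+1); the remaining orbits are full. The order
  of l modulo 2^(n+1) is 2^(n-1), which is also the number of logarithms needed to control a
  relative unit: a nontrivial W is at least as large as the upper bound for V. The upper bound is
  obtained without computing the rank of a unit group. Every relative class contains a unit of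
  relative norm exactly 1. For such units half of the absolute values are the reciprocals of the
  other half, and only finitely many of them have bounded logarithms. Comparing the number of units
  in growing boxes then bounds the number of classes modulo l-th powers.\<close>

lemma power_mod_eq_one:
  fixes a N :: nat
  assumes "a mod N = 1" "N > 1"
  shows "a ^ k mod N = 1"
  using power_mod[of a N k] assms by simp

text \<open>The residue classes 3 and 5 modulo 8 are those of maximal order 2^m in the units modulo
  2^(m+2). The induction halves the exponent through l^(2f) - 1 = (l^f - 1)(l^f + 1), where the
  second factor absorbs only one factor 2.\<close>

lemma two_power_dvd_exponent:
  fixes l e m :: nat
  assumes l: "l mod 8 = 3 \<or> l mod 8 = 5" and "m \<ge> 1" and "l ^ e mod 2 ^ (m + 2) = 1"
  shows "2 ^ m dvd e"
  using assms(2,3)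
proof (induction m arbitrary: e rule: dec_induct)
  case base
  have sq: "(l ^ 2) mod 8 = 1"
    using l by (auto simp: power2_eq_square mod_mult_eq[symmetric, of l l])
  show ?case
  proof (rule ccontr)
    assume "\<not> 2 ^ 1 dvd e"
    then obtain f where f: "e = 2 * f + 1" by (auto elim: oddE)
    have "l ^ e mod 8 = ((l ^ 2) ^ f mod 8) * (l mod 8) mod 8"
      by (simp only: f power_add power_mult power_one_right mod_mult_eq)
    also have "(l ^ 2) ^ f mod 8 = 1"
      using sq by (rule power_mod_eq_one) simp
    finally show False using base l by auto
  qed
next
  case (step m)
  have "l ^ e mod 2 ^ (m + 2) = 1"
  proof -
    have "(l ^ e mod 2 ^ (Suc m + 2)) mod 2 ^ (m + 2) = 1"
      using step.prems by simp
    moreover have "(2::nat) ^ (m + 2) dvd 2 ^ (Suc m + 2)" by (simp add: le_imp_power_dvd)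
    ultimately show ?thesis by (metis mod_mod_cancel)
  qed
  hence "2 ^ m dvd e" by (rule step.IH)
  hence "even e" using \<open>1 \<le> m\<close> dvd_trans[of 2 "2 ^ m" e] by (simp add: dvd_power)
  then obtain f where e: "e = 2 * f" by blast
  \<comment> \<open>An odd \<open>f\<close> would give l^e = (l^2)^f \<equiv> 9 modulo 16, and 16
    divides 2^(m+3) because m \<ge> 1.\<close>
  have f: "even f"
  proof (rule ccontr)
    assume "odd f"
    then obtain g where g: "f = 2 * g + 1" by (auto elim: oddE)
    define q where "q = l div 8"
    have "l = 8 * q + 3 \<or> l = 8 * q + 5"
      using l mult_div_mod_eq[of 8 l] unfolding q_def by metis
    then have "l ^ 2 = 16 * (4 * q * q + 3 * q) + 9 \<or> l ^ 2 = 16 * (4 * q * q + 5 * q + 1) + 9"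
      by (auto simp: power2_eq_square algebra_simps)
    moreover have "(16 * a + 9) mod 16 = 9" for a :: nat by presburger
    ultimately have sq: "l ^ 2 mod 16 = 9" by metis
    have "(l ^ 2) ^ 2 mod 16 = 1"
      using power_mod[of "l^2" 16 2] sq by simp
    hence "((l ^ 2) ^ 2) ^ g mod 16 = 1"
      by (rule power_mod_eq_one) simp
    moreover have "l ^ e = ((l ^ 2) ^ 2) ^ g * l ^ 2"
      by (simp only: e g power_mult[symmetric] power_add[symmetric]) (simp add: algebra_simps)
    ultimately have "l ^ e mod 16 = 9"
      using sq mod_mult_eq[of "((l ^ 2) ^ 2) ^ g" 16 "l ^ 2"] by simp
    moreover have "l ^ e mod 16 = 1"
    proof -
      have "(16::nat) dvd 2 ^ (Suc m + 2)"
        using \<open>1 \<le> m\<close> le_imp_power_dvd[of 4 "Suc m + 2" "2::nat"] by simp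
      then have "(l ^ e mod 2 ^ (Suc m + 2)) mod 16 = l ^ e mod 16"
        by (rule mod_mod_cancel)
      thus ?thesis using step.prems by simp
    qed
    ultimately show False by simp
  qed
  then obtain g where g: "f = 2 * g" by blast
  have l0: "l > 0" using l by (cases l) auto
  have sq: "l ^ 2 mod 4 = 1"
  proof -
    have "(l mod 8) mod 4 = l mod 4" by (simp add: mod_mod_cancel)
    hence "l mod 4 \<in> {1,3}" using l by auto
    thus ?thesis by (auto simp: power2_eq_square mod_mult_eq[symmetric, of l l])
  qed
  \<comment> \<open>With \<open>f\<close> even, \<open>l ^ f = 4 * h + 1\<close>, so
    \<open>l ^ f + 1\<close> is twice the odd number \<open>2 * h + 1\<close>.\<close>
  have "l ^ f mod 4 = 1"
    unfolding g power_mult using sq by (rule power_mod_eq_one) simp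
  then obtain h where h: "l ^ f = 4 * h + 1"
    by (metis mult_div_mod_eq)
  have "2 ^ (m + 3) dvd l ^ e - 1"
    using step.prems dvd_minus_mod[of "2 ^ (m + 3)" "l ^ e"] by (simp add: numeral_3_eq_3)
  also have "l ^ e - 1 = 2 * ((l ^ f - 1) * (2 * h + 1))"
    unfolding e mult_2 power_add h by (simp add: algebra_simps)
  finally have "2 * 2 ^ (m + 2) dvd 2 * ((l ^ f - 1) * (2 * h + 1))"
    by (simp add: eval_nat_numeral)
  hence "2 ^ (m + 2) dvd (l ^ f - 1) * (2 * h + 1)"
    by (rule nat_mult_dvd_cancel1[THEN iffD1, rotated]) simp
  moreover have "coprime ((2::nat) ^ (m + 2)) (2 * h + 1)"
    by (intro coprime_power_left_iff[THEN iffD2] disjI1) simp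
  ultimately have "2 ^ (m + 2) dvd l ^ f - 1"
    by (simp only: coprime_dvd_mult_left_iff)
  then obtain q where "l ^ f = 2 ^ (m + 2) * q + 1"
    using h by (metis add_diff_cancel_right' dvd_def)
  moreover have "(1::nat) < 2 ^ (m + 2)" by (rule one_less_power) auto
  ultimately have "l ^ f mod 2 ^ (m + 2) = 1" by (metis mod_less mod_mult_self4)
  hence "2 ^ m dvd f" by (rule step.IH)
  thus ?case by (simp add: e)
qed

text \<open>Cauchy's argument: a prime p dividing the order yields a subgroup of order p, and a
  nontrivial element of it has order dividing both p and \<open>l\<close>.\<close>

lemma (in comm_group) order_eq_prime_power:
  assumes fin: "finite (carrier G)" and l: "Factorial_Ring.prime (l::nat)"
    and exponent: "\<And>x. x \<in> carrier G \<Longrightarrow> x [^] l = \<one>"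
  shows "\<exists>e. order G = l ^ e"
proof -
  have *: "p = l" if p: "Factorial_Ring.prime (p::nat)" "p dvd order G" for p
  proof (rule ccontr)
    assume "p \<noteq> l"
    hence cop: "coprime p l" using p l by (simp add: primes_coprime)
    obtain m where "order G = p ^ 1 * m" using p by auto
    then obtain H where H: "subgroup H G" "card H = p ^ 1"
      using sylow_thm[OF p(1) is_group _ fin] by blast
    have "1 < card H" using H p prime_gt_1_nat by simp
    moreover have "finite H" using H(1) fin by (meson finite_subset subgroup.subset)
    ultimately obtain x where x: "x \<in> H" "x \<noteq> \<one>"
      by (metis One_nat_def card_le_Suc0_iff_eq less_le_not_le subgroup.one_closed[OF H(1)])
    have xG: "x \<in> carrier G" using H x by (meson subgroup.mem_carrier)
    interpret H: group "G\<lparr>carrier := H\<rparr>" using H by (simp add: subgroup.subgroup_is_group)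
    have "x [^] p = \<one>"
      using H.pow_order_eq_1[of x] x H nat_pow_consistent[of x p H] by (simp add: order_def)
    hence "ord x dvd p" "ord x dvd l"
      using exponent[OF xG] pow_eq_id[OF xG] by auto
    hence "ord x = 1" using cop by (metis coprime_common_divisor nat_dvd_1_iff_1)
    thus False using x xG pow_eq_id[OF xG, of 1] by simp
  qed
  have pos: "order G \<noteq> 0" using fin order_gt_0_iff_finite by simp
  obtain k m where km: "order G = l ^ k * m" "\<not> l dvd m"
    using multiplicity_decompose'[OF pos, of l] l by (metis not_prime_unit)
  have "m = 1"
  proof (rule ccontr)
    assume "m \<noteq> 1"
    then obtain p where "Factorial_Ring.prime p" "p dvd m" using prime_factor_nat by blast
    thus False using * km by (metis dvd_mult)
  qed
  thus ?thesis using km by auto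
qed

text \<open>\<open>j\<close> is a square root of -1 anticommuting with the involution
  \<open>r\<close>, so it exchanges the parts on which \<open>r\<close> acts as 1 and as -1, and the
  group is the sum of the fixed points and their image under \<open>j\<close>. To avoid dividing by
  2, the decomposition is replaced by two injections in opposite directions, for which absence of
  2-torsion is enough.\<close>

lemma (in comm_group) card_fixed_points_squared:
  assumes fin: "finite (carrier G)"
    and no2: "\<And>x. x \<in> carrier G \<Longrightarrow> x \<otimes> x = \<one> \<Longrightarrow> x = \<one>"
    and r: "r \<in> hom G G" "\<And>x. x \<in> carrier G \<Longrightarrow> r (r x) = x"
    and j: "j \<in> hom G G" "\<And>x. x \<in> carrier G \<Longrightarrow> j (j x) = inv x"
    and rj: "\<And>x. x \<in> carrier G \<Longrightarrow> r (j x) = inv (j (r x))"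
  shows "card {x \<in> carrier G. r x = x} ^ 2 = order G"
proof -
  interpret r: group_hom G G r by unfold_locales (rule r)
  interpret j: group_hom G G j by unfold_locales (rule j)
  have sq: "x = y" if "x \<in> carrier G" "y \<in> carrier G" "x \<otimes> x = y \<otimes> y" for x y
  proof -
    have "(x \<otimes> inv y) \<otimes> (x \<otimes> inv y) = (x \<otimes> x) \<otimes> inv (y \<otimes> y)"
      using that(1,2) m_lcomm[of "inv y" x "inv y"] by (simp add: m_assoc inv_mult)
    also have "\<dots> = \<one>" using that by (simp del: inv_mult)
    finally have "x \<otimes> inv y = \<one>" using that no2[of "x \<otimes> inv y"] by blast
    hence "inv (inv y) = x" using that by (intro inv_equality) auto
    thus ?thesis using that by simp
  qed
  have cancel: "(a \<otimes> b) \<otimes> (a \<otimes> inv b) = a \<otimes> a" if "a \<in> carrier G" "b \<in> carrier G" for a b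
    using that m_lcomm[of b a "inv b"] by (simp add: m_assoc)
  let ?F = "{x \<in> carrier G. r x = x}"
  \<comment> \<open>The first component is fixed by \<open>r\<close>. The quotient
    \<open>x \<otimes> inv (r x)\<close> is inverted by \<open>r\<close>, and \<open>j\<close> turns
    it into a fixed point.\<close>
  define f where "f x = (x \<otimes> r x, j (x \<otimes> inv (r x)))" for x
  have jinj: "x = y" if "x \<in> carrier G" "y \<in> carrier G" "j x = j y" for x y
  proof -
    have "inv x = inv y" using j(2)[OF that(1)] j(2)[OF that(2)] that(3) by simp
    thus ?thesis using that(1,2) inv_inv by metis
  qed
  have "inj_on f (carrier G)"
  proof (rule inj_onI)
    fix x y assume *: "x \<in> carrier G" "y \<in> carrier G" "f x = f y"
    hence 1: "x \<otimes> r x = y \<otimes> r y" by (simp add: f_def)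
    have 2: "x \<otimes> inv (r x) = y \<otimes> inv (r y)"
      by (rule jinj) (use * in \<open>auto simp: f_def\<close>)
    have "x \<otimes> x = y \<otimes> y" using 1 2 * cancel[of x "r x"] cancel[of y "r y"] by simp
    thus "x = y" using * sq by blast
  qed
  moreover have "f ` carrier G \<subseteq> ?F \<times> ?F"
  proof (rule image_subsetI)
    fix x assume x: "x \<in> carrier G"
    have "r (j (x \<otimes> inv (r x))) = inv (j (r x \<otimes> inv x))" using x rj[of "x \<otimes> inv (r x)"] r(2)[OF x] by (simp del: j.hom_mult)
    also have "\<dots> = j (inv (r x \<otimes> inv x))" using x by (simp del: j.hom_mult)
    also have "inv (r x \<otimes> inv x) = x \<otimes> inv (r x)" using x by (simp add: inv_mult m_comm)
    finally show "f x \<in> ?F \<times> ?F" using x r(2) by (simp add: f_def m_comm del: j.hom_mult)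
  qed
  ultimately have le: "order G \<le> card ?F ^ 2"
    unfolding order_def power2_eq_square card_cartesian_product[symmetric]
    by (rule card_inj_on_le) (use fin in auto)
  define g where "g = (\<lambda>(y, z). y \<otimes> j z)"
  have "inj_on g (?F \<times> ?F)"
  proof (rule inj_onI, clarify)
    fix y z y' z'
    assume c: "y \<in> carrier G" "z \<in> carrier G" "y' \<in> carrier G" "z' \<in> carrier G"
      and f: "r y = y" "r z = z" "r y' = y'" "r z' = z'" and "g (y, z) = g (y', z')"
    hence 1: "y \<otimes> j z = y' \<otimes> j z'" by (simp add: g_def)
    \<comment> \<open>\<open>r\<close> keeps the fixed point \<open>y\<close> and inverts
      \<open>j z\<close>; multiplying the two equations leaves the square of
      \<open>y\<close>.\<close>
    have "r (y \<otimes> j z) = r (y' \<otimes> j z')" by (simp add: 1)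
    hence 2: "y \<otimes> inv (j z) = y' \<otimes> inv (j z')" using c f rj by simp
    have "y \<otimes> y = y' \<otimes> y'" using 1 2 c cancel[of y "j z"] cancel[of y' "j z'"] by simp
    hence y: "y = y'" using c sq by blast
    hence "j z = j z'" using 1 c by simp
    thus "y = y' \<and> z = z'" using y jinj[OF c(2) c(4)] by blast
  qed
  moreover have "g ` (?F \<times> ?F) \<subseteq> carrier G" by (auto simp: g_def)
  ultimately have "card (?F \<times> ?F) \<le> order G"
    unfolding order_def using fin by (rule card_inj_on_le)
  thus ?thesis using le unfolding power2_eq_square card_cartesian_product by (rule antisym)
qed

lemma funpow_funpow: "(f ^^ i) ((f ^^ j) x) = (f ^^ (i + j)) x"
  by (simp add: funpow_add)

lemma funpow_gcd_fixed:
  assumes "(f ^^ a) x = x" "(f ^^ b) x = x" "a \<noteq> 0"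
  shows "(f ^^ gcd a b) x = x"
proof -
  have mult: "(f ^^ (m * k)) x = x" if "(f ^^ m) x = x" for m k
    using that by (induction k) (simp_all add: funpow_add)
  obtain u v where "a * u = b * v + gcd a b"
    using bezout_nat[OF assms(3), of b] by blast
  hence "(f ^^ (a * u)) x = (f ^^ gcd a b) ((f ^^ (b * v)) x)"
    by (simp only: funpow_add add.commute[of "b * v"] o_apply)
  thus ?thesis using mult assms by simp
qed

text \<open>Abstracts the group of relative classes that are norms, with \<open>s\<close> a
  generator of the rotations and \<open>c\<close> complex conjugation. \<open>s_half\<close> encodes
  that the norm to the previous layer is trivial, and \<open>c_inverts\<close> is the dihedral
  relation, written without an inverse of \<open>s\<close>.\<close>

locale dihedral_module = comm_group G for G (structure) +
  fixes l n :: nat and s c :: "'a \<Rightarrow> 'a"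
  assumes fin: "finite (carrier G)" and l: "Factorial_Ring.prime l"
    and l_mod: "l mod 8 = 3 \<or> l mod 8 = 5" and n: "n \<ge> 2"
    and exponent: "\<And>x. x \<in> carrier G \<Longrightarrow> x [^] l = \<one>"
    and s: "s \<in> hom G G" and c: "c \<in> hom G G"
    and s_half: "\<And>x. x \<in> carrier G \<Longrightarrow> (s ^^ 2 ^ (n - 1)) x = inv x"
    and c_involution: "\<And>x. x \<in> carrier G \<Longrightarrow> c (c x) = x"
    and c_inverts: "\<And>x. x \<in> carrier G \<Longrightarrow> c (s (c (s x))) = x"
begin

sublocale s: group_hom G G s by unfold_locales (rule s)
sublocale c: group_hom G G c by unfold_locales (rule c)

lemma funpow_hom: "s ^^ k \<in> hom G G"
proof (induction k)
  case (Suc k)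
  thus ?case using Group.hom_compose[OF Suc s] by (simp add: o_def)
qed (auto simp: hom_def)

lemma funpow_closed [simp, intro]: "x \<in> carrier G \<Longrightarrow> (s ^^ k) x \<in> carrier G"
  using funpow_hom[of k] by (auto simp: hom_def)

lemma square_eq_one:
  assumes "x \<in> carrier G" "x \<otimes> x = \<one>"
  shows "x = \<one>"
proof -
  have "odd l" using l_mod by presburger
  then obtain k where k: "l = 2 * k + 1" by (auto elim: oddE)
  have "x [^] (2::nat) = \<one>" using assms by (simp add: numeral_2_eq_2)
  hence "x [^] l = x" using assms by (simp add: k nat_pow_pow[symmetric])
  thus ?thesis using exponent assms by simp
qed

lemma s_period: "x \<in> carrier G \<Longrightarrow> (s ^^ 2 ^ n) x = x"
proof -
  assume x: "x \<in> carrier G"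
  have "(2::nat) ^ n = 2 ^ (n - 1) + 2 ^ (n - 1)" using n by (cases n) auto
  thus ?thesis using s_half x by (simp add: funpow_add)
qed

text \<open>A nontrivial stabiliser in a cyclic 2-group contains the element of order 2. Here that
  element acts as inversion, and only the neutral element is its own inverse.\<close>

lemma s_free:
  assumes x: "x \<in> carrier G" "x \<noteq> \<one>" and "(s ^^ i) x = (s ^^ j) x" "i < 2 ^ n" "j < 2 ^ n"
  shows "i = j"
proof -
  have inj: "y = z" if "(s ^^ i) y = (s ^^ i) z" "y \<in> carrier G" "z \<in> carrier G" "i < 2 ^ n" for i y z
  proof -
    have "(s ^^ (2 ^ n - i)) ((s ^^ i) y) = (s ^^ (2 ^ n - i)) ((s ^^ i) z)" using that by simp
    hence "(s ^^ 2 ^ n) y = (s ^^ 2 ^ n) z" using that(4) unfolding funpow_funpow by simp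
    thus ?thesis using that s_period by simp
  qed
  have *: False if "i < j" "(s ^^ i) x = (s ^^ j) x" "j < 2 ^ n" for i j
  proof -
    define k where "k = j - i"
    have "(s ^^ j) x = (s ^^ i) ((s ^^ k) x)"
      using that(1) by (simp add: k_def funpow_funpow)
    hence "(s ^^ i) x = (s ^^ i) ((s ^^ k) x)" using that(2) by (simp only:)
    hence fixed: "(s ^^ k) x = x"
      using inj[of i x "(s ^^ k) x"] that(1,3) x(1) funpow_closed[OF x(1)] less_trans by metis
    have k: "0 < k" "k < 2 ^ n" using that by (auto simp: k_def)
    \<comment> \<open>The gcd is a proper divisor \<open>2 ^ v\<close> of \<open>2 ^ n\<close>,
      hence it divides \<open>2 ^ (n - 1)\<close>, whose rotation is inversion.\<close>
    have "(s ^^ gcd k (2 ^ n)) x = x" using fixed s_period x k by (intro funpow_gcd_fixed) auto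
    moreover have "gcd k (2 ^ n) dvd 2 ^ n" by simp
    then obtain v where v: "gcd k (2 ^ n) = 2 ^ v" "v \<le> n"
      using divides_primepow_nat[OF two_is_prime_nat] by blast
    moreover have "gcd k (2 ^ n) \<noteq> 2 ^ n"
      using k gcd_le1_nat[of k "2 ^ n"] by linarith
    ultimately have "v < n" by (cases "v = n") auto
    hence "(2::nat) ^ (n - 1) = 2 ^ v * 2 ^ (n - 1 - v)"
      by (subst power_add[symmetric]) (rule arg_cong[of _ _ "power 2"], simp)
    moreover have "(s ^^ (2 ^ v * m)) x = x" for m
      using \<open>(s ^^ gcd k (2 ^ n)) x = x\<close> unfolding v(1) by (induction m) (simp_all add: funpow_add)
    ultimately have "(s ^^ 2 ^ (n - 1)) x = x" by (simp only:)
    hence "inv x = x" by (simp only: s_half[OF x(1)])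
    hence "x \<otimes> x = \<one>" using r_inv[OF x(1)] by simp
    thus False using square_eq_one x by blast
  qed
  show ?thesis
    by (rule linorder_cases[of i j]) (use *[of i j] *[of j i] assms in auto)
qed

lemma s_c_s: "x \<in> carrier G \<Longrightarrow> (s ^^ k) (c ((s ^^ k) x)) = c x"
proof (induction k arbitrary: x)
  case (Suc k)
  have "(s ^^ Suc k) (c ((s ^^ Suc k) x)) = s ((s ^^ k) (c ((s ^^ k) (s x))))"
    by (simp add: funpow_swap1)
  also have "\<dots> = s (c (s x))" using Suc by simp
  also have "\<dots> = c (c (s (c (s x))))" using Suc.prems c_involution by simp
  also have "\<dots> = c x" using Suc.prems c_inverts by simp
  finally show ?case .
qed simp

definition reflection :: "nat \<Rightarrow> 'a \<Rightarrow> 'a" where "reflection k x = (s ^^ k) (c x)"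

lemma reflection_closed [simp, intro]: "x \<in> carrier G \<Longrightarrow> reflection k x \<in> carrier G"
  by (simp add: reflection_def)

lemma reflection_hom: "reflection k \<in> hom G G"
  using Group.hom_compose[OF c funpow_hom[of k]] by (simp add: reflection_def[abs_def] o_def)

lemma reflection_involution: "x \<in> carrier G \<Longrightarrow> reflection k (reflection k x) = x"
  using s_c_s[of "c x" k] c_involution by (simp add: reflection_def)

lemma card_fixed_reflection: "card {x \<in> carrier G. reflection k x = x} ^ 2 = order G"
proof -
  \<comment> \<open>The rotation by \<open>h\<close> squares to inversion. A reflection conjugates
    it to its inverse, which is its composite with inversion; so the two anticommute.\<close>
  define h :: nat where "h = 2 ^ (n - 2)"
  have h: "h + h = 2 ^ (n - 1)"
  proof -
    obtain m where "n = m + 2" using n le_iff_add[of 2 n] by (auto simp: add.commute)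
    thus ?thesis by (simp add: h_def)
  qed
  have jj: "(s ^^ h) ((s ^^ h) x) = inv x" if "x \<in> carrier G" for x
    using s_half[OF that] by (simp add: h funpow_funpow)
  show ?thesis
  proof (rule card_fixed_points_squared[where j = "s ^^ h"])
    fix x assume x: "x \<in> carrier G"
    have "(s ^^ h) ((s ^^ h) (c ((s ^^ h) x))) = (s ^^ h) (c x)" using s_c_s x by simp
    hence "inv (c ((s ^^ h) x)) = (s ^^ h) (c x)" using jj x by simp
    hence "c ((s ^^ h) x) = inv ((s ^^ h) (c x))"
      using x inv_inv[of "c ((s ^^ h) x)"] by simp
    hence "reflection k ((s ^^ h) x) = (s ^^ k) (inv ((s ^^ h) (c x)))" by (simp add: reflection_def)
    also have "\<dots> = inv ((s ^^ k) ((s ^^ h) (c x)))"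
      using x by (intro group_hom.hom_inv[OF group_hom.intro[OF is_group is_group group_hom_axioms.intro[OF funpow_hom]]]) simp
    also have "(s ^^ k) ((s ^^ h) (c x)) = (s ^^ h) (reflection k x)"
      by (simp add: reflection_def add.commute funpow_funpow)
    finally show "reflection k ((s ^^ h) x) = inv ((s ^^ h) (reflection k x))" .
  next
    show "reflection k (reflection k x) = x" if "x \<in> carrier G" for x using that by (rule reflection_involution)
    show "(s ^^ h) ((s ^^ h) x) = inv x" if "x \<in> carrier G" for x using that by (rule jj)
    show "x = \<one>" if "x \<in> carrier G" "x \<otimes> x = \<one>" for x using that by (rule square_eq_one)
  qed (rule fin reflection_hom funpow_hom)+
qed

end

section \<open>Orbit count for the action of the dihedral group\<close>

context dihedral_module begin

lemma funpow_mod: "x \<in> carrier G \<Longrightarrow> (s ^^ (k mod 2 ^ n)) x = (s ^^ k) x"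
  by (rule funpow_mod_eq) (rule s_period)

lemma funpow_period_mult: "x \<in> carrier G \<Longrightarrow> (s ^^ (2 ^ n * k)) x = x"
  using funpow_mod[of x "2 ^ n * k"] by simp

text \<open>Exponents are natural numbers, so the inverse rotation needs a nonnegative one:
  \<open>2 ^ n * k - k\<close> is congruent to -k modulo the period, and the subtraction never
  truncates.\<close>

lemma funpow_inverse:
  assumes "x \<in> carrier G"
  shows "(s ^^ (2 ^ n * k - k)) ((s ^^ k) x) = x"
proof -
  have "k \<le> 2 ^ n * k" by simp
  thus ?thesis using assms funpow_period_mult by (simp add: funpow_funpow del: mult_le_cancel2)
qed

lemma c_funpow:
  assumes "x \<in> carrier G"
  shows "c ((s ^^ k) x) = (s ^^ (2 ^ n * k - k)) (c x)"
  using s_c_s[OF assms, of k] funpow_inverse[of "c ((s ^^ k) x)" k] assms by simp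

definition orbit :: "'a \<Rightarrow> 'a set" where
  "orbit x = range (\<lambda>k. (s ^^ k) x) \<union> range (\<lambda>k. (s ^^ k) (c x))"

lemma orbit_self: "x \<in> orbit x"
  unfolding orbit_def by (auto intro!: range_eqI[of _ _ 0])

lemma orbit_carrier: "x \<in> carrier G \<Longrightarrow> orbit x \<subseteq> carrier G"
  by (auto simp: orbit_def)

lemma funpow_in_orbit: "y \<in> orbit x \<Longrightarrow> (s ^^ k) y \<in> orbit x"
  by (auto simp: orbit_def funpow_funpow)

lemma c_in_orbit: "x \<in> carrier G \<Longrightarrow> y \<in> orbit x \<Longrightarrow> c y \<in> orbit x"
  by (auto simp: orbit_def c_funpow c_involution)

lemma orbit_subset: "x \<in> carrier G \<Longrightarrow> y \<in> orbit x \<Longrightarrow> orbit y \<subseteq> orbit x"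
  using funpow_in_orbit c_in_orbit unfolding orbit_def[of y] by blast

lemma orbit_sym:
  assumes "x \<in> carrier G" "y \<in> orbit x"
  shows "x \<in> orbit y"
proof -
  consider k where "y = (s ^^ k) x" | k where "y = (s ^^ k) (c x)"
    using assms by (auto simp: orbit_def)
  thus ?thesis
  proof cases
    case 1
    thus ?thesis using funpow_in_orbit[OF orbit_self[of y]] funpow_inverse[OF assms(1)] by metis
  next
    case 2
    hence "c x \<in> orbit y"
      using funpow_in_orbit[OF orbit_self[of y]] funpow_inverse[of "c x"] assms(1) by (metis c.hom_closed)
    thus ?thesis using c_in_orbit[of y "c x"] assms c_involution orbit_carrier by auto
  qed
qed

lemma orbit_eq: "x \<in> carrier G \<Longrightarrow> y \<in> orbit x \<Longrightarrow> orbit y = orbit x"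
  using orbit_subset orbit_sym orbit_carrier by (meson subset_antisym subsetD)

definition reflected :: "nat \<Rightarrow> 'a set" where
  "reflected k = {x \<in> carrier G. x \<noteq> \<one> \<and> reflection k x = x}"

text \<open>The elements with trivial stabiliser: rotations act freely on nontrivial elements
  anyway, and the condition excludes every reflection.\<close>

definition generic :: "'a set" where
  "generic = {x \<in> carrier G. x \<noteq> \<one> \<and> c x \<notin> range (\<lambda>k. (s ^^ k) x)}"

lemma funpow_eq_one_iff: "x \<in> carrier G \<Longrightarrow> (s ^^ k) x = \<one> \<longleftrightarrow> x = \<one>"
  using funpow_inverse[of x k] funpow_hom[of "2 ^ n * k - k"] funpow_hom[of k]
  by (metis hom_one is_group)

lemma c_eq_one_iff: "x \<in> carrier G \<Longrightarrow> c x = \<one> \<longleftrightarrow> x = \<one>"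
  using c_involution by (metis c.hom_one)

text \<open>\<open>c x\<close> being the rotation of \<open>x\<close> by \<open>k\<close> means that
  \<open>x\<close> is fixed by the reflection of index \<open>-k\<close>, reduced modulo
  \<open>2 ^ n\<close>.\<close>

lemma reflected_Un_generic:
  "carrier G - {\<one>} = (\<Union>k<2 ^ n. reflected k) \<union> generic" "(\<Union>k<2 ^ n. reflected k) \<inter> generic = {}"
proof -
  have *: "c x \<in> range (\<lambda>k. (s ^^ k) x) \<longleftrightarrow> (\<exists>k<2 ^ n. reflection k x = x)" if x: "x \<in> carrier G" for x
  proof
    assume "c x \<in> range (\<lambda>k. (s ^^ k) x)"
    then obtain k where "c x = (s ^^ k) x" by auto
    hence "(s ^^ (2 ^ n * k - k)) (c x) = x" using funpow_inverse x by simp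
    hence "reflection ((2 ^ n * k - k) mod 2 ^ n) x = x" using x by (simp add: reflection_def funpow_mod)
    thus "\<exists>k<2 ^ n. reflection k x = x" by (metis mod_less_divisor zero_less_numeral zero_less_power)
  next
    assume "\<exists>k<2 ^ n. reflection k x = x"
    then obtain k where "(s ^^ k) (c x) = x" by (auto simp: reflection_def)
    hence "c x = (s ^^ (2 ^ n * k - k)) x" using funpow_inverse[of "c x" k] x by simp
    thus "c x \<in> range (\<lambda>k. (s ^^ k) x)" by simp
  qed
  show "carrier G - {\<one>} = (\<Union>k<2 ^ n. reflected k) \<union> generic"
    using * by (auto simp: reflected_def generic_def)
  show "(\<Union>k<2 ^ n. reflected k) \<inter> generic = {}"
    using * by (auto simp: reflected_def generic_def)
qed

lemma card_orbit:
  assumes "x \<in> generic"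
  shows "card (orbit x) = 2 ^ (n + 1)"
proof -
  have x: "x \<in> carrier G" "x \<noteq> \<one>" "c x \<notin> range (\<lambda>k. (s ^^ k) x)"
    using assms by (auto simp: generic_def)
  have range: "range (\<lambda>k. (s ^^ k) y) = (\<lambda>k. (s ^^ k) y) ` {..<2 ^ n}" if "y \<in> carrier G" for y
  proof -
    have "(s ^^ k) y \<in> (\<lambda>k. (s ^^ k) y) ` {..<2 ^ n}" for k
      by (rule image_eqI[of _ _ "k mod 2 ^ n"]) (use that in \<open>auto simp: funpow_mod\<close>)
    thus ?thesis by blast
  qed
  have card: "card (range (\<lambda>k. (s ^^ k) y)) = 2 ^ n" if "y \<in> carrier G" "y \<noteq> \<one>" for y
    unfolding range[OF that(1)]
    by (subst card_image) (auto intro!: inj_onI s_free[of y] that)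
  have disj: "range (\<lambda>k. (s ^^ k) x) \<inter> range (\<lambda>k. (s ^^ k) (c x)) = {}"
  proof (rule equals0I)
    fix y assume "y \<in> range (\<lambda>k. (s ^^ k) x) \<inter> range (\<lambda>k. (s ^^ k) (c x))"
    then obtain i j where "(s ^^ i) x = (s ^^ j) (c x)" by auto
    hence "(s ^^ (2 ^ n * j - j)) ((s ^^ i) x) = c x" using funpow_inverse[of "c x" j] x by simp
    thus False using x(3) by (metis funpow_funpow rangeI)
  qed
  have fin: "finite (range (\<lambda>k. (s ^^ k) y))" if "y \<in> carrier G" for y
    unfolding range[OF that] by simp
  show ?thesis unfolding orbit_def
    using card_Un_disjoint[OF fin fin disj] card[of x] card[of "c x"] x c_eq_one_iff by simp
qed

lemma card_generic: "2 ^ (n + 1) dvd card generic"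
proof -
  have sub: "orbit x \<subseteq> generic" if "x \<in> generic" for x
  proof
    fix y assume y: "y \<in> orbit x"
    have x: "x \<in> carrier G" "x \<noteq> \<one>" "c x \<notin> range (\<lambda>k. (s ^^ k) x)"
      using that by (auto simp: generic_def)
    have yG: "y \<in> carrier G" using y x orbit_carrier by blast
    have "y \<noteq> \<one>"
      using y x(1,2) funpow_eq_one_iff[of x] funpow_eq_one_iff[of "c x"] c_eq_one_iff[of x]
      by (force simp: orbit_def)
    moreover have "c y \<notin> range (\<lambda>k. (s ^^ k) y)"
    proof
      assume "c y \<in> range (\<lambda>k. (s ^^ k) y)"
      then obtain k where k: "c y = (s ^^ k) y" by auto
      \<comment> \<open>If \<open>c y\<close> were a rotation of \<open>y\<close>, the orbit would
        consist of rotations of \<open>y\<close> only, at most \<open>2 ^ n\<close> elements instead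
        of \<open>2 ^ (n + 1)\<close>.\<close>
      have "orbit y \<subseteq> range (\<lambda>k. (s ^^ k) y)" unfolding orbit_def k by (auto simp: funpow_funpow)
      hence "orbit x \<subseteq> range (\<lambda>k. (s ^^ k) y)" using orbit_eq[OF x(1) y] by simp
      hence "card (orbit x) \<le> card ((\<lambda>k. (s ^^ k) y) ` {..<2 ^ n})"
      proof (intro card_mono subsetI)
        fix z assume "z \<in> orbit x"
        then obtain k where "z = (s ^^ k) y" using \<open>orbit x \<subseteq> _\<close> by blast
        thus "z \<in> (\<lambda>k. (s ^^ k) y) ` {..<2 ^ n}"
          by (intro image_eqI[of _ _ "k mod 2 ^ n"]) (use yG in \<open>auto simp: funpow_mod\<close>)
      qed simp
      also have "\<dots> \<le> 2 ^ n" using card_image_le[of "{..<2 ^ n :: nat}"] by force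
      finally show False using card_orbit[OF that] by simp
    qed
    ultimately show "y \<in> generic" using yG by (simp add: generic_def)
  qed
  have eq: "\<Union> (orbit ` generic) = generic" using sub orbit_self by blast
  have fing: "finite generic" using fin by (auto simp: generic_def)
  have "2 ^ (n + 1) * card (orbit ` generic) = card (\<Union> (orbit ` generic))"
  proof (rule card_partition)
    show "finite (orbit ` generic)" using fing by simp
    show "finite (\<Union> (orbit ` generic))" using fing eq by simp
    show "card C = 2 ^ (n + 1)" if "C \<in> orbit ` generic" for C using that card_orbit by auto
    fix C D assume "C \<in> orbit ` generic" "D \<in> orbit ` generic" "C \<noteq> D"
    moreover have "generic \<subseteq> carrier G" by (auto simp: generic_def)
    ultimately show "C \<inter> D = {}" using orbit_eq by blast
  qed
  thus ?thesis unfolding eq by (metis dvd_triv_left)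
qed

theorem order_eq_power: "\<exists>e. order G = l ^ (2 ^ (n - 1) * e)"
proof -
  obtain e where e: "order G = l ^ e"
    using order_eq_prime_power[OF fin l exponent] by blast
  define a where "a = card {x \<in> carrier G. reflection 0 x = x}"
  have a: "a ^ 2 = order G" unfolding a_def by (rule card_fixed_reflection)
  have "odd l" using l_mod by presburger
  hence "odd (order G)" by (simp add: e)
  hence "odd a" by (simp flip: a)
  \<comment> \<open>Oddness of \<open>a\<close> supplies the factor 2 beyond \<open>2 ^ n\<close>:
    after removal of the neutral element each reflection contributes the even number
    \<open>2 * b\<close>.\<close>
  then obtain b where b: "a = 2 * b + 1" by (auto elim: oddE)
  have card: "card (reflected k) = 2 * b" for k
  proof -
    have "card {x \<in> carrier G. reflection k x = x} ^ 2 = a ^ 2" using card_fixed_reflection a by simp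
    hence "card {x \<in> carrier G. reflection k x = x} = a" by (rule power2_eq_imp_eq) auto
    moreover have "\<one> \<in> {x \<in> carrier G. reflection k x = x}"
      using hom_one[OF reflection_hom is_group is_group] by simp
    moreover have "reflected k = {x \<in> carrier G. reflection k x = x} - {\<one>}" by (auto simp: reflected_def)
    ultimately show ?thesis using fin b by simp
  qed
  have "card (\<Union>k<2 ^ n. reflected k) = (\<Sum>k<2 ^ n. card (reflected k))"
  proof (rule card_UN_disjoint)
    \<comment> \<open>An element fixed by two reflections gives two equal rotations of
      \<open>c x\<close>, which freeness excludes.\<close>
    show "\<forall>i\<in>{..<2 ^ n}. \<forall>j\<in>{..<2 ^ n}. i \<noteq> j \<longrightarrow> reflected i \<inter> reflected j = {}"
    proof (intro ballI impI equals0I)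
      fix i j x assume "i \<in> {..<2 ^ n}" "j \<in> {..<2 ^ n}" "i \<noteq> j" "x \<in> reflected i \<inter> reflected j"
      thus False using s_free[of "c x" i j] c_eq_one_iff by (auto simp: reflected_def reflection_def)
    qed
  qed (use fin in \<open>auto simp: reflected_def\<close>)
  also have "\<dots> = 2 ^ (n + 1) * b" by (simp add: card)
  finally have 1: "card (\<Union>k<2 ^ n. reflected k) = 2 ^ (n + 1) * b" .
  have "card (carrier G - {\<one>}) = card (\<Union>k<2 ^ n. reflected k) + card generic"
    unfolding reflected_Un_generic(1)
    by (rule card_Un_disjoint) (use fin reflected_Un_generic(2) in \<open>auto simp: reflected_def generic_def\<close>)
  hence "2 ^ (n + 1) dvd card (carrier G - {\<one>})" using 1 card_generic by simp
  moreover have "order G = card (carrier G - {\<one>}) + 1"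
    unfolding order_def using fin one_closed by (metis Suc_eq_plus1 card_Suc_Diff1)
  ultimately obtain q where "l ^ e = 2 ^ (n + 1) * q + 1" using e by auto
  moreover have "(1::nat) < 2 ^ (n + 1)" by (rule one_less_power) auto
  ultimately have "l ^ e mod 2 ^ (n + 1) = 1" by (metis mod_less mod_mult_self4)
  moreover have "n + 1 = (n - 1) + 2" "n - 1 \<ge> 1" using n by auto
  ultimately have "2 ^ (n - 1) dvd e" using two_power_dvd_exponent[OF l_mod, of "n - 1" e] by simp
  thus ?thesis using e by auto
qed

end

section \<open>Counting classes of powers by growth\<close>

text \<open>If a > b, the powers of a / b outgrow any constant. This discards every constant of an
  iterated count at once.\<close>

lemma power_growth_bound:
  fixes a b C :: real
  assumes "a > 0" "b > 0" "\<And>k::nat. a ^ k \<le> C * b ^ k"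
  shows "a \<le> b"
proof (rule ccontr)
  assume "\<not> a \<le> b"
  hence "a / b > 1" using assms by simp
  then obtain k where "(a / b) ^ k > C" using real_arch_pow by blast
  moreover have "(a / b) ^ k \<le> C" using assms(3)[of k] assms(2) by (simp add: power_divide field_simps)
  ultimately show False by simp
qed

text \<open>A group with \<open>d\<close> additive logarithms and finitely many elements in each
  box. It plays the role of a lattice of rank at most \<open>d\<close>, up to a finite kernel, but
  no basis is chosen: only numbers of elements in boxes are compared.\<close>

locale discrete_logs =
  fixes R :: "complex set" and f :: "nat \<Rightarrow> complex \<Rightarrow> real" and d :: nat
  assumes one: "1 \<in> R" and nonzero: "0 \<notin> R"
    and mult: "\<And>u v. u \<in> R \<Longrightarrow> v \<in> R \<Longrightarrow> u * v \<in> R"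
    and inverse: "\<And>u. u \<in> R \<Longrightarrow> inverse u \<in> R"
    and log_mult: "\<And>k u v. k < d \<Longrightarrow> u \<in> R \<Longrightarrow> v \<in> R \<Longrightarrow> f k (u * v) = f k u + f k v"
    and finite_bounded: "\<And>B. finite {u \<in> R. \<forall>k<d. \<bar>f k u\<bar> \<le> B}"
begin

definition box :: "real \<Rightarrow> complex set" where
  "box B = {u \<in> R. \<forall>k<d. \<bar>f k u\<bar> \<le> B}"

lemma finite_box: "finite (box B)"
  unfolding box_def by (rule finite_bounded)

lemma log_one: "k < d \<Longrightarrow> f k 1 = 0"
  using log_mult[of k 1 1] one by simp

lemma log_inverse: "k < d \<Longrightarrow> u \<in> R \<Longrightarrow> f k (inverse u) = - f k u"
  using log_mult[of k u "inverse u"] log_one[of k] inverse[of u] nonzero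
  by (metis add_eq_0_iff right_inverse)

lemma power_closed: "u \<in> R \<Longrightarrow> u ^ m \<in> R"
  by (induction m) (auto simp: one mult)

lemma log_power: "k < d \<Longrightarrow> u \<in> R \<Longrightarrow> f k (u ^ m) = m * f k u"
  by (induction m) (auto simp: log_one log_mult power_closed algebra_simps)

text \<open>Elements whose logarithms lie in the same unit cube differ by an element of \<open>box 1\<close>.\<close>

lemma card_box_le:
  fixes m :: nat
  shows "card (box m) \<le> card (box 1) * (2 * m + 1) ^ d"
proof -
  define q where "q u = restrict (\<lambda>k. \<lfloor>f k u\<rfloor>) {..<d}" for u
  have "q ` box m \<subseteq> {..<d} \<rightarrow>\<^sub>E {- int m..int m}"
  proof (rule image_subsetI)
    fix u assume u: "u \<in> box m"
    have "- int m \<le> \<lfloor>f k u\<rfloor> \<and> \<lfloor>f k u\<rfloor> \<le> int m" if "k < d" for k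
    proof -
      have "\<bar>f k u\<bar> \<le> m" using u that by (auto simp: box_def)
      thus ?thesis by linarith
    qed
    thus "q u \<in> {..<d} \<rightarrow>\<^sub>E {- int m..int m}" by (auto simp: q_def)
  qed
  moreover have "finite ({..<d} \<rightarrow>\<^sub>E {- int m..int m})" by (intro finite_PiE) auto
  ultimately have "card (q ` box m) \<le> card ({..<d} \<rightarrow>\<^sub>E {- int m..int m})"
    by (intro card_mono)
  also have "\<dots> = (2 * m + 1) ^ d"
  proof -
    have "nat (2 * int m + 1) = 2 * m + 1" by simp
    thus ?thesis by (simp add: card_PiE del: nat_add_distrib)
  qed
  finally have le: "card (q ` box m) \<le> (2 * m + 1) ^ d" .
  have fibre: "card {u \<in> box m. q u = y} \<le> card (box 1)" for y
  proof (cases "{u \<in> box m. q u = y} = {}")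
    case False
    then obtain v where v: "v \<in> box m" "q v = y" by blast
    have vR: "v \<in> R" using v by (simp add: box_def)
    hence v0: "v \<noteq> 0" using nonzero by blast
    have sub: "(\<lambda>u. u * inverse v) ` {u \<in> box m. q u = y} \<subseteq> box 1"
    proof (rule image_subsetI)
      fix u assume u: "u \<in> {u \<in> box m. q u = y}"
      hence uR: "u \<in> R" by (simp add: box_def)
      have "\<bar>f k (u * inverse v)\<bar> \<le> 1" if k: "k < d" for k
      proof -
        have "q u k = q v k" using u v(2) by simp
        hence "\<lfloor>f k u\<rfloor> = \<lfloor>f k v\<rfloor>" using k by (simp add: q_def)
        hence "\<bar>f k u - f k v\<bar> \<le> 1" by linarith
        thus ?thesis using k uR vR by (simp add: log_mult log_inverse inverse)
      qed
      thus "u * inverse v \<in> box 1" using uR vR by (simp add: box_def mult inverse)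
    qed
    have "inj_on (\<lambda>u. u * inverse v) {u \<in> box m. q u = y}"
      using v0 by (intro inj_onI) simp
    thus ?thesis using sub finite_box by (rule card_inj_on_le)
  next
    case True
    thus ?thesis by (simp only: card.empty)
  qed
  have "box m = (\<Union>y\<in>q ` box m. {u \<in> box m. q u = y})" by blast
  hence "card (box m) \<le> (\<Sum>y\<in>q ` box m. card {u \<in> box m. q u = y})"
    using card_UN_le[of "q ` box m" "\<lambda>y. {u \<in> box m. q u = y}"] finite_box by simp
  also have "\<dots> \<le> (\<Sum>y\<in>q ` box m. card (box 1))" by (intro sum_mono fibre)
  also have "\<dots> \<le> card (box 1) * (2 * m + 1) ^ d" using le by simp
  finally show ?thesis .
qed

text \<open>The map (t, v) to t v^l is injective when \<open>T\<close> represents distinct classes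
  and there is no l-torsion, and it enlarges a box by the factor \<open>l\<close> up to a constant.
  After k iterations there are at least |T|^k elements in a box of side of order l^k, which holds at
  most a constant times l^(kd).\<close>

lemma card_distinct_classes_le:
  fixes l :: nat
  assumes l: "l \<ge> 2" and torsion: "\<And>u. u \<in> R \<Longrightarrow> u ^ l = 1 \<Longrightarrow> u = 1"
    and T: "finite T" "T \<subseteq> R"
    and distinct: "\<And>t t' v. t \<in> T \<Longrightarrow> t' \<in> T \<Longrightarrow> v \<in> R \<Longrightarrow> t = t' * v ^ l \<Longrightarrow> t = t'"
  shows "card T \<le> l ^ d"
proof (cases "T = {}")
  case False
  \<comment> \<open>The inserted 0 keeps \<open>S\<close> nonempty for \<open>d = 0\<close>, so that
    \<open>Max S\<close> is meaningful.\<close>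
  define S where "S = insert 0 ((\<lambda>(k, t). \<bar>f k t\<bar>) ` ({..<d} \<times> T))"
  have finS: "finite S" using T by (auto simp: S_def)
  obtain C :: nat where C: "Max S \<le> C" using real_arch_simple by blast
  have logT: "\<bar>f k t\<bar> \<le> C" if "k < d" "t \<in> T" for k t
  proof -
    have "\<bar>f k t\<bar> \<in> S" using that by (auto simp: S_def)
    thus ?thesis using Max_ge[OF finS] C order_trans by blast
  qed
  have step: "card T * card (box B) \<le> card (box (l * B + C))" for B :: nat
  proof -
    define h :: "complex \<times> complex \<Rightarrow> complex" where "h = (\<lambda>(t, v). t * v ^ l)"
    have "inj_on h (T \<times> box B)"
    proof (rule inj_onI, clarify)
      fix t v t' v' assume T': "t \<in> T" "t' \<in> T" and "v \<in> box B" "v' \<in> box B" and "h (t, v) = h (t', v')"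
      hence R: "t \<in> R" "t' \<in> R" "v \<in> R" "v' \<in> R" and eq: "t * v ^ l = t' * v' ^ l"
        using T by (auto simp: h_def box_def)
      have nz: "v \<noteq> 0" "v' \<noteq> 0" "t \<noteq> 0" "t' \<noteq> 0" using R nonzero by metis+
      have "t = t' * (v' * inverse v) ^ l" using eq nz by (simp add: field_simps)
      hence t: "t = t'" by (rule distinct[OF T' mult[OF R(4) inverse[OF R(3)]]])
      have "(v * inverse v') ^ l = 1" using eq nz by (simp add: t field_simps)
      hence "v * inverse v' = 1" using torsion R by (meson mult inverse)
      hence "v = v'" using nz by (simp add: field_simps)
      thus "t = t' \<and> v = v'" using t by simp
    qed
    moreover have "h ` (T \<times> box B) \<subseteq> box (l * B + C)"
    proof (rule image_subsetI, clarify)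
      fix t v assume t: "t \<in> T" and v: "v \<in> box B"
      have R: "t \<in> R" "v \<in> R" using t v T by (auto simp: box_def)
      have "\<bar>f k (t * v ^ l)\<bar> \<le> l * B + C" if k: "k < d" for k
      proof -
        have "\<bar>f k (t * v ^ l)\<bar> \<le> \<bar>f k t\<bar> + \<bar>l * f k v\<bar>"
          using k R by (simp add: log_mult log_power power_closed)
        also have "\<bar>f k t\<bar> \<le> C" using logT k t by blast
        also have "\<bar>l * f k v\<bar> \<le> l * B" using v k by (auto simp: box_def abs_mult intro!: mult_left_mono)
        finally show ?thesis by simp
      qed
      thus "h (t, v) \<in> box (l * B + C)" using R by (auto simp: box_def h_def mult power_closed)
    qed
    ultimately have "card (T \<times> box B) \<le> card (box (l * B + C))"
      using finite_box by (rule card_inj_on_le)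
    thus ?thesis by (simp add: card_cartesian_product)
  qed
  \<comment> \<open>Sizes of the successive boxes. Adding \<open>C\<close> makes their growth
    geometric, because 2C \<le> lC.\<close>
  define B where "B = rec_nat 0 (\<lambda>_ b. l * b + C)"
  have B: "B 0 = 0" "\<And>k. B (Suc k) = l * B k + C" by (simp_all add: B_def)
  have B_le: "B k + C \<le> l ^ k * C" for k
  proof (induction k)
    case (Suc k)
    have "B (Suc k) + C = l * B k + 2 * C" by (simp add: B)
    also have "\<dots> \<le> l * B k + l * C" using l by simp
    also have "\<dots> \<le> l * (l ^ k * C)" using Suc by (simp flip: distrib_left)
    finally show ?case by simp
  qed (simp add: B)
  have "1 \<le> card (box 0)"
    using finite_box[of 0] one log_one by (auto simp: box_def Suc_le_eq card_gt_0_iff)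
  have lower: "card T ^ k \<le> card (box (B k))" for k
  proof (induction k)
    case 0 thus ?case using \<open>1 \<le> card (box 0)\<close> by (simp add: B)
  next
    case (Suc k)
    have "card T ^ Suc k \<le> card T * card (box (B k))" using Suc by simp
    also have "\<dots> \<le> card (box (B (Suc k)))" using step[of "B k"] by (simp add: B)
    finally show ?case .
  qed
  have "real (card T) \<le> real l ^ d"
  proof (rule power_growth_bound)
    fix k
    have "card T ^ k \<le> card (box 1) * (2 * B k + 1) ^ d"
      using lower card_box_le order_trans by blast
    also have "2 * B k + 1 \<le> (2 * C + 1) * l ^ k"
    proof -
      have "2 * B k + 1 \<le> 2 * (l ^ k * C) + l ^ k" using B_le[of k] l by (intro add_mono) auto
      thus ?thesis by (simp add: algebra_simps)
    qed
    hence "card (box 1) * (2 * B k + 1) ^ d \<le> card (box 1) * ((2 * C + 1) * l ^ k) ^ d"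
      by (intro mult_left_mono power_mono) auto
    also have "\<dots> = card (box 1) * (2 * C + 1) ^ d * (l ^ d) ^ k"
      by (simp only: power_mult_distrib power_mult[symmetric] mult.commute[of d k] mult.assoc)
    finally have "real (card T ^ k) \<le> real (card (box 1) * (2 * C + 1) ^ d * (l ^ d) ^ k)"
      by (rule of_nat_mono)
    thus "real (card T) ^ k \<le> real (card (box 1) * (2 * C + 1) ^ d) * (real l ^ d) ^ k" by simp
  qed (use l False T card_gt_0_iff in auto)
  thus ?thesis by (simp flip: of_nat_power)
qed simp

end

section \<open>Sums and products of algebraic integers\<close>

text \<open>Meant for finite \<open>S\<close>; indexing the coefficients by the elements themselves
  avoids an enumeration until a matrix is needed.\<close>

definition int_span :: "'a::comm_ring_1 set \<Rightarrow> 'a set" where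
  "int_span S = range (\<lambda>f. \<Sum>w\<in>S. of_int (f w) * w)"

lemma int_span_0: "0 \<in> int_span S"
  unfolding int_span_def by (rule range_eqI[of _ _ "\<lambda>_. 0"]) simp

lemma int_span_base: "finite S \<Longrightarrow> w \<in> S \<Longrightarrow> w \<in> int_span S"
  unfolding int_span_def
  by (rule range_eqI[of _ _ "\<lambda>v. if v = w then 1 else 0"]) (simp add: if_distrib if_distribR cong: if_cong)

lemma int_span_add:
  assumes "x \<in> int_span S" "y \<in> int_span S"
  shows "x + y \<in> int_span S"
proof -
  obtain f g where "x = (\<Sum>w\<in>S. of_int (f w) * w)" "y = (\<Sum>w\<in>S. of_int (g w) * w)"
    using assms by (auto simp: int_span_def)
  hence "x + y = (\<Sum>w\<in>S. of_int (f w + g w) * w)"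
    by (simp add: sum.distrib distrib_right)
  thus ?thesis unfolding int_span_def by (rule range_eqI[of _ _ "\<lambda>w. f w + g w"])
qed

lemma int_span_mult:
  assumes "x \<in> int_span S"
  shows "of_int k * x \<in> int_span S"
proof -
  obtain f where "x = (\<Sum>w\<in>S. of_int (f w) * w)"
    using assms by (auto simp: int_span_def)
  hence "of_int k * x = (\<Sum>w\<in>S. of_int (k * f w) * w)"
    by (simp add: sum_distrib_left mult.assoc)
  thus ?thesis unfolding int_span_def by (rule range_eqI[of _ _ "\<lambda>w. k * f w"])
qed

lemma int_span_sum: "(\<And>i. i \<in> I \<Longrightarrow> g i \<in> int_span S) \<Longrightarrow> sum g I \<in> int_span S"
  by (induction I rule: infinite_finite_induct) (auto simp: int_span_0 int_span_add)

lemma int_span_stable: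
  assumes "\<And>v. v \<in> S \<Longrightarrow> x * v \<in> int_span S" "y \<in> int_span S"
  shows "x * y \<in> int_span S"
proof -
  obtain f where "y = (\<Sum>w\<in>S. of_int (f w) * w)"
    using assms(2) by (auto simp: int_span_def)
  hence "x * y = (\<Sum>w\<in>S. of_int (f w) * (x * w))"
    by (simp add: sum_distrib_left mult.left_commute)
  thus ?thesis using assms(1) by (auto intro!: int_span_sum int_span_mult)
qed

text \<open>The determinant trick: multiplication by \<open>x\<close> on the span of
  \<open>S\<close> is given by an integer matrix, and the vector of elements of \<open>S\<close> is
  an eigenvector for \<open>x\<close>. So \<open>x\<close> is a root of the monic characteristic
  polynomial. The element 1 makes the eigenvector nonzero.\<close>

lemma algebraic_int_of_stable:
  fixes x :: complex
  assumes fin: "finite S" and "1 \<in> S" and stable: "\<And>v. v \<in> S \<Longrightarrow> x * v \<in> int_span S"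
  shows "algebraic_int x"
proof -
  obtain h where h: "bij_betw h {0..<card S} S"
    using fin ex_bij_betw_nat_finite by blast
  define N where "N = card S"
  have "\<forall>v\<in>S. \<exists>f. x * v = (\<Sum>w\<in>S. of_int (f w) * w)"
    using stable by (auto simp: int_span_def)
  then obtain a where a: "\<And>v. v \<in> S \<Longrightarrow> x * v = (\<Sum>w\<in>S. of_int (a v w) * w)"
    by metis
  define A where "A = mat N N (\<lambda>(i, j). a (h i) (h j))"
  define B where "B = map_mat (of_int :: int \<Rightarrow> complex) A"
  define v where "v = vec N h"
  have A: "A \<in> carrier_mat N N" by (simp add: A_def)
  have B: "B \<in> carrier_mat N N" by (simp add: A_def B_def)
  have "B *\<^sub>v v = x \<cdot>\<^sub>v v"
  proof (rule eq_vecI)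
    show "dim_vec (B *\<^sub>v v) = dim_vec (x \<cdot>\<^sub>v v)" using B by (simp add: v_def)
    fix i assume "i < dim_vec (x \<cdot>\<^sub>v v)"
    hence i: "i < N" by (simp add: v_def)
    hence "h i \<in> S" using h by (auto simp: N_def bij_betw_def)
    have "(B *\<^sub>v v) $ i = (\<Sum>j = 0..<N. of_int (a (h i) (h j)) * h j)"
      using i by (simp add: B_def A_def v_def scalar_prod_def)
    also have "\<dots> = (\<Sum>w\<in>S. of_int (a (h i) w) * w)"
      using h unfolding N_def by (rule sum.reindex_bij_betw)
    also have "\<dots> = x * h i" using a \<open>h i \<in> S\<close> by simp
    finally show "(B *\<^sub>v v) $ i = (x \<cdot>\<^sub>v v) $ i" using i by (simp add: v_def)
  qed
  moreover have "v \<noteq> 0\<^sub>v N"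
  proof
    assume v0: "v = 0\<^sub>v N"
    have "1 \<in> h ` {0..<N}" using h \<open>1 \<in> S\<close> by (simp add: N_def bij_betw_def)
    then obtain i where "i < N" "h i = 1" by auto
    thus False using arg_cong[OF v0, of "\<lambda>u. vec_index u i"] by (simp add: v_def)
  qed
  ultimately have "eigenvector B v x" using B by (auto simp: eigenvector_def v_def)
  hence "poly (char_poly B) x = 0" using eigenvalue_root_char_poly[OF B] by (auto simp: eigenvalue_def)
  moreover have "char_poly B = map_poly of_int (char_poly A)"
    unfolding B_def by (rule of_int_hom.char_poly_hom[OF A])
  moreover have "lead_coeff (char_poly A) = 1" using degree_monic_char_poly[OF A] by auto
  ultimately show ?thesis unfolding algebraic_int_altdef_ipoly by metis
qed

lemma algebraic_int_power_stable:
  fixes x :: complex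
  assumes "algebraic_int x"
  obtains m where "m > 0" "x ^ m \<in> int_span ((\<lambda>i. x ^ i) ` {..<m})"
proof -
  obtain p where p: "poly (map_poly of_int p) x = 0" "lead_coeff p = 1"
    using assms by (auto simp: algebraic_int_altdef_ipoly)
  define m where "m = degree p"
  have "m \<noteq> 0"
  proof
    assume "m = 0"
    then obtain a where "p = [:a:]" unfolding m_def by (metis degree_0_id)
    thus False using p by (simp add: of_int_poly)
  qed
  have pm: "coeff p m = 1" using p by (simp add: m_def)
  have "0 = (\<Sum>i\<le>m. of_int (coeff p i) * x ^ i)"
    using p(1) by (simp add: poly_altdef m_def)
  also have "\<dots> = x ^ m + (\<Sum>i<m. of_int (coeff p i) * x ^ i)"
    using pm by (simp add: lessThan_Suc_atMost[symmetric])
  finally have "x ^ m = (\<Sum>i<m. of_int (- coeff p i) * x ^ i)"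
    by (simp add: sum_negf eq_neg_iff_add_eq_0)
  also have "\<dots> \<in> int_span ((\<lambda>i. x ^ i) ` {..<m})"
    by (intro int_span_sum int_span_mult int_span_base) auto
  finally show ?thesis using that \<open>m \<noteq> 0\<close> by auto
qed

text \<open>The monomials in \<open>x\<close> and \<open>y\<close> with exponents below the degrees
  of two monic equations span a module stable under both numbers; sums and products are then handled
  alike.\<close>

lemma algebraic_int_common_module:
  fixes x y :: complex
  assumes "algebraic_int x" "algebraic_int y"
  obtains S where "finite S" "1 \<in> S" "\<And>v. v \<in> S \<Longrightarrow> x * v \<in> int_span S" "\<And>v. v \<in> S \<Longrightarrow> y * v \<in> int_span S"
proof -
  obtain m where m: "m > 0" "x ^ m \<in> int_span ((\<lambda>i. x ^ i) ` {..<m})"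
    using algebraic_int_power_stable[OF assms(1)] by blast
  obtain k where k: "k > 0" "y ^ k \<in> int_span ((\<lambda>i. y ^ i) ` {..<k})"
    using algebraic_int_power_stable[OF assms(2)] by blast
  define S where "S = (\<lambda>(i, j). x ^ i * y ^ j) ` ({..<m} \<times> {..<k})"
  have S: "finite S" by (simp add: S_def)
  have mem: "x ^ i * y ^ j \<in> int_span S" if "i < m" "j < k" for i j
    using that S by (auto simp: S_def intro!: int_span_base)
  have span_mult: "z * c \<in> int_span S" if z: "z \<in> int_span T" and "\<And>w. w \<in> T \<Longrightarrow> w * c \<in> int_span S" for z c and T :: "complex set"
  proof -
    obtain f where "z = (\<Sum>w\<in>T. of_int (f w) * w)"
      using z by (auto simp: int_span_def)
    hence "z * c = (\<Sum>w\<in>T. of_int (f w) * (w * c))" by (simp add: sum_distrib_right mult.assoc)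
    thus ?thesis using that(2) by (auto intro!: int_span_sum int_span_mult)
  qed
  show ?thesis
  proof
    show "finite S" by (rule S)
    show "1 \<in> S" using m(1) k(1) by (force simp: S_def image_iff)
    fix v assume "v \<in> S"
    then obtain i j where v: "v = x ^ i * y ^ j" "i < m" "j < k" by (auto simp: S_def)
    show "x * v \<in> int_span S"
    proof (cases "Suc i < m")
      case True
      thus ?thesis using mem[of "Suc i" j] v by (simp add: mult.assoc)
    next
      case False
      hence "Suc i = m" using v by simp
      hence "x * v = x ^ m * y ^ j" using v by (simp add: mult.assoc flip: power_Suc)
      also have "\<dots> \<in> int_span S" by (rule span_mult[OF m(2)]) (use mem v in auto)
      finally show ?thesis .
    qed
    show "y * v \<in> int_span S"
    proof (cases "Suc j < k")
      case True
      thus ?thesis using mem[of i "Suc j"] v by (simp add: mult_ac)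
    next
      case False
      hence "Suc j = k" using v by simp
      hence "y * v = y ^ k * x ^ i" using v by (simp add: mult_ac flip: power_Suc)
      also have "\<dots> \<in> int_span S" by (rule span_mult[OF k(2)]) (use mem v in \<open>auto simp: mult.commute\<close>)
      finally show ?thesis .
    qed
  qed
qed

lemma algebraic_int_add:
  fixes x y :: complex
  assumes "algebraic_int x" "algebraic_int y"
  shows "algebraic_int (x + y)"
proof -
  obtain S where S: "finite S" "1 \<in> S" "\<And>v. v \<in> S \<Longrightarrow> x * v \<in> int_span S" "\<And>v. v \<in> S \<Longrightarrow> y * v \<in> int_span S"
    using algebraic_int_common_module[OF assms] by blast
  show ?thesis
    by (rule algebraic_int_of_stable[OF S(1,2)]) (auto simp: distrib_right intro!: int_span_add S)
qed

lemma algebraic_int_mult: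
  fixes x y :: complex
  assumes "algebraic_int x" "algebraic_int y"
  shows "algebraic_int (x * y)"
proof -
  obtain S where S: "finite S" "1 \<in> S" "\<And>v. v \<in> S \<Longrightarrow> x * v \<in> int_span S" "\<And>v. v \<in> S \<Longrightarrow> y * v \<in> int_span S"
    using algebraic_int_common_module[OF assms] by blast
  show ?thesis
    by (rule algebraic_int_of_stable[OF S(1,2)]) (subst mult.assoc, rule int_span_stable[of S x], simp_all add: S)
qed

lemma algebraic_int_diff:
  fixes x y :: complex
  shows "algebraic_int x \<Longrightarrow> algebraic_int y \<Longrightarrow> algebraic_int (x - y)"
  using algebraic_int_add[of x "- y"] by simp

lemma algebraic_int_1: "algebraic_int (1::complex)"
  by (rule int_imp_algebraic_int) simp

section \<open>Subfields of the complex numbers\<close>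

lemma CC_simps [simp]:
  "carrier CC = UNIV" "x \<otimes>\<^bsub>CC\<^esub> y = x * y" "x \<oplus>\<^bsub>CC\<^esub> y = x + y" "\<zero>\<^bsub>CC\<^esub> = 0" "\<one>\<^bsub>CC\<^esub> = 1"
  by (simp_all add: ring_of_type_algebra_def)

lemma CC_field: "field CC"
  by (rule field_from_type_algebra)

lemma CC_ring: "ring CC"
  by (rule ring_from_type_algebra)

lemma CC_cring: "cring CC"
  by (rule cring_from_type_algebra)

lemma CC_a_inv [simp]: "\<ominus>\<^bsub>CC\<^esub> x = - (x::complex)"
  by (rule abelian_group.minus_equality[OF ring.is_abelian_group[OF CC_ring]]) simp_all

lemma CC_m_inv [simp]: "x \<noteq> 0 \<Longrightarrow> inv\<^bsub>CC\<^esub> x = inverse (x::complex)"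
  by (rule comm_monoid.comm_inv_char[OF cring.axioms(2)[OF CC_cring]]) simp_all

lemma CC_pow [simp]: "x [^]\<^bsub>CC\<^esub> (k::nat) = (x::complex) ^ k"
  by (induction k) (simp_all add: monoid.nat_pow_0[OF ring.is_monoid[OF CC_ring]]
      monoid.nat_pow_Suc[OF ring.is_monoid[OF CC_ring]] mult.commute)

text \<open>Closure under \<open>inverse\<close> can be required of every element because
  \<open>inverse 0 = 0\<close>; membership of 0 follows from 1 + (-1).\<close>

lemma subfield_CC_iff:
  "subfield E CC \<longleftrightarrow> 1 \<in> E \<and> (\<forall>x\<in>E. \<forall>y\<in>E. x + y \<in> E \<and> x * y \<in> E) \<and> (\<forall>x\<in>E. - x \<in> E \<and> inverse x \<in> E)"
    (is "_ \<longleftrightarrow> ?R")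
proof
  assume E: "subfield E CC"
  have s: "subring E CC" using E by (rule subfieldE)
  have 0: "0 \<in> E" using subringE(2)[OF s] by simp
  have "inverse x \<in> E" if "x \<in> E" for x
  proof (cases "x = 0")
    case False
    thus ?thesis using ring.subfield_m_inv(1)[OF CC_ring E, of x] that by simp
  qed (use 0 in simp)
  thus ?R using subringE(3,5,6,7)[OF s] by auto
next
  assume R: ?R
  have "0 = 1 + (- 1 :: complex)" by simp
  hence "0 \<in> E" using R by metis
  show "subfield E CC"
    by (rule field.subfieldI'[OF CC_field], rule ring.subringI[OF CC_ring]) (use R \<open>0 \<in> E\<close> in auto)
qed

locale subfld =
  fixes E :: "complex set"
  assumes subfield: "subfield E CC"
begin

lemma one [simp, intro]: "1 \<in> E"
  and add [simp, intro]: "x \<in> E \<Longrightarrow> y \<in> E \<Longrightarrow> x + y \<in> E"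
  and mult [simp, intro]: "x \<in> E \<Longrightarrow> y \<in> E \<Longrightarrow> x * y \<in> E"
  and uminus [simp, intro]: "x \<in> E \<Longrightarrow> - x \<in> E"
  and inverse [simp, intro]: "x \<in> E \<Longrightarrow> inverse x \<in> E"
  using subfield by (auto simp: subfield_CC_iff)

lemma zero [simp, intro]: "0 \<in> E"
  using add[OF one uminus[OF one]] by simp

lemma diff [simp, intro]: "x \<in> E \<Longrightarrow> y \<in> E \<Longrightarrow> x - y \<in> E"
  using add[of x "- y"] by simp

lemma divide [simp, intro]: "x \<in> E \<Longrightarrow> y \<in> E \<Longrightarrow> x / y \<in> E"
  using mult[of x "inverse y"] by (simp only: divide_inverse mult inverse)

lemma power [simp, intro]: "x \<in> E \<Longrightarrow> x ^ k \<in> E"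
  by (induction k) auto

lemma sum_closed [intro]: "(\<And>i. i \<in> I \<Longrightarrow> g i \<in> E) \<Longrightarrow> sum g I \<in> E"
  by (induction I rule: infinite_finite_induct) auto

lemma prod_closed [intro]: "(\<And>i. i \<in> I \<Longrightarrow> g i \<in> E) \<Longrightarrow> prod g I \<in> E"
  by (induction I rule: infinite_finite_induct) auto

lemma of_nat [simp, intro]: "of_nat k \<in> E"
  by (induction k) auto

lemma of_int [simp, intro]: "of_int k \<in> E"
  by (cases k) (auto simp del: of_nat_Suc)

lemma Rats_subset: "\<rat> \<subseteq> E"
  by (auto elim!: Rats_cases')

text \<open>Polynomials stay complex and only their coefficients are confined to \<open>E\<close>,
  so that their roots can be taken among all complex numbers.\<close>

definition polys :: "complex poly set" where
  "polys = {p. \<forall>i. coeff p i \<in> E}"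

lemma polys_pCons [simp]: "pCons a p \<in> polys \<longleftrightarrow> a \<in> E \<and> p \<in> polys"
  by (auto simp: polys_def coeff_pCons split: nat.splits)

lemma polys_0 [simp]: "0 \<in> polys" and polys_1 [simp]: "1 \<in> polys"
  by (auto simp: polys_def)

lemma polys_mult: "p \<in> polys \<Longrightarrow> q \<in> polys \<Longrightarrow> p * q \<in> polys"
  by (auto simp: polys_def coeff_mult)

lemma polys_diff: "p \<in> polys \<Longrightarrow> q \<in> polys \<Longrightarrow> p - q \<in> polys"
  by (auto simp: polys_def)

lemma polys_add: "p \<in> polys \<Longrightarrow> q \<in> polys \<Longrightarrow> p + q \<in> polys"
  by (auto simp: polys_def)

lemma polys_prod: "(\<And>i. i \<in> I \<Longrightarrow> g i \<in> polys) \<Longrightarrow> prod g I \<in> polys"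
  by (induction I rule: infinite_finite_induct) (auto simp: polys_mult)

lemma poly_closed: "p \<in> polys \<Longrightarrow> x \<in> E \<Longrightarrow> poly p x \<in> E"
  by (induction p) auto

end

lemma subfld_Rats: "subfld \<rat>"
  unfolding subfld_def subfield_CC_iff by auto

lemma subfld_UNIV: "subfld UNIV"
  unfolding subfld_def subfield_CC_iff by auto

text \<open>\<open>f\<close> is constrained on \<open>E\<close> only. Thus \<open>cnj\<close>,
  iterates of \<open>s\<close> and restrictions to smaller fields are covered without cutting
  functions down to a domain.\<close>

locale field_hom = subfld E for E :: "complex set" +
  fixes f :: "complex \<Rightarrow> complex"
  assumes hom_one [simp]: "f 1 = 1"
    and hom_add [simp]: "x \<in> E \<Longrightarrow> y \<in> E \<Longrightarrow> f (x + y) = f x + f y"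
    and hom_mult [simp]: "x \<in> E \<Longrightarrow> y \<in> E \<Longrightarrow> f (x * y) = f x * f y"
begin

lemma hom_zero [simp]: "f 0 = 0"
  using hom_add[of 0 0] by (simp del: hom_add)

lemma hom_uminus [simp]: "x \<in> E \<Longrightarrow> f (- x) = - f x"
  using hom_add[of x "- x"] by (simp del: hom_add add: eq_neg_iff_add_eq_0 add.commute)

lemma hom_diff [simp]: "x \<in> E \<Longrightarrow> y \<in> E \<Longrightarrow> f (x - y) = f x - f y"
  using hom_add[of x "- y"] by (simp del: hom_add)

lemma hom_inverse [simp]: "x \<in> E \<Longrightarrow> f (inverse x) = inverse (f x)"
proof (cases "x = 0")
  case False
  assume "x \<in> E"
  hence "f x * f (inverse x) = 1" using hom_mult[of x "inverse x"] False by (simp del: hom_mult)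
  thus ?thesis by (metis inverse_unique)
qed simp

lemma hom_eq_0_iff [simp]: "x \<in> E \<Longrightarrow> f x = 0 \<longleftrightarrow> x = 0"
  using hom_mult[of x "inverse x"] by (cases "x = 0") (auto simp del: hom_mult hom_inverse)

lemma hom_inj: "inj_on f E"
proof (rule inj_onI)
  fix x y assume "x \<in> E" "y \<in> E" "f x = f y"
  thus "x = y" using hom_eq_0_iff[of "x - y"] by simp
qed

lemma hom_power [simp]: "x \<in> E \<Longrightarrow> f (x ^ k) = f x ^ k"
  by (induction k) auto

lemma hom_sum: "(\<And>i. i \<in> I \<Longrightarrow> g i \<in> E) \<Longrightarrow> f (sum g I) = (\<Sum>i\<in>I. f (g i))"
  by (induction I rule: infinite_finite_induct) (auto simp: sum_closed)

lemma hom_prod: "(\<And>i. i \<in> I \<Longrightarrow> g i \<in> E) \<Longrightarrow> f (prod g I) = (\<Prod>i\<in>I. f (g i))"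
  by (induction I rule: infinite_finite_induct) (auto simp: prod_closed)

lemma hom_of_nat [simp]: "f (of_nat k) = of_nat k"
  by (induction k) auto

lemma hom_of_int [simp]: "f (of_int k) = of_int k"
  by (cases k) (auto simp del: of_nat_Suc)

lemma hom_Rats [simp]: "q \<in> \<rat> \<Longrightarrow> f q = q"
  by (elim Rats_cases') (simp add: divide_inverse)

lemma coeff_map [simp]: "coeff (map_poly f p) i = f (coeff p i)"
  by (simp add: coeff_map_poly)

lemma map_poly_mult: "p \<in> polys \<Longrightarrow> q \<in> polys \<Longrightarrow> map_poly f (p * q) = map_poly f p * map_poly f q"
  by (rule poly_eqI) (auto simp: coeff_mult polys_def hom_sum)

lemma map_poly_add: "p \<in> polys \<Longrightarrow> q \<in> polys \<Longrightarrow> map_poly f (p + q) = map_poly f p + map_poly f q"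
  by (rule poly_eqI) (auto simp: polys_def)

lemma map_poly_prod:
  "(\<And>i. i \<in> I \<Longrightarrow> g i \<in> polys) \<Longrightarrow> map_poly f (prod g I) = (\<Prod>i\<in>I. map_poly f (g i))"
  by (induction I rule: infinite_finite_induct) (auto simp: map_poly_mult polys_prod)

lemma hom_poly: "p \<in> polys \<Longrightarrow> x \<in> E \<Longrightarrow> f (poly p x) = poly (map_poly f p) (f x)"
  by (induction p) (auto simp: map_poly_pCons poly_closed)

lemma image_subfld: "subfld (f ` E)"
  unfolding subfld_def subfield_CC_iff
  by (auto simp: image_iff simp flip: hom_add hom_mult hom_uminus hom_inverse intro: exI[of _ 1] bexI[of _ 1])

end

lemma field_hom_cnj: "subfld E \<Longrightarrow> field_hom E cnj"
  by (simp add: field_hom_def field_hom_axioms_def)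

lemma field_hom_comp: "field_hom E f \<Longrightarrow> field_hom F g \<Longrightarrow> f ` E \<subseteq> F \<Longrightarrow> field_hom E (g \<circ> f)"
  unfolding field_hom_def field_hom_axioms_def by (simp add: image_subset_iff)

lemma field_hom_subset: "field_hom E f \<Longrightarrow> subfld F \<Longrightarrow> F \<subseteq> E \<Longrightarrow> field_hom F f"
  unfolding field_hom_def field_hom_axioms_def by (simp add: subset_iff)

section \<open>Units with bounded conjugates\<close>

text \<open>A further linear factor adds a shifted copy of the coefficients to a multiple of them by
  a number of modulus at most \<open>M\<close>, hence the factor 1 + M at each step.\<close>

lemma coeff_linear_prod_bound:
  fixes z :: "'i \<Rightarrow> complex"
  assumes "finite I" "\<And>i. i \<in> I \<Longrightarrow> cmod (z i) \<le> M"
  shows "cmod (coeff (\<Prod>i\<in>I. [:- z i, 1:]) j) \<le> (1 + M) ^ card I"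
  using assms
proof (induction I arbitrary: j rule: finite_induct)
  case empty
  thus ?case by (cases j) (auto simp: coeff_eq_0)
next
  case (insert i I)
  define p where "p = (\<Prod>i\<in>I. [:- z i, 1:])"
  have IH: "cmod (coeff p j) \<le> (1 + M) ^ card I" for j
    unfolding p_def using insert by blast
  have M: "cmod (z i) \<le> M" using insert.prems by blast
  hence "0 \<le> M" using norm_ge_zero order_trans by blast
  have "coeff ([:- z i, 1:] * p) j = - (z i * coeff p j) + (case j of 0 \<Rightarrow> 0 | Suc k \<Rightarrow> coeff p k)"
    by (simp add: coeff_pCons)
  hence "cmod (coeff ([:- z i, 1:] * p) j) \<le> cmod (z i) * cmod (coeff p j) + cmod (case j of 0 \<Rightarrow> 0 | Suc k \<Rightarrow> coeff p k)"
    by (metis norm_minus_cancel norm_mult norm_triangle_ineq)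
  also have "\<dots> \<le> M * (1 + M) ^ card I + (1 + M) ^ card I"
    using IH M \<open>0 \<le> M\<close> by (intro add_mono mult_mono) (auto split: nat.splits)
  also have "\<dots> = (1 + M) ^ card (insert i I)"
    using insert by (simp add: algebra_simps)
  finally show ?case using insert by (simp add: p_def)
qed

lemma finite_bounded_Ints: "finite {x :: complex. x \<in> \<int> \<and> cmod x \<le> B}"
proof -
  have "{x :: complex. x \<in> \<int> \<and> cmod x \<le> B} \<subseteq> of_int ` {- \<lceil>B\<rceil>..\<lceil>B\<rceil>}"
  proof
    fix x :: complex assume "x \<in> {x. x \<in> \<int> \<and> cmod x \<le> B}"
    then obtain k where k: "x = of_int k" "\<bar>real_of_int k\<bar> \<le> B" by (auto elim!: Ints_cases)
    hence "\<bar>k\<bar> \<le> \<lceil>B\<rceil>" by linarith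
    hence "k \<in> {- \<lceil>B\<rceil>..\<lceil>B\<rceil>}" by auto
    thus "x \<in> of_int ` {- \<lceil>B\<rceil>..\<lceil>B\<rceil>}" using k by blast
  qed
  thus ?thesis by (rule finite_subset) simp
qed

lemma finite_bounded_Ints_polys:
  "finite {p :: complex poly. degree p \<le> D \<and> (\<forall>i. coeff p i \<in> \<int> \<and> cmod (coeff p i) \<le> B)}"
    (is "finite ?P")
proof -
  define g where "g p = restrict (coeff p) {..D}" for p :: "complex poly"
  have "g ` ?P \<subseteq> {..D} \<rightarrow>\<^sub>E {x. x \<in> \<int> \<and> cmod x \<le> B}"
    by (rule image_subsetI, rule PiE_I) (auto simp: g_def)
  moreover have "finite ({..D} \<rightarrow>\<^sub>E {x :: complex. x \<in> \<int> \<and> cmod x \<le> B})"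
    by (intro finite_PiE finite_bounded_Ints) simp
  ultimately have "finite (g ` ?P)" by (rule finite_subset)
  moreover have "inj_on g ?P"
  proof (rule inj_onI, rule poly_eqI)
    fix p q i assume *: "p \<in> ?P" "q \<in> ?P" "g p = g q"
    show "coeff p i = coeff q i"
    proof (cases "i \<le> D")
      case True
      thus ?thesis using fun_cong[OF *(3), of i] by (simp add: g_def)
    next
      case False
      thus ?thesis using * by (simp add: coeff_eq_0)
    qed
  qed
  ultimately show ?thesis by (rule finite_imageD)
qed

lemma algebraic_int_coeff_prod:
  fixes z :: "'i \<Rightarrow> complex"
  assumes "finite I" "\<And>i. i \<in> I \<Longrightarrow> algebraic_int (z i)"
  shows "algebraic_int (coeff (\<Prod>i\<in>I. [:- z i, 1:]) j)"
  using assms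
proof (induction I arbitrary: j rule: finite_induct)
  case empty
  thus ?case by (cases j) (auto simp: coeff_eq_0 algebraic_int_1)
next
  case (insert i I)
  define p where "p = (\<Prod>i\<in>I. [:- z i, 1:])"
  have IH: "algebraic_int (coeff p j)" for j unfolding p_def using insert by blast
  have "coeff ([:- z i, 1:] * p) j = - (z i * coeff p j) + (case j of 0 \<Rightarrow> 0 | Suc k \<Rightarrow> coeff p k)"
    by (simp add: coeff_pCons)
  moreover have "algebraic_int \<dots>"
    using IH insert.prems by (auto intro!: algebraic_int_diff algebraic_int_mult split: nat.splits)
  ultimately show ?case using insert by (simp add: p_def)
qed

text \<open>The arithmetic side of the dihedral action. The order of \<open>s\<close> is only
  bounded by \<open>s_period\<close>: the orbit products below may repeat conjugates, and what
  matters is that the common fixed field is rational.\<close>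

locale dihedral_field = field_hom E s for E s +
  fixes n :: nat
  assumes s_closed: "x \<in> E \<Longrightarrow> s x \<in> E"
    and s_period: "x \<in> E \<Longrightarrow> (s ^^ 2 ^ n) x = x"
    and cnj_closed: "x \<in> E \<Longrightarrow> cnj x \<in> E"
    and cnj_inverts: "x \<in> E \<Longrightarrow> cnj (s (cnj (s x))) = x"
    and fixed_field: "x \<in> E \<Longrightarrow> s x = x \<Longrightarrow> cnj x = x \<Longrightarrow> x \<in> \<rat>"
begin

lemma funpow_closed: "x \<in> E \<Longrightarrow> (s ^^ k) x \<in> E"
  by (induction k) (auto simp: s_closed)

lemma hom_funpow: "field_hom E (s ^^ k)"
proof (induction k)
  case 0
  show ?case by unfold_locales auto
next
  case (Suc k)
  show ?case using field_hom_comp[OF Suc field_hom_axioms] funpow_closed by (auto simp: o_def)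
qed

lemma s_cnj_s: "x \<in> E \<Longrightarrow> s (cnj (s x)) = cnj x"
  using cnj_inverts[of x] by (metis complex_cnj_cnj)

lemma s_image_E: "s ` E = E"
proof
  show "E \<subseteq> s ` E"
  proof
    fix x assume x: "x \<in> E"
    obtain m where m: "(2::nat) ^ n = Suc m" by (metis not0_implies_Suc power_not_zero zero_neq_numeral)
    have "x = s ((s ^^ m) x)" using s_period[OF x] by (simp add: m)
    thus "x \<in> s ` E" using funpow_closed[OF x] by blast
  qed
qed (use s_closed in auto)

lemma cnj_image_E: "cnj ` E = E"
  using cnj_closed by (metis complex_cnj_cnj image_eqI image_subset_iff subsetI subset_antisym)

lemma algebraic_int_s:
  assumes "x \<in> E" "algebraic_int x"
  shows "algebraic_int (s x)"
proof -
  obtain p where p: "lead_coeff p = 1" "\<forall>i. coeff p i \<in> \<int>" "poly p x = 0"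
    using assms(2) by (auto simp: algebraic_int.simps)
  have "p \<in> polys" "map_poly s p = p"
    using p(2) Ints_subset_Rats Rats_subset by (auto simp: polys_def poly_eq_iff intro!: hom_Rats)
  hence "poly p (s x) = 0" using hom_poly[of p x] assms(1) p(3) by simp
  thus ?thesis using p by (intro algebraic_int.intros)
qed

lemma algebraic_int_funpow: "x \<in> E \<Longrightarrow> algebraic_int x \<Longrightarrow> algebraic_int ((s ^^ k) x)"
  by (induction k) (auto intro: algebraic_int_s funpow_closed)

lemma prod_shift:
  fixes g :: "nat \<Rightarrow> 'b::comm_monoid_mult"
  assumes "g (2 ^ n) = g 0"
  shows "(\<Prod>k<2 ^ n. g (Suc k)) = (\<Prod>k<2 ^ n. g k)"
proof -
  obtain m where m: "2 ^ n = Suc m" by (metis not0_implies_Suc power_not_zero zero_neq_numeral)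
  have "(\<Prod>k<Suc m. g (Suc k)) = (\<Prod>k<m. g (Suc k)) * g (Suc m)" by simp
  also have "\<dots> = (\<Prod>k<Suc m. g k)" using assms by (subst prod.lessThan_Suc_shift) (simp add: m mult.commute)
  finally show ?thesis by (simp only: m)
qed

text \<open>The product runs over the images of \<open>u\<close> under the whole dihedral group.
  \<open>s\<close> shifts the first factor forwards and, since s cnj s = cnj, the second one
  backwards, while \<open>cnj\<close> exchanges them. So the coefficients are fixed by the group and
  are rational algebraic integers.\<close>

lemma coeff_conjugates_Ints:
  assumes u: "u \<in> E" "algebraic_int u"
  shows "coeff ((\<Prod>k<2 ^ n. [:- (s ^^ k) u, 1:]) * (\<Prod>k<2 ^ n. [:- cnj ((s ^^ k) u), 1:])) i \<in> \<int>"
proof -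
  define A where "A = (\<Prod>k<2 ^ n. [:- (s ^^ k) u, 1:])"
  define B where "B = (\<Prod>k<2 ^ n. [:- cnj ((s ^^ k) u), 1:])"
  have E: "A \<in> polys" "B \<in> polys"
    using u by (auto simp: A_def B_def funpow_closed cnj_closed intro!: polys_prod)
  interpret cnj: field_hom E cnj by (rule field_hom_cnj) (rule subfld_axioms)
  have "map_poly s A = (\<Prod>k<2 ^ n. [:- (s ^^ Suc k) u, 1:])"
    using u unfolding A_def by (subst map_poly_prod) (auto simp: funpow_closed map_poly_pCons)
  also have "\<dots> = A" unfolding A_def using s_period[OF u(1)] by (intro prod_shift) simp
  finally have sA: "map_poly s A = A" .
  have "B = (\<Prod>k<2 ^ n. [:- cnj ((s ^^ Suc k) u), 1:])"
    unfolding B_def using s_period[OF u(1)] by (intro prod_shift[symmetric]) simp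
  also have "map_poly s \<dots> = B"
    using u unfolding B_def by (subst map_poly_prod)
      (auto simp: funpow_closed cnj_closed s_closed map_poly_pCons s_cnj_s)
  finally have sB: "map_poly s B = B" .
  have cA: "map_poly cnj A = B"
    using u unfolding A_def B_def by (subst cnj.map_poly_prod) (auto simp: funpow_closed map_poly_pCons)
  have cB: "map_poly cnj B = A"
    using u unfolding A_def B_def by (subst cnj.map_poly_prod) (auto simp: funpow_closed cnj_closed map_poly_pCons)
  have "map_poly s (A * B) = A * B" using E sA sB by (simp add: map_poly_mult)
  hence 1: "s (coeff (A * B) i) = coeff (A * B) i" by (metis coeff_map)
  have "map_poly cnj (A * B) = A * B" using E cA cB by (simp add: cnj.map_poly_mult mult.commute)
  hence 2: "cnj (coeff (A * B) i) = coeff (A * B) i" by (metis cnj.coeff_map)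
  have 3: "coeff (A * B) i \<in> E" using polys_mult[OF E] by (simp add: polys_def)
  have "algebraic_int (coeff (A * B) i)"
  proof -
    have sum: "algebraic_int (\<Sum>i\<in>I. g i)" if "\<And>i. i \<in> I \<Longrightarrow> algebraic_int (g i)"
      for I :: "nat set" and g :: "nat \<Rightarrow> complex"
      using that by (induction I rule: infinite_finite_induct) (auto intro: algebraic_int_add)
    show ?thesis unfolding coeff_mult A_def B_def using u
      by (intro sum algebraic_int_mult algebraic_int_coeff_prod) (auto intro: algebraic_int_funpow)
  qed
  thus ?thesis using rational_algebraic_int_is_int[OF _ fixed_field[OF 3 1 2]] by (simp add: A_def B_def)
qed

text \<open>Complex conjugation preserves absolute values, so bounding the rotations of
  \<open>u\<close> bounds all its conjugates. Then \<open>u\<close> is a root of one of finitely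
  many nonzero integer polynomials.\<close>

lemma finite_bounded_conjugates:
  "finite {u \<in> E. algebraic_int u \<and> (\<forall>k<2 ^ n. cmod ((s ^^ k) u) \<le> M)}" (is "finite ?S")
proof -
  define N :: nat where "N = 2 ^ n"
  define Q where "Q u = (\<Prod>k<N. [:- (s ^^ k) u, 1:]) * (\<Prod>k<N. [:- cnj ((s ^^ k) u), 1:])" for u
  define z where "z u k = (if k < N then (s ^^ k) u else cnj ((s ^^ (k - N)) u))" for u k
  have Q: "Q u = (\<Prod>k<N + N. [:- z u k, 1:])" for u
  proof -
    have "(\<Prod>k<N + N. [:- z u k, 1:]) = (\<Prod>k<N. [:- z u k, 1:]) * (\<Prod>k = N..<N + N. [:- z u k, 1:])"
      by (subst prod.union_disjoint[symmetric]) (auto simp: ivl_disj_un intro!: prod.cong)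
    also have "(\<Prod>k = N..<N + N. [:- z u k, 1:]) = (\<Prod>k<N. [:- z u (N + k), 1:])"
      using prod.shift_bounds_nat_ivl[of "\<lambda>k. [:- z u k, 1:]" 0 N N]
      by (simp add: atLeast0LessThan add.commute)
    finally show ?thesis by (simp add: Q_def z_def)
  qed
  let ?P = "{p :: complex poly. degree p \<le> N + N \<and> (\<forall>i. coeff p i \<in> \<int> \<and> cmod (coeff p i) \<le> (1 + M) ^ (N + N))}"
  have "?S \<subseteq> (\<Union>p\<in>?P - {0}. {x. poly p x = 0})"
  proof
    fix u assume u: "u \<in> ?S"
    have "cmod (z u k) \<le> M" if "k < N + N" for k
      using u that by (auto simp: z_def N_def)
    hence "cmod (coeff (Q u) i) \<le> (1 + M) ^ (N + N)" for i
      unfolding Q using coeff_linear_prod_bound[of "{..<N + N}" "z u" M i] by simp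
    moreover have "coeff (Q u) i \<in> \<int>" for i
      using coeff_conjugates_Ints[of u i] u by (simp add: Q_def N_def)
    moreover have "degree (Q u) \<le> N + N"
      unfolding Q using degree_prod_sum_le[of "{..<N + N}" "\<lambda>k. [:- z u k, 1:]"] by simp
    moreover have "Q u \<noteq> 0" unfolding Q by (simp add: prod_zero_iff)
    moreover have "poly (Q u) u = 0"
    proof -
      have "0 < N" by (simp add: N_def)
      thus ?thesis unfolding Q by (auto simp: poly_prod prod_zero_iff z_def intro!: bexI[of _ 0])
    qed
    ultimately show "u \<in> (\<Union>p\<in>?P - {0}. {x. poly p x = 0})" by blast
  qed
  moreover have "finite (\<Union>p\<in>?P - {0}. {x. poly p x = 0})"
    using finite_bounded_Ints_polys poly_roots_finite by (intro finite_UN_I) auto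
  ultimately show ?thesis by (rule finite_subset)
qed

end

section \<open>Galois extensions\<close>

lemma gal_group_carrier:
  "\<sigma> \<in> carrier (gal_group F E) \<longleftrightarrow>
     \<sigma> \<in> extensional E \<and> bij_betw \<sigma> E E \<and> \<sigma> 1 = 1 \<and> (\<forall>x\<in>F. \<sigma> x = x) \<and>
     (\<forall>x\<in>E. \<forall>y\<in>E. \<sigma> (x + y) = \<sigma> x + \<sigma> y \<and> \<sigma> (x * y) = \<sigma> x * \<sigma> y)"
  unfolding gal_group_def Bij_def Ring.ring_hom_def bij_betw_def by auto

lemma gal_group_mult:
  assumes "\<sigma> \<in> carrier (gal_group F E)" "\<tau> \<in> carrier (gal_group F E)"
  shows "\<sigma> \<otimes>\<^bsub>gal_group F E\<^esub> \<tau> = compose E \<sigma> \<tau>"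
  using assms by (simp add: gal_group_def BijGroup_def)

lemma gal_group_mult_apply:
  assumes "\<sigma> \<in> carrier (gal_group F E)" "\<tau> \<in> carrier (gal_group F E)" "x \<in> E"
  shows "(\<sigma> \<otimes>\<^bsub>gal_group F E\<^esub> \<tau>) x = \<sigma> (\<tau> x)"
  using assms by (simp add: gal_group_mult compose_def)

lemma gal_group_closed:
  assumes \<sigma>: "\<sigma> \<in> carrier (gal_group F E)" and \<tau>: "\<tau> \<in> carrier (gal_group F E)"
    and "F \<subseteq> E" "subfield E CC"
  shows "\<sigma> \<otimes>\<^bsub>gal_group F E\<^esub> \<tau> \<in> carrier (gal_group F E)"
proof -
  interpret subfld E by (rule subfld.intro) (rule assms)
  have \<tau>E: "\<tau> x \<in> E" if "x \<in> E" for x using \<tau> that by (auto simp: gal_group_carrier bij_betw_def)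
  have "bij_betw (compose E \<sigma> \<tau>) E E"
    using \<sigma> \<tau> by (auto simp: gal_group_carrier intro: bij_betw_compose)
  moreover have "compose E \<sigma> \<tau> x = \<sigma> (\<tau> x)" if "x \<in> E" for x
    using that by (simp add: compose_def)
  moreover have "\<tau> x = x" "\<sigma> x = x" if "x \<in> F" for x
    using that \<sigma> \<tau> by (auto simp: gal_group_carrier)
  moreover have "\<sigma> 1 = 1" "\<tau> 1 = 1" using \<sigma> \<tau> by (auto simp: gal_group_carrier)
  ultimately show ?thesis
    using \<sigma> \<tau> \<tau>E \<open>F \<subseteq> E\<close> unfolding gal_group_mult[OF \<sigma> \<tau>]
    by (simp add: gal_group_carrier subset_iff)
qed

lemma gal_group_field_hom:
  assumes "\<sigma> \<in> carrier (gal_group F E)" "subfield E CC"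
  shows "field_hom E \<sigma>"
  using assms by (simp add: field_hom_def field_hom_axioms_def subfld_def gal_group_carrier)

text \<open>The list \<open>p\<close> starts with the leading coefficient, whereas
  \<open>Poly\<close> expects the constant one first; hence \<open>rev\<close>.\<close>

lemma eval_eq_poly: "ring.eval CC p x = poly (Poly (rev p)) x"
proof (induction p)
  case Nil
  show ?case by (simp add: ring.eval.simps[OF CC_ring])
next
  case (Cons a p)
  thus ?case by (simp add: ring.eval.simps[OF CC_ring] Poly_append poly_monom add.commute mult.commute)
qed

lemma algebraic_polyE:
  assumes F: "subfield F CC" and alg: "ring.algebraic CC F x"
  obtains p where "p \<in> subfld.polys F" "p \<noteq> 0" "poly p x = 0"
proof -
  interpret subfld F by (rule subfld.intro) (rule F)
  obtain q where "q \<in> carrier (F [X]\<^bsub>CC\<^esub>)" "q \<noteq> []" "ring.eval CC q x = \<zero>\<^bsub>CC\<^esub>"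
    by (rule domain.algebraicE[OF field.axioms(1)[OF CC_field] subfieldE(1)[OF F], of x])
       (use alg in \<open>simp_all add: over_def\<close>)
  hence q: "set q \<subseteq> F" "hd q \<noteq> 0" "poly (Poly (rev q)) x = 0" "q \<noteq> []"
    by (simp_all add: univ_poly_def polynomial_def eval_eq_poly)
  have "coeff (Poly (rev q)) i \<in> F" for i
    using q(1) nth_mem[of i "rev q"] by (auto simp: nth_default_def)
  hence "Poly (rev q) \<in> polys" by (simp add: polys_def)
  moreover have "Poly (rev q) \<noteq> 0"
  proof
    assume 0: "Poly (rev q) = 0"
    obtain a r where "q = a # r" using q(4) by (cases q) auto
    thus False using q(2) arg_cong[OF 0, of "\<lambda>p. coeff p (length r)"] by (simp add: nth_default_def nth_append)
  qed
  ultimately show ?thesis using that q(3) by blast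
qed

text \<open>The d + 1 powers 1, x, ..., x^d are dependent in a space of dimension \<open>d\<close>,
  and a nontrivial relation is the desired polynomial.\<close>

lemma dimension_polyE:
  assumes F: "subfield F CC" and E: "subfield E CC" and dim: "ring.dimension CC d F E" and x: "x \<in> E"
  obtains p where "p \<in> subfld.polys F" "p \<noteq> 0" "degree p \<le> d" "poly p x = 0"
proof -
  interpret F: subfld F by (rule subfld.intro) (rule F)
  interpret E: subfld E by (rule subfld.intro) (rule E)
  define Us where "Us = map (\<lambda>i. x ^ i) [0..<Suc d]"
  have "\<not> ring.independent CC F Us"
    using ring.independent_length_le_dimension[OF CC_ring F dim, of Us] x by (auto simp: Us_def)
  then obtain Ks where Ks: "length Ks = length Us" "ring.combine CC Ks Us = 0" "set Ks \<subseteq> F" "set Ks \<noteq> {0}"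
    using ring.dependent_imp_non_trivial_combine[OF CC_ring F, of Us] by auto
  have comb: "ring.combine CC Ks (map (\<lambda>i. x ^ i) [a..<a + length Ks]) = x ^ a * poly (Poly Ks) x" for a Ks
  proof (induction Ks arbitrary: a)
    case Nil
    show ?case by (simp add: ring.combine.simps[OF CC_ring])
  next
    case (Cons k Ks)
    have "[a..<a + length (k # Ks)] = a # [Suc a..<Suc a + length Ks]"
      by (subst upt_rec) simp
    thus ?case using Cons[of "Suc a"] by (simp add: ring.combine.simps[OF CC_ring] algebra_simps)
  qed
  have "poly (Poly Ks) x = 0"
    using comb[of Ks 0] Ks(1,2) by (simp add: Us_def del: upt_Suc)
  moreover have "Poly Ks \<in> F.polys"
    using Ks(3) by (auto simp: F.polys_def nth_default_def)
  moreover have "Poly Ks \<noteq> 0"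
  proof
    assume "Poly Ks = 0"
    hence "Ks ! i = 0" if "i < length Ks" for i
      using that coeff_Poly[of Ks i] by (simp add: nth_default_def)
    hence "set Ks \<subseteq> {0}" by (auto simp: in_set_conv_nth)
    moreover have "set Ks \<noteq> {}" using Ks(1) by (auto simp: Us_def)
    ultimately show False using Ks(4) by (auto dest: subset_singletonD)
  qed
  moreover have "degree (Poly Ks) \<le> d"
    using Ks(1) by (intro degree_le) (auto simp: nth_default_def Us_def)
  ultimately show ?thesis using that by blast
qed

text \<open>The orbit polynomial of \<open>x\<close> has coefficients in the fixed field, so that all conjugates of
  \<open>x\<close> are in its orbit.\<close>

lemma galois_extension_splits:
  assumes gal: "galois_extension F E" and x: "x \<in> E"
  obtains p where "p \<in> subfld.polys F" "p \<noteq> 0" "poly p x = 0" "\<And>y. poly p y = 0 \<Longrightarrow> y \<in> E"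
proof -
  have ext: "subfield F CC" "subfield E CC" "F \<subseteq> E" using gal by (auto simp: galois_extension_def extension_def)
  interpret F: subfld F by (rule subfld.intro) (rule ext)
  interpret E: subfld E by (rule subfld.intro) (rule ext)
  let ?G = "carrier (gal_group F E)"
  define O' where "O' = (\<lambda>\<sigma>. \<sigma> x) ` ?G"
  obtain q where q: "q \<in> F.polys" "q \<noteq> 0" "poly q x = 0"
    using gal x algebraic_polyE[OF ext(1), of x] by (auto simp: galois_extension_def)
  have "poly q (\<sigma> x) = 0" if "\<sigma> \<in> ?G" for \<sigma>
  proof -
    interpret field_hom E \<sigma> using that ext(2) by (rule gal_group_field_hom)
    have "map_poly \<sigma> q = q" using that q(1) by (auto simp: poly_eq_iff F.polys_def gal_group_carrier)
    moreover have "q \<in> E.polys" using q(1) ext(3) by (auto simp: F.polys_def E.polys_def)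
    ultimately show ?thesis using hom_poly[of q x] x q(3) by simp
  qed
  hence "O' \<subseteq> {y. poly q y = 0}" by (auto simp: O'_def)
  hence fin: "finite O'" using poly_roots_finite[OF q(2)] finite_subset by blast
  have O'E: "O' \<subseteq> E"
  proof -
    have "\<sigma> x \<in> E" if "\<sigma> \<in> ?G" for \<sigma> using that x by (meson gal_group_carrier bij_betwE)
    thus ?thesis by (auto simp: O'_def)
  qed
  define p where "p = (\<Prod>y\<in>O'. [:- y, 1:])"
  have pE: "p \<in> E.polys" unfolding p_def using O'E by (intro E.polys_prod) auto
  have "coeff p i \<in> F" for i
  proof -
    have "\<sigma> (coeff p i) = coeff p i" if \<sigma>: "\<sigma> \<in> ?G" for \<sigma>
    proof -
      interpret field_hom E \<sigma> using \<sigma> ext(2) by (rule gal_group_field_hom)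
      have inj: "inj_on \<sigma> O'" using hom_inj O'E by (rule inj_on_subset)
      have "\<sigma> ` O' \<subseteq> O'"
      proof (rule image_subsetI)
        fix y assume "y \<in> O'"
        then obtain \<tau> where \<tau>: "\<tau> \<in> ?G" "y = \<tau> x" by (auto simp: O'_def)
        thus "\<sigma> y \<in> O'" using gal_group_closed[OF \<sigma> \<tau>(1) ext(3,2)] gal_group_mult_apply[OF \<sigma> \<tau>(1) x]
          unfolding O'_def by (metis imageI)
      qed
      hence "\<sigma> ` O' = O'" using fin inj by (simp add: endo_inj_surj)
      have "map_poly \<sigma> p = (\<Prod>y\<in>O'. [:- \<sigma> y, 1:])"
        unfolding p_def using O'E by (subst map_poly_prod) (auto simp: map_poly_pCons intro!: prod.cong)
      also have "\<dots> = p" unfolding p_def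
        using prod.reindex[OF inj, of "\<lambda>y. [:- y, 1:]"] \<open>\<sigma> ` O' = O'\<close> by simp
      finally show ?thesis by (metis coeff_map)
    qed
    moreover have "coeff p i \<in> E" using pE by (simp add: E.polys_def)
    ultimately show ?thesis using gal by (auto simp: galois_extension_def)
  qed
  hence "p \<in> F.polys" by (simp add: F.polys_def)
  moreover have "p \<noteq> 0" using fin by (simp add: p_def)
  moreover have "poly p y = 0 \<longleftrightarrow> y \<in> O'" for y using fin by (auto simp: p_def poly_prod)
  moreover have "x \<in> O'"
  proof -
    have "(\<lambda>y\<in>E. y) \<in> ?G" using ext by (auto simp: gal_group_carrier id_Bij bij_betw_def inj_on_def subset_iff)
    thus ?thesis using x unfolding O'_def by (intro image_eqI[of _ _ "\<lambda>y\<in>E. y"]) simp_all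
  qed
  ultimately show ?thesis using that O'E by blast
qed

text \<open>The image is a root of a polynomial over \<open>F\<close> that has all its complex roots
  in \<open>E\<close>. Allowing a larger domain \<open>M\<close> covers both \<open>cnj\<close> on
  all complex numbers and homomorphisms of a compositum.\<close>

lemma galois_extension_normal:
  assumes gal: "galois_extension F E" and x: "x \<in> E"
    and hom: "field_hom M f" "E \<subseteq> M" and fixed: "\<And>y. y \<in> F \<Longrightarrow> f y = y"
  shows "f x \<in> E"
proof -
  interpret field_hom M f by (rule hom)
  have ext: "subfield F CC" "F \<subseteq> E" using gal by (auto simp: galois_extension_def extension_def)
  interpret F: subfld F by (rule subfld.intro) (rule ext)
  obtain p where p: "p \<in> F.polys" "poly p x = 0" and roots: "\<And>y. poly p y = 0 \<Longrightarrow> y \<in> E"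
    using galois_extension_splits[OF gal x] by metis
  have "map_poly f p = p" using p(1) fixed by (auto simp: poly_eq_iff F.polys_def)
  moreover have "p \<in> polys" using p(1) ext hom(2) by (auto simp: F.polys_def polys_def)
  ultimately have "poly p (f x) = 0" using hom_poly[of p x] x hom(2) p(2) by auto
  thus ?thesis by (rule roots)
qed

section \<open>The 2-adic integers\<close>

lemma two_adic_carrier:
  "x \<in> carrier two_adic_int \<longleftrightarrow> (\<forall>n. 0 \<le> x n \<and> x n < 2 ^ n \<and> x (Suc n) mod 2 ^ n = x n)"
  by (auto simp: two_adic_int_def)

lemma two_adic_mult: "(x \<otimes>\<^bsub>two_adic_int\<^esub> y) = (\<lambda>n. (x n + y n) mod 2 ^ n)"
  by (simp add: two_adic_int_def)

lemma two_adic_one: "\<one>\<^bsub>two_adic_int\<^esub> = (\<lambda>n. 0)"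
  by (simp add: two_adic_int_def)

lemma mod_double_power: "(a mod 2 ^ Suc n) mod 2 ^ n = (a :: int) mod 2 ^ n"
  by (rule mod_mod_cancel) (simp add: le_imp_power_dvd)

lemma two_adic_reduce:
  assumes "\<And>n. f (Suc n) mod 2 ^ n = f n mod 2 ^ n"
  shows "(\<lambda>n. (f n :: int) mod 2 ^ n) \<in> carrier two_adic_int"
  using assms unfolding two_adic_carrier mod_double_power by simp

lemma two_adic_mod_add:
  assumes x: "x \<in> carrier two_adic_int"
  shows "x (n + m) mod 2 ^ n = x n"
proof (induction m)
  case 0
  thus ?case using x by (simp add: two_adic_carrier)
next
  case (Suc m)
  have "x (Suc (n + m)) mod 2 ^ n = (x (Suc (n + m)) mod 2 ^ (n + m)) mod 2 ^ n"
    by (rule mod_mod_cancel[symmetric]) (simp add: le_imp_power_dvd)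
  thus ?case using Suc x by (simp add: two_adic_carrier)
qed

lemma comm_group_two_adic_int: "comm_group two_adic_int"
proof (rule comm_groupI)
  fix x y z assume xyz: "x \<in> carrier two_adic_int" "y \<in> carrier two_adic_int" "z \<in> carrier two_adic_int"
  show "x \<otimes>\<^bsub>two_adic_int\<^esub> y \<in> carrier two_adic_int"
    unfolding two_adic_mult
  proof (rule two_adic_reduce)
    fix n show "(x (Suc n) + y (Suc n)) mod 2 ^ n = (x n + y n) mod 2 ^ n"
      using xyz mod_add_eq[of "x (Suc n)" "2 ^ n" "y (Suc n)"] by (simp add: two_adic_carrier)
  qed
  show "x \<otimes>\<^bsub>two_adic_int\<^esub> y \<otimes>\<^bsub>two_adic_int\<^esub> z = x \<otimes>\<^bsub>two_adic_int\<^esub> (y \<otimes>\<^bsub>two_adic_int\<^esub> z)"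
    by (simp add: two_adic_mult mod_simps add.assoc)
  show "x \<otimes>\<^bsub>two_adic_int\<^esub> y = y \<otimes>\<^bsub>two_adic_int\<^esub> x"
    by (simp add: two_adic_mult add.commute)
next
  show "\<one>\<^bsub>two_adic_int\<^esub> \<in> carrier two_adic_int" by (simp add: two_adic_one two_adic_carrier)
next
  fix x assume x: "x \<in> carrier two_adic_int"
  show "\<one>\<^bsub>two_adic_int\<^esub> \<otimes>\<^bsub>two_adic_int\<^esub> x = x"
    using x by (simp add: two_adic_mult two_adic_one two_adic_carrier)
  have "(\<lambda>n. (- x n) mod 2 ^ n) \<in> carrier two_adic_int"
  proof (rule two_adic_reduce)
    fix n show "(- x (Suc n)) mod 2 ^ n = (- x n) mod 2 ^ n"
      using x mod_minus_eq[of "x (Suc n)" "2 ^ n"] by (simp add: two_adic_carrier)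
  qed
  moreover have "(\<lambda>n. (- x n) mod 2 ^ n) \<otimes>\<^bsub>two_adic_int\<^esub> x = \<one>\<^bsub>two_adic_int\<^esub>"
    by (simp add: two_adic_mult two_adic_one mod_simps)
  ultimately show "\<exists>y\<in>carrier two_adic_int. y \<otimes>\<^bsub>two_adic_int\<^esub> x = \<one>\<^bsub>two_adic_int\<^esub>" by blast
qed

lemma two_adic_pow:
  assumes x: "x \<in> carrier two_adic_int"
  shows "x [^]\<^bsub>two_adic_int\<^esub> (k::nat) = (\<lambda>n. (int k * x n) mod 2 ^ n)"
proof -
  interpret Z: comm_group two_adic_int by (rule comm_group_two_adic_int)
  show ?thesis
    by (induction k) (simp_all add: two_adic_one two_adic_mult mod_simps distrib_right add.commute)
qed

text \<open>Level n + 1 decides level n: 2x \<equiv> 0 modulo 2^(n+1) gives x \<equiv> 0 modulo 2^n.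
  This is what separates rotations from reflections later.\<close>

lemma two_adic_no_2_torsion:
  assumes x: "x \<in> carrier two_adic_int" and "x \<otimes>\<^bsub>two_adic_int\<^esub> x = \<one>\<^bsub>two_adic_int\<^esub>"
  shows "x = \<one>\<^bsub>two_adic_int\<^esub>"
proof -
  have "x n = 0" for n
  proof -
    have "(x (Suc n) + x (Suc n)) mod 2 ^ Suc n = 0"
      using fun_cong[OF assms(2), of "Suc n"] unfolding two_adic_mult two_adic_one .
    hence "2 * 2 ^ n dvd 2 * x (Suc n)" by (simp add: mod_eq_0_iff_dvd)
    hence "2 ^ n dvd x (Suc n)" by (rule zdvd_mult_cancel) simp
    hence "x (Suc n) mod 2 ^ n = 0" by simp
    thus ?thesis using x by (simp add: two_adic_carrier)
  qed
  thus ?thesis by (auto simp: two_adic_one)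
qed

text \<open>\<open>N\<close> is invertible modulo every power of 2. The inverses \<open>u n\<close>
  are chosen independently at each level; compatibility of \<open>y\<close> follows by cancelling
  \<open>N\<close> in the congruences.\<close>

lemma two_adic_odd_divisible:
  assumes x: "x \<in> carrier two_adic_int" and "odd (N::nat)"
  obtains y where "y \<in> carrier two_adic_int" "x = y [^]\<^bsub>two_adic_int\<^esub> N"
proof -
  have cop: "coprime (int N) (2 ^ n)" for n using assms(2) by simp
  have "\<exists>u. [int N * u = 1] (mod 2 ^ n)" for n
    using cong_solve_coprime_int[OF cop] by blast
  then obtain u where u: "\<And>n. [int N * u n = 1] (mod 2 ^ n)" by metis
  define y where "y = (\<lambda>n. (u n * x n) mod 2 ^ n)"
  have Nux: "[int N * (u n * x n) = x n] (mod 2 ^ n)" for n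
    using cong_scalar_right[OF u[of n], of "x n"] by (simp add: mult.assoc)
  have y: "y \<in> carrier two_adic_int" unfolding y_def
  proof (rule two_adic_reduce)
    fix n
    have "[int N * (u (Suc n) * x (Suc n)) = x (Suc n)] (mod 2 ^ n)"
      by (rule cong_dvd_modulus[OF Nux[of "Suc n"]]) (simp add: le_imp_power_dvd)
    moreover have "[x (Suc n) = x n] (mod 2 ^ n)" using x by (simp add: cong_def two_adic_carrier)
    ultimately have "[int N * (u (Suc n) * x (Suc n)) = int N * (u n * x n)] (mod 2 ^ n)"
      using Nux[of n] by (meson cong_sym cong_trans)
    thus "u (Suc n) * x (Suc n) mod 2 ^ n = u n * x n mod 2 ^ n"
      using cong_mult_lcancel[OF cop] unfolding cong_def by blast
  qed
  have "x n = (int N * y n) mod 2 ^ n" for n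
  proof -
    have "(int N * y n) mod 2 ^ n = x n mod 2 ^ n" using Nux[of n] by (simp add: y_def cong_def mod_simps)
    thus ?thesis using x by (simp add: two_adic_carrier)
  qed
  thus ?thesis using that[OF y] two_adic_pow[OF y, of N] by auto
qed

text \<open>The 2-adic integer 1; \<open>mod\<close> matters at level 0, where the only residue is
  0.\<close>

definition two_adic_unit :: "nat \<Rightarrow> int" where
  "two_adic_unit = (\<lambda>n. 1 mod 2 ^ n)"

lemma two_adic_unit_carrier: "two_adic_unit \<in> carrier two_adic_int"
  unfolding two_adic_unit_def by (rule two_adic_reduce) simp

text \<open>The natural numbers are dense: \<open>k\<close> is the residue of \<open>x\<close>
  modulo 2^m, and \<open>y\<close> is the digit sequence of \<open>x\<close> moved by m places. It
  lets a single automorphism stand for all of the 2-adic group on each layer.\<close>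

lemma two_adic_decompose:
  assumes x: "x \<in> carrier two_adic_int"
  obtains k y where "y \<in> carrier two_adic_int"
    "x = (two_adic_unit [^]\<^bsub>two_adic_int\<^esub> (k::nat)) \<otimes>\<^bsub>two_adic_int\<^esub> (y [^]\<^bsub>two_adic_int\<^esub> (2 ^ m :: nat))"
proof
  define y where "y = (\<lambda>j. x (j + m) div 2 ^ m)"
  have xm: "x (j + m) = x m + 2 ^ m * y j" for j
    using two_adic_mod_add[OF x, of m j] mult_div_mod_eq[of "2 ^ m" "x (j + m)"]
    by (simp add: y_def add.commute)
  have "0 \<le> y j" "y j < 2 ^ j" "y (Suc j) mod 2 ^ j = y j" for j
  proof -
    have *: "0 \<le> x (j + m)" "x (j + m) < 2 ^ (j + m)" "0 \<le> x m" using x by (auto simp: two_adic_carrier)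
    show "0 \<le> y j" unfolding y_def using * by (simp add: pos_imp_zdiv_nonneg_iff)
    have "(2::int) ^ (j + m) = 2 ^ m * 2 ^ j" by (simp add: power_add)
    hence "2 ^ m * y j < 2 ^ m * 2 ^ j" using * xm[of j] by linarith
    thus "y j < 2 ^ j" by simp
    have "2 ^ m * (y (Suc j) mod 2 ^ j) = (2 ^ m * y (Suc j)) mod (2 ^ m * 2 ^ j)"
      by (rule mult_mod_right)
    also have "2 ^ m * y (Suc j) = x (Suc (j + m)) - x m" using xm[of "Suc j"] by simp
    also have "(x (Suc (j + m)) - x m) mod (2 ^ m * 2 ^ j) = (x (Suc (j + m)) mod 2 ^ (j + m) - x m) mod 2 ^ (j + m)"
      by (simp add: mod_simps power_add mult.commute)
    also have "\<dots> = (x (j + m) - x m) mod 2 ^ (j + m)" using x by (simp add: two_adic_carrier)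
    also have "\<dots> = (2 ^ m * y j) mod (2 ^ m * 2 ^ j)" using xm[of j] by (simp add: power_add mult.commute)
    also have "\<dots> = 2 ^ m * y j" using \<open>0 \<le> y j\<close> \<open>y j < 2 ^ j\<close> by (intro mod_pos_pos_trivial) auto
    finally show "y (Suc j) mod 2 ^ j = y j" by simp
  qed
  thus y: "y \<in> carrier two_adic_int" by (simp add: two_adic_carrier)
  have "x n = (int (nat (x m)) * two_adic_unit n mod 2 ^ n + int (2 ^ m) * y n mod 2 ^ n) mod 2 ^ n" for n
  proof -
    have "0 \<le> x m" using x by (simp add: two_adic_carrier)
    hence "(int (nat (x m)) * two_adic_unit n mod 2 ^ n + int (2 ^ m) * y n mod 2 ^ n) mod 2 ^ n = x (n + m) mod 2 ^ n"
      by (simp add: two_adic_unit_def mod_simps xm[of n])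
    thus ?thesis using two_adic_mod_add[OF x, of n m] by simp
  qed
  thus "x = (two_adic_unit [^]\<^bsub>two_adic_int\<^esub> nat (x m)) \<otimes>\<^bsub>two_adic_int\<^esub> (y [^]\<^bsub>two_adic_int\<^esub> (2 ^ m :: nat))"
    unfolding two_adic_mult two_adic_pow[OF y] two_adic_pow[OF two_adic_unit_carrier] by blast
qed

section \<open>Layers of the anti-cyclotomic extension\<close>

lemma adjoin_i_subset: "adjoin \<rat> {\<i>} \<subseteq> {z. Re z \<in> \<rat> \<and> Im z \<in> \<rat>}"
proof -
  have "subfield {z. Re z \<in> \<rat> \<and> Im z \<in> \<rat>} CC"
    unfolding subfield_CC_iff
    by (auto simp: power2_eq_square intro!: Rats_add Rats_diff Rats_mult Rats_divide Rats_minus_iff[THEN iffD2])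
  moreover have "\<rat> \<union> {\<i>} \<subseteq> {z. Re z \<in> \<rat> \<and> Im z \<in> \<rat>}"
  proof -
    have "Re q \<in> \<rat> \<and> Im q \<in> \<rat>" if q: "q \<in> \<rat>" for q :: complex
    proof -
      obtain a b where "q = of_int a / of_int b" using q by (rule Rats_cases')
      hence "q = complex_of_real (of_int a / of_int b)" by simp
      thus ?thesis by (metis Im_complex_of_real Re_complex_of_real Rats_0 Rats_divide Rats_of_int)
    qed
    thus ?thesis by auto
  qed
  ultimately show ?thesis unfolding adjoin_def
    by (intro field.generate_field_min_subfield1[OF CC_field]) auto
qed

lemma adjoin_i_fixed_cnj:
  assumes "z \<in> adjoin \<rat> {\<i>}" "cnj z = z"
  shows "z \<in> \<rat>"
proof -
  have "Re z \<in> \<rat>" using assms adjoin_i_subset by auto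
  then obtain a b where "Re z = of_int a / of_int b" by (rule Rats_cases')
  moreover have "z = of_real (Re z)" using assms(2) by (simp add: complex_eq_iff)
  ultimately have "z = of_int a / of_int b" by (metis of_real_divide of_real_of_int_eq)
  thus ?thesis by simp
qed

lemma i_in_adjoin: "\<i> \<in> adjoin \<rat> {\<i>}"
  unfolding adjoin_def by (rule generate_field.incl) simp

text \<open>The Galois group of an anti-cyclotomic extension, as an action of the 2-adic integers.\<close>

locale anticyclotomic_action = subfld Kinf for Kinf :: "complex set" +
  fixes K0 :: "complex set" and act :: "(nat \<Rightarrow> int) \<Rightarrow> complex \<Rightarrow> complex"
  assumes K0: "K0 = adjoin \<rat> {\<i>}" "subfield K0 CC" "K0 \<subseteq> Kinf"
    and act_hom: "a \<in> carrier two_adic_int \<Longrightarrow> field_hom Kinf (act a)"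
    and act_closed: "a \<in> carrier two_adic_int \<Longrightarrow> x \<in> Kinf \<Longrightarrow> act a x \<in> Kinf"
    and act_mult: "a \<in> carrier two_adic_int \<Longrightarrow> b \<in> carrier two_adic_int \<Longrightarrow> x \<in> Kinf \<Longrightarrow>
      act (a \<otimes>\<^bsub>two_adic_int\<^esub> b) x = act a (act b x)"
    and act_K0: "a \<in> carrier two_adic_int \<Longrightarrow> x \<in> K0 \<Longrightarrow> act a x = x"
    and act_fixed: "x \<in> Kinf \<Longrightarrow> (\<And>a. a \<in> carrier two_adic_int \<Longrightarrow> act a x = x) \<Longrightarrow> x \<in> K0"
    and cnj_Kinf: "x \<in> Kinf \<Longrightarrow> cnj x \<in> Kinf"
    and act_cnj: "a \<in> carrier two_adic_int \<Longrightarrow> x \<in> Kinf \<Longrightarrow> act a (cnj (act a x)) = cnj x"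

text \<open>The isomorphisms of the group over \<open>K0\<close> with the 2-adic integers and of the
  group over \<rat> with the dihedral group are unrelated a priori. Torsion matches them: an
  automorphism over \<open>K0\<close> cannot be a reflection, since the 2-adic integers contain no
  involution, and complex conjugation, a nontrivial involution, must be one.\<close>

lemma anticyclotomic_actionI:
  assumes anti: "anticyclotomic_Z2_extension K0 Kinf" and K0: "K0 = adjoin \<rat> {\<i>}"
  obtains act where "anticyclotomic_action Kinf K0 act"
proof -
  let ?Z = "two_adic_int" and ?A = "gal_group K0 Kinf" and ?G = "gal_group \<rat> Kinf"
    and ?D = "dihedral_group two_adic_int"
  interpret Z: comm_group ?Z by (rule comm_group_two_adic_int)
  have gal: "galois_extension K0 Kinf" "galois_extension \<rat> Kinf"
    using anti by (auto simp: anticyclotomic_Z2_extension_def Z2_extension_def)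
  have ext: "subfield K0 CC" "subfield Kinf CC" "K0 \<subseteq> Kinf" "\<rat> \<subseteq> Kinf"
    using gal by (auto simp: galois_extension_def extension_def)
  interpret Kinf: subfld Kinf by (rule subfld.intro) (rule ext)
  interpret K0': subfld K0 by (rule subfld.intro) (rule ext)
  obtain \<phi> where \<phi>: "\<phi> \<in> iso ?A ?Z"
    using anti by (auto simp: anticyclotomic_Z2_extension_def Z2_extension_def topgroup_iso_def)
  obtain \<delta> where \<delta>: "\<delta> \<in> iso ?G ?D"
    using anti by (auto simp: anticyclotomic_Z2_extension_def topgroup_iso_def)
  have \<phi>_bij: "bij_betw \<phi> (carrier ?A) (carrier ?Z)"
    and \<phi>_mult: "\<And>\<sigma> \<tau>. \<sigma> \<in> carrier ?A \<Longrightarrow> \<tau> \<in> carrier ?A \<Longrightarrow> \<phi> (\<sigma> \<otimes>\<^bsub>?A\<^esub> \<tau>) = \<phi> \<sigma> \<otimes>\<^bsub>?Z\<^esub> \<phi> \<tau>"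
    using \<phi> by (auto simp: iso_def hom_def)
  have \<delta>_inj: "inj_on \<delta> (carrier ?G)" and \<delta>_closed: "\<And>\<sigma>. \<sigma> \<in> carrier ?G \<Longrightarrow> \<delta> \<sigma> \<in> carrier ?D"
    and \<delta>_mult: "\<And>\<sigma> \<tau>. \<sigma> \<in> carrier ?G \<Longrightarrow> \<tau> \<in> carrier ?G \<Longrightarrow> \<delta> (\<sigma> \<otimes>\<^bsub>?G\<^esub> \<tau>) = \<delta> \<sigma> \<otimes>\<^bsub>?D\<^esub> \<delta> \<tau>"
    using \<delta> by (auto simp: iso_def hom_def bij_betw_def)
  define act where "act = the_inv_into (carrier ?A) \<phi>"
  have act: "act a \<in> carrier ?A" "\<phi> (act a) = a" if "a \<in> carrier ?Z" for a
    using \<phi>_bij that by (auto simp: act_def bij_betw_def the_inv_into_into f_the_inv_into_f)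
  have act_eq: "act (a \<otimes>\<^bsub>?Z\<^esub> b) = act a \<otimes>\<^bsub>?A\<^esub> act b" if "a \<in> carrier ?Z" "b \<in> carrier ?Z" for a b
  proof (rule inj_onD[OF bij_betw_imp_inj_on[OF \<phi>_bij]])
    show "\<phi> (act (a \<otimes>\<^bsub>?Z\<^esub> b)) = \<phi> (act a \<otimes>\<^bsub>?A\<^esub> act b)" using that act by (simp add: \<phi>_mult)
    show "act a \<otimes>\<^bsub>?A\<^esub> act b \<in> carrier ?A" using that act ext by (intro gal_group_closed) auto
  qed (use that act in auto)
  have act_mult: "act (a \<otimes>\<^bsub>?Z\<^esub> b) x = act a (act b x)"
    if "a \<in> carrier ?Z" "b \<in> carrier ?Z" "x \<in> Kinf" for a b x
    using that act gal_group_mult_apply[of "act a" K0 Kinf "act b" x] by (simp add: act_eq)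
  have act_surj: "\<exists>a\<in>carrier ?Z. \<sigma> = act a" if "\<sigma> \<in> carrier ?A" for \<sigma>
    using \<phi>_bij that by (intro bexI[of _ "\<phi> \<sigma>"]) (auto simp: act_def bij_betw_def the_inv_into_f_f)
  have AG: "\<sigma> \<in> carrier ?G" if "\<sigma> \<in> carrier ?A" for \<sigma>
    using that K0'.Rats_subset by (auto simp: gal_group_carrier)
  have D_mult: "(a, s) \<otimes>\<^bsub>?D\<^esub> (b, t) = (a \<otimes>\<^bsub>?Z\<^esub> (if s then inv\<^bsub>?Z\<^esub> b else b), s \<noteq> t)" for a b s t
    by (simp add: dihedral_group_def)
  have D_carrier: "(a, s) \<in> carrier ?D \<longleftrightarrow> a \<in> carrier ?Z" for a s
    by (simp add: dihedral_group_def)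
  define e where "e = (\<lambda>x\<in>Kinf. x)"
  have e: "e \<in> carrier ?G"
    using ext by (auto simp: e_def gal_group_carrier bij_betw_def inj_on_def subset_iff)
  have e_mult: "e \<otimes>\<^bsub>?G\<^esub> e = e" using gal_group_mult[OF e e] by (auto simp: e_def compose_def)
  \<comment> \<open>\<open>e\<close> is idempotent, and the only idempotent of the dihedral group is
    its neutral element.\<close>
  have \<delta>e: "\<delta> e = (\<one>\<^bsub>?Z\<^esub>, False)"
  proof -
    obtain a s where as: "\<delta> e = (a, s)" by (cases "\<delta> e")
    have aZ: "a \<in> carrier ?Z" using \<delta>_closed[OF e] as by (simp add: D_carrier)
    have "(a, s) = (a, s) \<otimes>\<^bsub>?D\<^esub> (a, s)" using \<delta>_mult[OF e e] as e_mult by simp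
    hence "\<not> s" "a = a \<otimes>\<^bsub>?Z\<^esub> a" by (auto simp: D_mult)
    thus ?thesis using as aZ Z.r_cancel_one' by simp
  qed
  have e_eq: "\<sigma> = e" if "\<sigma> \<in> carrier ?G" "\<And>x. x \<in> Kinf \<Longrightarrow> \<sigma> x = x" for \<sigma>
    using that by (auto simp: e_def gal_group_carrier extensional_def fun_eq_iff)
  define c where "c = restrict cnj Kinf"
  have cnj_Kinf: "cnj x \<in> Kinf" if "x \<in> Kinf" for x
  proof (rule galois_extension_normal[OF gal(2) that field_hom_cnj[OF subfld_UNIV]])
    show "cnj y = y" if "y \<in> \<rat>" for y :: complex
      using that by (elim Rats_cases') simp
  qed simp
  have cnj_Rats: "cnj q = q" if "q \<in> \<rat>" for q :: complex
    using that by (elim Rats_cases') simp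
  have c: "c \<in> carrier ?G"
  proof -
    have "bij_betw cnj Kinf Kinf" by (rule bij_betwI[of _ _ _ cnj]) (use cnj_Kinf in auto)
    hence "bij_betw c Kinf Kinf" unfolding c_def by (simp add: bij_betw_restrict_eq)
    thus ?thesis using ext cnj_Rats by (auto simp: gal_group_carrier c_def)
  qed
  have cc: "c \<otimes>\<^bsub>?G\<^esub> c = e"
  proof (rule e_eq[OF gal_group_closed[OF c c ext(4,2)]])
    fix x assume "x \<in> Kinf"
    thus "(c \<otimes>\<^bsub>?G\<^esub> c) x = x" using cnj_Kinf[of x] gal_group_mult_apply[OF c c, of x] by (simp add: c_def)
  qed
  \<comment> \<open>A reflection has trivial square, so \<open>a\<close> would be 2-torsion, hence
    neutral, and \<open>act a\<close> would be the identity, which is not a reflection.\<close>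
  have rot: "snd (\<delta> (act a)) = False" if a: "a \<in> carrier ?Z" for a
  proof (rule ccontr)
    assume "snd (\<delta> (act a)) \<noteq> False"
    then obtain y where y: "\<delta> (act a) = (y, True)" by (metis (full_types) prod.collapse)
    have aG: "act a \<in> carrier ?G" using act AG a by blast
    have yZ: "y \<in> carrier ?Z" using \<delta>_closed[OF aG] y by (simp add: D_carrier)
    have "\<delta> (act a \<otimes>\<^bsub>?G\<^esub> act a) = \<delta> e" using yZ y by (simp add: \<delta>_mult[OF aG aG] D_mult \<delta>e)
    hence "act a \<otimes>\<^bsub>?G\<^esub> act a = e"
      using gal_group_closed[OF aG aG ext(4,2)] e inj_onD[OF \<delta>_inj] by blast
    hence "act (a \<otimes>\<^bsub>?Z\<^esub> a) x = x" if "x \<in> Kinf" for x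
      using that a act_mult gal_group_mult_apply[OF aG aG that] by (simp add: e_def)
    hence "act (a \<otimes>\<^bsub>?Z\<^esub> a) = e" using a act AG by (intro e_eq) auto
    moreover have "act \<one>\<^bsub>?Z\<^esub> = e"
    proof (rule e_eq)
      fix x assume x: "x \<in> Kinf"
      have inj: "inj_on (act \<one>\<^bsub>?Z\<^esub>) Kinf" and cl: "act \<one>\<^bsub>?Z\<^esub> x \<in> Kinf"
        using act[OF Z.one_closed] x by (auto simp: gal_group_carrier bij_betw_def)
      have "act \<one>\<^bsub>?Z\<^esub> (act \<one>\<^bsub>?Z\<^esub> x) = act \<one>\<^bsub>?Z\<^esub> x" using act_mult[of "\<one>\<^bsub>?Z\<^esub>" "\<one>\<^bsub>?Z\<^esub>" x] x by simp
      thus "act \<one>\<^bsub>?Z\<^esub> x = x" using inj_onD[OF inj] cl x by blast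
    qed (use act AG in auto)
    ultimately have "a \<otimes>\<^bsub>?Z\<^esub> a = \<one>\<^bsub>?Z\<^esub>" using act(2) a by (metis Z.m_closed Z.one_closed)
    hence "a = \<one>\<^bsub>?Z\<^esub>" using two_adic_no_2_torsion a by blast
    hence "act a = e" using \<open>act \<one>\<^bsub>?Z\<^esub> = e\<close> by simp
    thus False using y \<delta>e by simp
  qed
  \<comment> \<open>A rotation with trivial square is trivial, but complex conjugation moves
    \<i>.\<close>
  obtain z where z: "\<delta> c = (z, True)" "z \<in> carrier ?Z"
  proof -
    obtain z b where zb: "\<delta> c = (z, b)" by (cases "\<delta> c")
    have zZ: "z \<in> carrier ?Z" using \<delta>_closed[OF c] zb by (simp add: D_carrier)
    have b
    proof (rule ccontr)
      assume "\<not> b"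
      hence "(z \<otimes>\<^bsub>?Z\<^esub> z, False) = \<delta> e" using cc \<delta>_mult[OF c c] zb by (simp add: D_mult)
      hence "z \<otimes>\<^bsub>?Z\<^esub> z = \<one>\<^bsub>?Z\<^esub>" using \<delta>e by simp
      hence "z = \<one>\<^bsub>?Z\<^esub>" by (rule two_adic_no_2_torsion[OF zZ])
      hence "\<delta> c = \<delta> e" using zb \<open>\<not> b\<close> \<delta>e by simp
      hence "c = e" using c e inj_onD[OF \<delta>_inj] by blast
      moreover have "\<i> \<in> Kinf" using i_in_adjoin K0 ext by blast
      ultimately have "cnj \<i> = \<i>" unfolding c_def e_def by (metis restrict_apply')
      thus False by simp
    qed
    thus ?thesis using that zb zZ by simp
  qed
  have acnj: "act a (cnj (act a x)) = cnj x" if a: "a \<in> carrier ?Z" and x: "x \<in> Kinf" for a x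
  proof -
    have aG: "act a \<in> carrier ?G" using act AG a by blast
    obtain y where y: "\<delta> (act a) = (y, False)" using rot[OF a] by (metis prod.collapse)
    have yZ: "y \<in> carrier ?Z" using \<delta>_closed[OF aG] y by (simp add: D_carrier)
    have ac: "act a \<otimes>\<^bsub>?G\<^esub> c \<in> carrier ?G" by (rule gal_group_closed[OF aG c ext(4,2)])
    \<comment> \<open>A rotation times a reflection is a reflection and squares to 1, which is the
      dihedral relation for \<open>act a\<close>.\<close>
    have "\<delta> ((act a \<otimes>\<^bsub>?G\<^esub> c) \<otimes>\<^bsub>?G\<^esub> (act a \<otimes>\<^bsub>?G\<^esub> c)) = \<delta> e"
      using y z yZ by (simp add: \<delta>_mult ac aG c D_mult \<delta>e)
    hence "(act a \<otimes>\<^bsub>?G\<^esub> c) \<otimes>\<^bsub>?G\<^esub> (act a \<otimes>\<^bsub>?G\<^esub> c) = e"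
      using gal_group_closed[OF ac ac ext(4,2)] e inj_onD[OF \<delta>_inj] by blast
    moreover have cx: "cnj x \<in> Kinf" "c (cnj x) = x" "act a x \<in> Kinf" "c (act a x) = cnj (act a x)"
      using x cnj_Kinf act[OF a] by (auto simp: c_def gal_group_carrier bij_betw_def)
    ultimately have "(act a \<otimes>\<^bsub>?G\<^esub> c) ((act a \<otimes>\<^bsub>?G\<^esub> c) (cnj x)) = cnj x"
      using gal_group_mult_apply[OF ac ac cx(1)] by (simp add: e_def)
    thus ?thesis using gal_group_mult_apply[OF aG c] cx by simp
  qed
  have "anticyclotomic_action Kinf K0 act"
  proof (intro anticyclotomic_action.intro anticyclotomic_action_axioms.intro)
    show "subfld Kinf" by unfold_locales
    show "K0 = adjoin \<rat> {\<i>}" "subfield K0 CC" "K0 \<subseteq> Kinf" by (fact K0 ext)+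
    fix x assume x: "x \<in> Kinf"
    show "cnj x \<in> Kinf" by (rule cnj_Kinf) (rule x)
    show "x \<in> K0" if "\<And>a. a \<in> carrier ?Z \<Longrightarrow> act a x = x"
    proof -
      have "\<sigma> x = x" if "\<sigma> \<in> carrier ?A" for \<sigma> using act_surj[OF that] \<open>\<And>a. a \<in> carrier ?Z \<Longrightarrow> act a x = x\<close> by blast
      thus ?thesis using gal(1) x by (auto simp: galois_extension_def)
    qed
    fix a assume a: "a \<in> carrier ?Z"
    show "act a x \<in> Kinf" using act[OF a] x by (auto simp: gal_group_carrier bij_betw_def)
    show "act a (cnj (act a x)) = cnj x" using a x by (rule acnj)
    show "act (a \<otimes>\<^bsub>?Z\<^esub> b) x = act a (act b x)" if "b \<in> carrier ?Z" for b using a that x by (rule act_mult)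
  next
    fix a assume a: "a \<in> carrier ?Z"
    show "field_hom Kinf (act a)" using act[OF a] ext(2) gal_group_field_hom by blast
    show "act a x = x" if "x \<in> K0" for x using act[OF a] that by (auto simp: gal_group_carrier)
  qed
  thus ?thesis by (rule that)
qed

section \<open>Layers as fixed fields of the subgroups 2^m Z_2\<close>

context anticyclotomic_action
begin

abbreviation (input) Z where "Z \<equiv> two_adic_int"

interpretation Z: comm_group two_adic_int by (rule comm_group_two_adic_int)

lemma act_one: "x \<in> Kinf \<Longrightarrow> act \<one>\<^bsub>Z\<^esub> x = x"
proof -
  assume x: "x \<in> Kinf"
  interpret field_hom Kinf "act \<one>\<^bsub>Z\<^esub>" by (rule act_hom) simp
  have "act \<one>\<^bsub>Z\<^esub> (act \<one>\<^bsub>Z\<^esub> x) = act \<one>\<^bsub>Z\<^esub> x" using act_mult[of "\<one>\<^bsub>Z\<^esub>" "\<one>\<^bsub>Z\<^esub>" x] x by simp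
  thus ?thesis using inj_onD[OF hom_inj _ act_closed x] x by simp
qed

lemma act_pow: "a \<in> carrier Z \<Longrightarrow> x \<in> Kinf \<Longrightarrow> act (a [^]\<^bsub>Z\<^esub> (k::nat)) x = (act a ^^ k) x"
proof (induction k arbitrary: x)
  case (Suc k)
  thus ?case using act_mult[of "a [^]\<^bsub>Z\<^esub> k" a x] act_closed by (simp add: funpow_swap1)
qed (simp add: act_one)

definition layer :: "nat \<Rightarrow> complex set" where
  "layer m = {x \<in> Kinf. \<forall>a\<in>carrier Z. act (a [^]\<^bsub>Z\<^esub> (2 ^ m :: nat)) x = x}"

lemma layer_Kinf: "layer m \<subseteq> Kinf"
  by (auto simp: layer_def)

lemma layer_subfield: "subfield (layer m) CC"
proof -
  have "act b (x + y) = x + y \<and> act b (x * y) = x * y \<and> act b (- x) = - x \<and> act b (inverse x) = inverse x \<and> act b 1 = 1"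
    if "b \<in> carrier Z" "x \<in> Kinf" "y \<in> Kinf" "act b x = x" "act b y = y" for b x y
  proof -
    interpret field_hom Kinf "act b" using that(1) by (rule act_hom)
    show ?thesis using that by simp
  qed
  thus ?thesis unfolding subfield_CC_iff layer_def
    by (auto simp: field_hom.hom_one[OF act_hom])
qed

lemma layer_act_closed:
  assumes "a \<in> carrier Z" "x \<in> layer m"
  shows "act a x \<in> layer m"
proof -
  have "act (b [^]\<^bsub>Z\<^esub> (2 ^ m :: nat)) (act a x) = act a x" if b: "b \<in> carrier Z" for b
  proof -
    have "act (b [^]\<^bsub>Z\<^esub> (2 ^ m :: nat)) (act a x) = act (a \<otimes>\<^bsub>Z\<^esub> b [^]\<^bsub>Z\<^esub> (2 ^ m :: nat)) x"
      using assms b subsetD[OF layer_Kinf assms(2)] act_mult[of "b [^]\<^bsub>Z\<^esub> (2 ^ m :: nat)" a x]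
      by (simp add: Z.m_comm)
    also have "\<dots> = act a x" using assms b by (simp add: act_mult layer_def)
    finally show ?thesis .
  qed
  thus ?thesis using assms act_closed by (auto simp: layer_def)
qed

lemma layer_cnj_closed:
  assumes "x \<in> layer m"
  shows "cnj x \<in> layer m"
proof -
  have "act (b [^]\<^bsub>Z\<^esub> (2 ^ m :: nat)) (cnj x) = cnj x" if b: "b \<in> carrier Z" for b
    using act_cnj[of "b [^]\<^bsub>Z\<^esub> (2 ^ m :: nat)" x] assms b by (simp add: layer_def)
  thus ?thesis using assms cnj_Kinf by (auto simp: layer_def)
qed

lemma layer_0: "layer 0 = K0"
  using act_fixed act_K0 K0 by (auto simp: layer_def)

lemma layer_mono: "layer m \<subseteq> layer (m + j)"
proof -
  have "a [^]\<^bsub>Z\<^esub> (2 ^ (m + j) :: nat) = (a [^]\<^bsub>Z\<^esub> (2 ^ j :: nat)) [^]\<^bsub>Z\<^esub> (2 ^ m :: nat)" if "a \<in> carrier Z" for a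
    using that by (simp add: Z.nat_pow_pow power_add mult.commute)
  thus ?thesis by (auto simp: layer_def)
qed

definition gen :: "complex \<Rightarrow> complex" where
  "gen = act two_adic_unit"

lemma gen_pow: "x \<in> Kinf \<Longrightarrow> (gen ^^ k) x = act (two_adic_unit [^]\<^bsub>Z\<^esub> k) x"
  unfolding gen_def by (simp add: act_pow two_adic_unit_carrier)

text \<open>Writing a = k + 2^j y gives 2^m a = k 2^m + 2^(m+j) y, and the second summand acts
  trivially on \<open>layer (m + j)\<close>. So one generator decides membership, with no appeal to
  continuity of the action.\<close>

lemma layer_iff:
  assumes x: "x \<in> layer (m + j)"
  shows "x \<in> layer m \<longleftrightarrow> (gen ^^ (2 ^ m)) x = x"
proof
  have xK: "x \<in> Kinf" using x layer_Kinf by blast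
  show "(gen ^^ (2 ^ m)) x = x" if "x \<in> layer m"
    using that two_adic_unit_carrier by (simp add: gen_pow xK layer_def)
  assume gen: "(gen ^^ (2 ^ m)) x = x"
  have "act (a [^]\<^bsub>Z\<^esub> (2 ^ m :: nat)) x = x" if a: "a \<in> carrier Z" for a
  proof -
    obtain k y where y: "y \<in> carrier Z" and a': "a = two_adic_unit [^]\<^bsub>Z\<^esub> (k::nat) \<otimes>\<^bsub>Z\<^esub> y [^]\<^bsub>Z\<^esub> (2 ^ j :: nat)"
      using two_adic_decompose[OF a] by blast
    define v where "v = two_adic_unit [^]\<^bsub>Z\<^esub> (2 ^ m :: nat)"
    have v: "v \<in> carrier Z" using two_adic_unit_carrier by (simp add: v_def)
    have "a [^]\<^bsub>Z\<^esub> (2 ^ m :: nat) = v [^]\<^bsub>Z\<^esub> k \<otimes>\<^bsub>Z\<^esub> y [^]\<^bsub>Z\<^esub> (2 ^ (m + j) :: nat)"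
      using y two_adic_unit_carrier
      by (simp add: a' v_def Z.pow_mult_distrib Z.m_comm Z.nat_pow_pow power_add mult.commute)
    hence "act (a [^]\<^bsub>Z\<^esub> (2 ^ m :: nat)) x = act (v [^]\<^bsub>Z\<^esub> k) x"
      using act_mult[of "v [^]\<^bsub>Z\<^esub> k" "y [^]\<^bsub>Z\<^esub> (2 ^ (m + j) :: nat)" x] v y x xK by (simp add: layer_def)
    also have "\<dots> = (act v ^^ k) x" using v xK by (rule act_pow)
    also have "\<dots> = x" using gen xK by (induction k) (simp_all add: v_def gen_pow)
    finally show ?thesis .
  qed
  thus "x \<in> layer m" using xK by (simp add: layer_def)
qed

text \<open>The rotation by 2^m is an involution of the upper layer with the lower layer as fixed
  field. When it is nontrivial, an anti-invariant element \<open>b\<close> together with 1 is a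
  basis.\<close>

lemma layer_step:
  obtains "layer (Suc m) = layer m" | "ring.dimension CC 2 (layer m) (layer (Suc m))"
proof (cases "layer (Suc m) = layer m")
  case False
  define t where "t = gen ^^ (2 ^ m)"
  interpret M: subfld "layer m" by (rule subfld.intro) (rule layer_subfield)
  interpret M': subfld "layer (Suc m)" by (rule subfld.intro) (rule layer_subfield)
  have t: "t x = act (two_adic_unit [^]\<^bsub>Z\<^esub> (2 ^ m :: nat)) x" if "x \<in> Kinf" for x
    using that by (simp add: t_def gen_pow)
  have uc: "two_adic_unit [^]\<^bsub>Z\<^esub> (2 ^ m :: nat) \<in> carrier Z" using two_adic_unit_carrier by simp
  have tM': "t x \<in> layer (Suc m)" if "x \<in> layer (Suc m)" for x
    using layer_act_closed[OF uc that] t[OF subsetD[OF layer_Kinf that]] by simp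
  interpret t: field_hom "layer (Suc m)" t
  proof -
    interpret u: field_hom Kinf "act (two_adic_unit [^]\<^bsub>Z\<^esub> (2 ^ m :: nat))" by (rule act_hom) (rule uc)
    show "field_hom (layer (Suc m)) t"
      by unfold_locales (use layer_Kinf[of "Suc m"] t in \<open>auto simp: subset_iff\<close>)
  qed
  have iff: "x \<in> layer m \<longleftrightarrow> t x = x" if "x \<in> layer (Suc m)" for x
    using layer_iff[of x m 1] that by (simp add: t_def)
  have tt: "t (t x) = x" if "x \<in> layer (Suc m)" for x
    using layer_iff[of x "Suc m" 0] that by (simp add: t_def funpow_funpow mult_2)
  obtain y where y: "y \<in> layer (Suc m)" "t y \<noteq> y" using False layer_mono[of m 1] iff by auto
  define b where "b = y - t y"
  have b: "b \<in> layer (Suc m)" "t b = - b" "b \<noteq> 0" using y tM' tt by (auto simp: b_def)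
  hence "b \<notin> layer m" using iff[of b] by (auto simp: equal_neg_zero)
  have "ring.dimension CC 1 (layer m) (layer m)"
    using ring.dimension_one[OF CC_ring layer_subfield] .
  hence "ring.dimension CC (Suc 1) (layer m) (ring.line_extension CC (layer m) b (layer m))"
    using \<open>b \<notin> layer m\<close> by (intro ring.Suc_dim[OF CC_ring]) auto
  moreover have "ring.line_extension CC (layer m) b (layer m) = layer (Suc m)"
  proof
    show "ring.line_extension CC (layer m) b (layer m) \<subseteq> layer (Suc m)"
      using b(1) layer_mono[of m 1]
      by (auto simp: ring.line_extension_mem_iff[OF CC_ring] intro!: M'.add M'.mult dest: subsetD)
    show "layer (Suc m) \<subseteq> ring.line_extension CC (layer m) b (layer m)"
    proof
      fix x assume x: "x \<in> layer (Suc m)"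
      \<comment> \<open>\<open>x\<close> is split into its anti-invariant and invariant halves;
        \<open>k\<close> is a quotient of two anti-invariant elements and hence invariant.\<close>
      define k where "k = (x - t x) / (b + b)"
      define v where "v = (x + t x) / 2"
      have two: "2 \<in> layer (Suc m)" using M'.of_nat[of 2] by simp
      have k: "k \<in> layer (Suc m)" and v: "v \<in> layer (Suc m)"
        unfolding k_def v_def using x b(1) tM'[OF x] two by simp_all
      have "t k = k"
      proof -
        have "t k = t (x - t x) * inverse (t (b + b))"
          unfolding k_def divide_inverse using x b(1) tM'[OF x]
          by (simp only: t.hom_mult t.hom_inverse M'.add M'.diff M'.inverse)
        also have "\<dots> = (t x - x) * inverse (- b + - b)"
          using x b(1,2) tM'[OF x] tt[OF x] by (simp only: t.hom_diff t.hom_add)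
        also have "(t x - x) * inverse (- b + - b) = (x - t x) * inverse (b + b)"
          by (metis inverse_minus_eq minus_add_distrib minus_diff_eq minus_mult_minus)
        finally show ?thesis by (simp only: k_def divide_inverse)
      qed
      moreover have "t v = v"
      proof -
        have "t v = t (x + t x) * inverse (t 2)"
          unfolding v_def divide_inverse using x tM'[OF x] two
          by (simp only: t.hom_mult t.hom_inverse M'.add M'.inverse)
        also have "t 2 = 2" using t.hom_of_nat[of 2] by simp
        also have "t (x + t x) = x + t x"
          using x tM'[OF x] tt[OF x] by (simp only: t.hom_add add.commute)
        finally show ?thesis by (simp only: v_def divide_inverse)
      qed
      moreover have "x = k * b + v" using b(3) by (simp add: k_def v_def field_simps)
      ultimately show "x \<in> ring.line_extension CC (layer m) b (layer m)"
        using iff k v by (auto simp: ring.line_extension_mem_iff[OF CC_ring])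
    qed
  qed
  ultimately show ?thesis using that(2) by (simp only: numeral_2_eq_2 One_nat_def)
qed (rule that)

text \<open>Only an upper bound: equality follows in \<open>is_layer_eq\<close> from a given field
  of degree \<open>2 ^ m\<close>.\<close>

lemma layer_dimension: "\<exists>d\<le>2 ^ m. ring.dimension CC d K0 (layer m)"
proof (induction m)
  case 0
  show ?case using ring.dimension_one[OF CC_ring K0(2)] by (auto simp: layer_0)
next
  case (Suc m)
  then obtain d where d: "d \<le> 2 ^ m" "ring.dimension CC d K0 (layer m)" by blast
  show ?case
  proof (cases rule: layer_step[of m])
    case 1
    thus ?thesis using d by (intro exI[of _ d]) auto
  next
    case 2
    thus ?thesis using d ring.telescopic_base[OF CC_ring K0(2) layer_subfield d(2) 2] by (intro exI[of _ "d * 2"]) auto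
  qed
qed

text \<open>A power \<open>a ^ i\<close> with \<open>1 \<le> i \<le> 2 ^ m\<close> fixes \<open>x\<close>, because \<open>x\<close> has at most \<open>2 ^ m\<close> conjugates. The
  odd part of \<open>i\<close> is removed by taking \<open>a\<close> to be a suitable odd power.\<close>

lemma degree_layer:
  assumes M: "extension_degree K0 M (2 ^ m)" "M \<subseteq> Kinf"
  shows "M \<subseteq> layer m"
proof
  fix x assume x: "x \<in> M"
  have xK: "x \<in> Kinf" using x M by blast
  have ext: "subfield M CC" "ring.dimension CC (2 ^ m) K0 M" using M by (auto simp: extension_degree_def extension_def)
  obtain p where p: "p \<in> subfld.polys K0" "p \<noteq> 0" "degree p \<le> 2 ^ m" "poly p x = 0"
    using dimension_polyE[OF K0(2) ext x] by blast
  interpret K0: subfld K0 by (rule subfld.intro) (rule K0)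
  have root: "poly p (act a x) = 0" if "a \<in> carrier Z" for a
  proof -
    interpret a: field_hom Kinf "act a" using that by (rule act_hom)
    have "map_poly (act a) p = p" using p(1) act_K0 that by (auto simp: poly_eq_iff K0.polys_def)
    moreover have "p \<in> polys" using p(1) K0(3) by (auto simp: polys_def K0.polys_def)
    ultimately show ?thesis using a.hom_poly[of p x] xK p(4) by simp
  qed
  have "act (a [^]\<^bsub>Z\<^esub> (2 ^ m :: nat)) x = x" if a: "a \<in> carrier Z" for a
  proof -
    \<comment> \<open>One odd number has to serve every \<open>i\<close> that the pigeonhole
      principle may return, so it collects all odd factors up to \<open>2 ^ m\<close>; then
      \<open>i\<close> divides \<open>2 ^ m * N\<close>.\<close>
    define N where "N = (\<Prod>i\<in>{i\<in>{1..2 ^ m}. odd i}. i :: nat)"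
    have "odd N" unfolding N_def by (rule ccontr) (auto simp: even_prod_iff)
    then obtain b where b: "b \<in> carrier Z" "a = b [^]\<^bsub>Z\<^esub> N"
      using two_adic_odd_divisible[OF a] by blast
    interpret b: field_hom Kinf "act b" using b(1) by (rule act_hom)
    have bK: "(act b ^^ k) y \<in> Kinf" if "y \<in> Kinf" for k y
      using that act_closed[OF b(1)] by (induction k) auto
    have "card ((\<lambda>k. (act b ^^ k) x) ` {..2 ^ m}) \<le> card {y. poly p y = 0}"
      using poly_roots_finite[OF p(2)] root b xK
      by (intro card_mono) (auto simp flip: act_pow)
    also have "\<dots> \<le> 2 ^ m" using card_poly_roots_bound[OF p(2)] p(3) by simp
    finally have "\<not> inj_on (\<lambda>k. (act b ^^ k) x) {..2 ^ m}"
      by (intro pigeonhole) simp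
    then obtain j k where jk: "j < k" "k \<le> 2 ^ m" "(act b ^^ j) x = (act b ^^ k) x"
      by (auto simp: inj_on_def) (metis linorder_neqE_nat)
    define i where "i = k - j"
    have binj: "y = z" if "(act b ^^ j) y = (act b ^^ j) z" "y \<in> Kinf" "z \<in> Kinf" for j y z
      using that
    proof (induction j)
      case (Suc j)
      thus ?case using inj_onD[OF b.hom_inj, of "(act b ^^ j) y" "(act b ^^ j) z"] bK by simp
    qed simp
    have "(act b ^^ j) x = (act b ^^ j) ((act b ^^ i) x)"
      using jk by (simp add: i_def funpow_funpow)
    hence i: "(act b ^^ i) x = x" using binj[of j x "(act b ^^ i) x"] xK bK by metis
    have i0: "i \<noteq> 0" "i \<le> 2 ^ m" using jk by (auto simp: i_def)
    obtain v q where vq: "i = 2 ^ v * q" "odd q"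
      using multiplicity_decompose'[OF i0(1), of 2] by (metis not_prime_unit two_is_prime_nat)
    have "q \<le> 2 ^ m" "1 \<le> q" using vq i0 by (auto intro: order_trans[of q "2 ^ v * q"] Suc_leI odd_pos)
    hence "q dvd N" unfolding N_def using vq(2) by (intro dvd_prodI) auto
    have "2 ^ v \<le> (2 :: nat) ^ m" using vq i0 by (metis One_nat_def \<open>1 \<le> q\<close> mult_le_mono2 nat_mult_1_right order_trans)
    hence "v \<le> m" by simp
    hence "i dvd 2 ^ m * N" unfolding vq(1) using \<open>q dvd N\<close> by (intro mult_dvd_mono le_imp_power_dvd)
    then obtain r where r: "2 ^ m * N = i * r" by (elim dvdE)
    have "a [^]\<^bsub>Z\<^esub> (2 ^ m :: nat) = b [^]\<^bsub>Z\<^esub> (i * r)"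
      using b by (simp add: Z.nat_pow_pow mult.commute flip: r)
    hence "act (a [^]\<^bsub>Z\<^esub> (2 ^ m :: nat)) x = (act b ^^ (i * r)) x" using b xK by (simp add: act_pow)
    also have "\<dots> = x" using i by (induction r) (simp_all add: funpow_add)
    finally show ?thesis .
  qed
  thus "x \<in> layer m" using xK by (simp add: layer_def)
qed

text \<open>A basis of \<open>M\<close> consists of \<open>2 ^ m\<close> independent elements of
  \<open>layer m\<close>, whose dimension is at most that, so it spans both. The layer is thus
  unique and explicit.\<close>

lemma is_layer_eq:
  assumes "is_layer K0 Kinf m M"
  shows "M = layer m"
proof -
  have M: "extension_degree K0 M (2 ^ m)" "M \<subseteq> Kinf" using assms by (auto simp: is_layer_def)
  obtain d where d: "d \<le> 2 ^ m" "ring.dimension CC d K0 (layer m)" using layer_dimension by blast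
  have dim: "ring.dimension CC (2 ^ m) K0 M" using M by (simp add: extension_degree_def)
  obtain Vs where Vs: "ring.independent CC K0 Vs" "length Vs = 2 ^ m" "ring.Span CC K0 Vs = M" "set Vs \<subseteq> UNIV"
    using ring.exists_base[OF CC_ring K0(2) dim] by auto
  have "set Vs \<subseteq> M" using ring.Span_base_incl[OF CC_ring K0(2), of Vs] Vs by simp
  hence V: "set Vs \<subseteq> layer m" using degree_layer[OF M] by blast
  have "2 ^ m \<le> d" using ring.independent_length_le_dimension[OF CC_ring K0(2) d(2) Vs(1) V] Vs(2) by simp
  hence "length Vs = d" using d Vs by simp
  thus ?thesis using ring.independent_length_eq_dimension[OF CC_ring K0(2) d(2) Vs(1) V] Vs(3) by simp
qed

lemma dihedral_field_layer: "dihedral_field (layer m) gen m"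
proof -
  have u: "two_adic_unit \<in> carrier Z" by (rule two_adic_unit_carrier)
  interpret u: field_hom Kinf gen unfolding gen_def by (rule act_hom) (rule u)
  interpret M: subfld "layer m" by (rule subfld.intro) (rule layer_subfield)
  interpret field_hom "layer m" gen
    by unfold_locales (use layer_Kinf[of m] in \<open>auto simp: subset_iff\<close>)
  show ?thesis
  proof unfold_locales
    fix x assume x: "x \<in> layer m"
    have xK: "x \<in> Kinf" using x layer_Kinf by blast
    show "gen x \<in> layer m" unfolding gen_def using u x by (rule layer_act_closed)
    show "(gen ^^ 2 ^ m) x = x" using layer_iff[of x m 0] x by simp
    show "cnj x \<in> layer m" using x by (rule layer_cnj_closed)
    show "cnj (gen (cnj (gen x))) = x" unfolding gen_def using act_cnj[OF u xK] by simp
    \<comment> \<open>Invariance under \<open>gen\<close> puts \<open>x\<close> into layer 0, the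
      Gaussian rationals, whose real elements are rational.\<close>
    show "x \<in> \<rat>" if "gen x = x" "cnj x = x"
      using layer_iff[of x 0 m] x that layer_0 K0(1) by (intro adjoin_i_fixed_cnj) auto
  qed
qed

end

section \<open>Norms from a compositum\<close>

context subfld

\<comment> \<open>Division and minimal polynomials over a subfield\<close>
begin

text \<open>The usual descent on the degree, carried out so that quotient and remainder visibly keep
  their coefficients in \<open>E\<close>.\<close>

lemma polys_division:
  assumes m: "m \<in> polys" "m \<noteq> 0" and q: "q \<in> polys"
  shows "\<exists>u\<in>polys. \<exists>r\<in>polys. q = m * u + r \<and> (r = 0 \<or> degree r < degree m)"
  using q
proof (induction "degree q" arbitrary: q rule: less_induct)
  case less
  show ?case
  proof (cases "q = 0 \<or> degree q < degree m")
    case True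
    thus ?thesis using less.prems by (intro bexI[of _ 0] bexI[of _ q]) auto
  next
    case False
    define a where "a = monom (lead_coeff q / lead_coeff m) (degree q - degree m)"
    have a: "a \<in> polys" using m(1) less.prems by (auto simp: a_def polys_def)
    define q' where "q' = q - m * a"
    have q': "q' \<in> polys" using polys_diff[OF less.prems polys_mult[OF m(1) a]] by (simp add: q'_def)
    have "q \<noteq> 0" "degree m \<le> degree q" using False by auto
    have deg: "degree (m * a) = degree q"
      using \<open>q \<noteq> 0\<close> \<open>degree m \<le> degree q\<close> m(2) unfolding a_def
      by (subst degree_mult_eq) (auto simp: degree_monom_eq monom_eq_0_iff)
    have "coeff (m * a) (degree q) = lead_coeff q"
    proof -
      have "lead_coeff (m * a) = lead_coeff m * lead_coeff a" by (rule lead_coeff_mult)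
      also have "\<dots> = lead_coeff q" using m(2) \<open>q \<noteq> 0\<close> by (simp add: a_def degree_monom_eq)
      finally show ?thesis by (simp add: deg)
    qed
    hence "coeff q' (degree q) = 0" by (simp add: q'_def)
    moreover have "degree q' \<le> degree q" unfolding q'_def by (rule degree_diff_le) (use deg in auto)
    ultimately consider "q' = 0" | "degree q' < degree q" using eq_zero_or_degree_less by blast
    thus ?thesis
    proof cases
      case 1
      thus ?thesis using a by (intro bexI[of _ a] bexI[of _ 0]) (auto simp: q'_def)
    next
      case 2
      then obtain u r where "u \<in> polys" "r \<in> polys" "q' = m * u + r" "r = 0 \<or> degree r < degree m"
        using less.hyps[OF 2 q'] by blast
      thus ?thesis using polys_add[OF a, of u]
        by (intro bexI[of _ "a + u"] bexI[of _ r]) (auto simp: q'_def algebra_simps)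
    qed
  qed
qed

lemma minimal_polynomialE:
  assumes "p \<in> polys" "p \<noteq> 0" "poly p x = 0"
  obtains m where "m \<in> polys" "m \<noteq> 0" "poly m x = 0"
    "\<And>q. q \<in> polys \<Longrightarrow> poly q x = 0 \<Longrightarrow> \<exists>u\<in>polys. q = m * u"
proof -
  define P where "P = (\<lambda>m. m \<in> polys \<and> m \<noteq> 0 \<and> poly m x = 0)"
  have "P p" using assms by (simp add: P_def)
  then obtain m where m: "P m" and min: "\<And>q. P q \<Longrightarrow> degree m \<le> degree q"
    using ex_has_least_nat[of P p degree] by blast
  have "\<exists>u\<in>polys. q = m * u" if q: "q \<in> polys" "poly q x = 0" for q
  proof -
    obtain u r where u: "u \<in> polys" and r: "r \<in> polys" "q = m * u + r" "r = 0 \<or> degree r < degree m"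
      using polys_division[of m q] m q by (auto simp: P_def)
    have "poly r x = 0" using q(2) r(2) m by (simp add: P_def)
    hence "r = 0" using r min[of r] by (cases "r = 0") (auto simp: P_def)
    thus ?thesis using u r by auto
  qed
  thus ?thesis using that[of m] m by (auto simp: P_def)
qed

lemma algebraic_of_poly:
  assumes "p \<in> polys" "p \<noteq> 0" "poly p x = 0"
  shows "ring.algebraic CC E x"
proof -
  have "rev (coeffs p) \<in> carrier (E [X]\<^bsub>CC\<^esub>)"
    using assms(1,2) by (auto simp: univ_poly_def polynomial_def polys_def hd_rev last_coeffs_eq_coeff_degree set_coeffs_subset_singleton_0_iff in_set_conv_nth coeffs_nth length_coeffs_degree)
  moreover have "rev (coeffs p) \<noteq> []" using assms(2) by simp
  moreover have "ring.eval CC (rev (coeffs p)) x = \<zero>\<^bsub>CC\<^esub>" using assms(3) by (simp add: eval_eq_poly)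
  ultimately show ?thesis using ring.algebraicI[OF CC_ring] by (simp add: over_def)
qed

lemma simple_extension_poly: "ring.simple_extension CC E x = {poly q x |q. q \<in> polys}"
proof -
  have "ring.simple_extension CC E x = (\<lambda>p. ring.eval CC p x) ` carrier (E [X]\<^bsub>CC\<^esub>)"
    by (rule ring.simple_extension_as_eval_img[OF CC_ring]) auto
  also have "\<dots> = {poly q x |q. q \<in> polys}"
  proof (intro equalityI subsetI)
    fix y assume "y \<in> (\<lambda>p. ring.eval CC p x) ` carrier (E [X]\<^bsub>CC\<^esub>)"
    then obtain p where p: "p = [] \<or> set p \<subseteq> E" "y = poly (Poly (rev p)) x"
      by (auto simp: eval_eq_poly univ_poly_def polynomial_def)
    have "coeff (Poly (rev p)) i \<in> E" for i
      using p(1) nth_mem[of i "rev p"] by (auto simp: nth_default_def)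
    thus "y \<in> {poly q x |q. q \<in> polys}" using p(2) by (auto simp: polys_def)
  next
    fix y assume "y \<in> {poly q x |q. q \<in> polys}"
    then obtain q where q: "q \<in> polys" "y = poly q x" by blast
    have "rev (coeffs q) \<in> carrier (E [X]\<^bsub>CC\<^esub>)"
    proof (cases "q = 0")
      case False
      thus ?thesis using q(1) by (auto simp: univ_poly_def polynomial_def polys_def hd_rev last_coeffs_eq_coeff_degree in_set_conv_nth coeffs_nth length_coeffs_degree)
    qed (simp add: univ_poly_def polynomial_def)
    moreover have "y = ring.eval CC (rev (coeffs q)) x" using q(2) by (simp add: eval_eq_poly)
    ultimately show "y \<in> (\<lambda>p. ring.eval CC p x) ` carrier (E [X]\<^bsub>CC\<^esub>)" by blast
  qed
  finally show ?thesis .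
qed

end

text \<open>\<open>x\<close> is sent to a complex root of the image of its minimal polynomial. The
  value at \<open>poly q x\<close> is read off any representing polynomial: two of them differ by a
  multiple of the minimal polynomial, whose image vanishes at that root.\<close>

lemma (in field_hom) extend_simple:
  assumes "p \<in> polys" "p \<noteq> 0" "poly p x = 0"
  obtains E' g where "field_hom E' g" "E \<subseteq> E'" "x \<in> E'" "\<And>y. y \<in> E \<Longrightarrow> g y = f y"
proof -
  obtain m where m: "m \<in> polys" "m \<noteq> 0" "poly m x = 0"
    and min: "\<And>q. q \<in> polys \<Longrightarrow> poly q x = 0 \<Longrightarrow> \<exists>u\<in>polys. q = m * u"
    using minimal_polynomialE[OF assms] by blast
  have "degree (map_poly f m) = degree m"
  proof (rule antisym)
    show "degree m \<le> degree (map_poly f m)"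
      using m(1,2) by (intro le_degree) (auto simp: polys_def)
  qed (rule degree_map_poly_le)
  moreover have "degree m \<noteq> 0"
  proof
    assume "degree m = 0"
    then obtain a where "m = [:a:]" by (metis degree_eq_zeroE)
    thus False using m by simp
  qed
  ultimately have "\<not> constant (poly (map_poly f m))" by (simp add: constant_degree)
  then obtain x' where x': "poly (map_poly f m) x' = 0" using fundamental_theorem_of_algebra by blast
  define E' where "E' = {poly q x |q. q \<in> polys}"
  define g where "g y = poly (map_poly f (SOME q. q \<in> polys \<and> poly q x = y)) x'" for y
  have g: "g (poly q x) = poly (map_poly f q) x'" if q: "q \<in> polys" for q
  proof -
    define r where "r = (SOME r. r \<in> polys \<and> poly r x = poly q x)"
    have r: "r \<in> polys" "poly r x = poly q x"
      using someI[of "\<lambda>r. r \<in> polys \<and> poly r x = poly q x" q] q by (auto simp: r_def)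
    have "\<exists>u\<in>polys. r - q = m * u" using r q by (intro min polys_diff) auto
    then obtain u where u: "u \<in> polys" "r = q + m * u" by (auto simp: algebra_simps)
    have "map_poly f r = map_poly f q + map_poly f m * map_poly f u"
      using u q m by (simp add: map_poly_add map_poly_mult polys_mult)
    thus ?thesis using x' by (simp add: g_def flip: r_def)
  qed
  have sub: "subfield E' CC"
    using domain.simple_extension_is_subfield[OF field.axioms(1)[OF CC_field] subfield, of x]
      algebraic_of_poly[OF assms] by (simp add: E'_def simple_extension_poly over_def)
  have "field_hom E' g"
  proof (intro field_hom.intro field_hom_axioms.intro subfld.intro sub)
    show "g 1 = 1" using g[of 1] by simp
    fix y z assume "y \<in> E'" "z \<in> E'"
    then obtain q r where q: "q \<in> polys" "y = poly q x" and r: "r \<in> polys" "z = poly r x"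
      by (auto simp: E'_def)
    show "g (y + z) = g y + g z"
      using g[OF polys_add[OF q(1) r(1)]] g[OF q(1)] g[OF r(1)] q r by (simp add: map_poly_add)
    show "g (y * z) = g y * g z"
      using g[OF polys_mult[OF q(1) r(1)]] g[OF q(1)] g[OF r(1)] q r by (simp add: map_poly_mult)
  qed
  moreover have mem: "poly q x \<in> E'" if "q \<in> polys" for q using that by (auto simp: E'_def)
  have "E \<subseteq> E'" using mem[of "[:y:]" for y] by auto
  moreover have "x \<in> E'" using mem[of "[:0, 1:]"] by simp
  moreover have "map_poly f [:y:] = [:f y:]" for y
    by (rule poly_eqI) (simp add: coeff_pCons split: nat.splits)
  hence "g y = f y" if "y \<in> E" for y using g[of "[:y:]"] that by simp
  ultimately show ?thesis using that by blast
qed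

lemma extend_list:
  assumes "field_hom E f" "\<forall>x\<in>set xs. \<exists>p. p \<in> subfld.polys \<rat> \<and> p \<noteq> 0 \<and> poly p x = 0"
  shows "\<exists>E' g. field_hom E' g \<and> E \<subseteq> E' \<and> set xs \<subseteq> E' \<and> (\<forall>y\<in>E. g y = f y)"
  using assms(2)
proof (induction xs)
  case Nil
  thus ?case using assms(1) by auto
next
  case (Cons x xs)
  then obtain E1 g1 where 1: "field_hom E1 g1" "E \<subseteq> E1" "set xs \<subseteq> E1" "\<forall>y\<in>E. g1 y = f y" by auto
  obtain p where p: "p \<in> subfld.polys \<rat>" "p \<noteq> 0" "poly p x = 0" using Cons.prems by auto
  interpret g1: field_hom E1 g1 by (rule 1)
  interpret Q: subfld \<rat> by (rule subfld_Rats)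
  have "p \<in> g1.polys" using p(1) g1.Rats_subset by (auto simp: g1.polys_def Q.polys_def)
  then obtain E' g where "field_hom E' g" "E1 \<subseteq> E'" "x \<in> E'" "\<And>y. y \<in> E1 \<Longrightarrow> g y = g1 y"
    using g1.extend_simple p(2,3) by metis
  thus ?case using 1 by (intro exI[of _ E'] exI[of _ g]) auto
qed

text \<open>\<open>L\<close> is spanned over \<rat> by finitely many algebraic numbers. Adjoining
  them one by one yields a domain containing the compositum, to which the homomorphism is then
  restricted.\<close>

lemma extend_compositum:
  assumes f: "field_hom E f" and L: "galois_extension \<rat> L" "ring.dimension CC d \<rat> L"
  obtains g where "field_hom (compositum E L) g" "\<And>y. y \<in> E \<Longrightarrow> g y = f y"
proof -
  interpret Q: subfld \<rat> by (rule subfld_Rats)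
  obtain Vs where Vs: "ring.Span CC \<rat> Vs = L" "set Vs \<subseteq> UNIV"
    using ring.exists_base[OF CC_ring Q.subfield L(2)] by auto
  have VL: "set Vs \<subseteq> L" using ring.Span_base_incl[OF CC_ring Q.subfield, of Vs] Vs by simp
  have "\<forall>x\<in>set Vs. \<exists>p. p \<in> subfld.polys \<rat> \<and> p \<noteq> 0 \<and> poly p x = 0"
    using VL L(1) algebraic_polyE[OF Q.subfield] unfolding galois_extension_def by (metis subsetD)
  then obtain E' g where g: "field_hom E' g" "E \<subseteq> E'" "set Vs \<subseteq> E'" "\<forall>y\<in>E. g y = f y"
    using extend_list[OF f] by blast
  interpret g: field_hom E' g by (rule g)
  have "L \<subseteq> E'"
  proof
    fix x assume "x \<in> L"
    then obtain Ks where Ks: "set Ks \<subseteq> \<rat>" "x = ring.combine CC Ks Vs"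
      using ring.Span_mem_iff_length_version[OF CC_ring Q.subfield, of Vs x] Vs by auto
    have "ring.combine CC Ks Vs \<in> E'" if "set Ks \<subseteq> E'" "set Vs \<subseteq> E'" for Ks Vs
      using that
    proof (induction Ks arbitrary: Vs)
      case Nil thus ?case by (simp add: ring.combine.simps[OF CC_ring])
    next
      case (Cons k Ks)
      thus ?case by (cases Vs) (auto simp: ring.combine.simps[OF CC_ring])
    qed
    thus "x \<in> E'" using Ks g(3) g.Rats_subset by blast
  qed
  hence "compositum E L \<subseteq> E'" unfolding compositum_def
    using g by (intro field.generate_field_min_subfield1[OF CC_field _ g.subfield]) auto
  moreover have "subfld (compositum E L)" unfolding compositum_def
    by (rule subfld.intro, rule field.generate_field_is_subfield[OF CC_field]) simp
  ultimately have "field_hom (compositum E L) g" using field_hom_subset g(1) by blast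
  thus ?thesis using that g(4) by blast
qed

section \<open>Embeddings and norms under automorphisms\<close>

lemma embeddings_iff:
  "\<sigma> \<in> embeddings F E \<longleftrightarrow> \<sigma> \<in> extensional E \<and> \<sigma> 1 = 1 \<and> (\<forall>x\<in>F. \<sigma> x = x) \<and>
     (\<forall>x\<in>E. \<forall>y\<in>E. \<sigma> (x + y) = \<sigma> x + \<sigma> y \<and> \<sigma> (x * y) = \<sigma> x * \<sigma> y)"
  unfolding embeddings_def Ring.ring_hom_def by auto

lemma embeddings_field_hom: "\<sigma> \<in> embeddings F E \<Longrightarrow> subfield E CC \<Longrightarrow> field_hom E \<sigma>"
  by (simp add: field_hom_def field_hom_axioms_def subfld_def embeddings_iff)

lemma field_norm_mult:
  assumes "subfield E CC" "x \<in> E" "y \<in> E"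
  shows "field_norm F E (x * y) = field_norm F E x * field_norm F E y"
  unfolding field_norm_def prod.distrib[symmetric]
  by (rule prod.cong) (use assms in \<open>auto simp: embeddings_iff\<close>)

lemma field_norm_1: "field_norm F E 1 = 1"
  unfolding field_norm_def by (rule prod.neutral) (auto simp: embeddings_iff)

lemma field_hom_the_inv_into:
  assumes S: "field_hom M S" "S ` M = M"
  shows "field_hom M (the_inv_into M S)" "the_inv_into M S ` M = M"
    "\<And>x. x \<in> M \<Longrightarrow> the_inv_into M S (S x) = x" "\<And>x. x \<in> M \<Longrightarrow> S (the_inv_into M S x) = x"
proof -
  interpret field_hom M S by (rule S)
  define T where "T = the_inv_into M S"
  have TS: "T (S x) = x" if "x \<in> M" for x using that hom_inj by (simp add: T_def the_inv_into_f_f)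
  have ST: "S (T x) = x" if "x \<in> M" for x using that hom_inj S(2) by (simp add: T_def f_the_inv_into_f)
  have TM: "T x \<in> M" if "x \<in> M" for x using that hom_inj S(2) by (auto simp: T_def intro: the_inv_into_into)
  have SM: "S x \<in> M" if "x \<in> M" for x using that S(2) by blast
  have "T (x + y) = T x + T y" "T (x * y) = T x * T y" if "x \<in> M" "y \<in> M" for x y
    using TS[of "T x + T y"] TS[of "T x * T y"] TM ST that by simp_all
  moreover have "T 1 = 1" using TS[of 1] by simp
  ultimately show "field_hom M (the_inv_into M S)" unfolding T_def[symmetric]
    by unfold_locales auto
  show "the_inv_into M S ` M = M" unfolding T_def[symmetric] using TM TS SM by (metis image_eqI subsetI equalityI image_subsetI)
  show "\<And>x. x \<in> M \<Longrightarrow> the_inv_into M S (S x) = x" "\<And>x. x \<in> M \<Longrightarrow> S (the_inv_into M S x) = x"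
    using TS ST by (simp_all add: T_def)
qed

text \<open>\<open>S\<close> may move elements of \<open>E\<close>, but the conjugate of an
  embedding fixing \<open>E\<close> still fixes it, since \<open>T\<close> maps \<open>E\<close>
  into itself and \<open>S\<close> undoes \<open>T\<close>. The pair is kept symmetric enough to be
  used with both roles exchanged.\<close>

lemma embeddings_conj:
  assumes M: "subfield M CC" "E \<subseteq> M"
    and S: "field_hom M S" and T: "field_hom M T" "T ` M = M" "T ` E \<subseteq> E" "\<And>x. x \<in> M \<Longrightarrow> S (T x) = x"
    and stable: "\<forall>\<sigma>\<in>embeddings E M. \<forall>x\<in>M. \<sigma> x \<in> M"
    and \<sigma>: "\<sigma> \<in> embeddings E M"
  shows "restrict (\<lambda>x. S (\<sigma> (T x))) M \<in> embeddings E M"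
proof -
  interpret S: field_hom M S by (rule S)
  interpret T: field_hom M T by (rule T)
  interpret \<sigma>: field_hom M \<sigma> using embeddings_field_hom[OF \<sigma> M(1)] .
  have TM: "T x \<in> M" if "x \<in> M" for x using that T(2) by blast
  have "S (\<sigma> (T x)) = x" if "x \<in> E" for x
  proof -
    have "T x \<in> E" using that T(3) by blast
    hence "\<sigma> (T x) = T x" using \<sigma> by (simp add: embeddings_iff)
    thus ?thesis using T(4) that M(2) by auto
  qed
  thus ?thesis using M(2) TM bspec[OF stable \<sigma>] by (auto simp: embeddings_iff)
qed

text \<open>Conjugation by \<open>S\<close> permutes the embeddings, so it only reindexes the
  product. \<open>stable\<close> keeps their values inside \<open>M\<close>, where \<open>S\<close>
  is multiplicative.\<close>

lemma field_norm_equivariant: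
  assumes M: "subfield M CC" "E \<subseteq> M"
    and S: "field_hom M S" "S ` M = M" "S ` E = E"
    and stable: "\<forall>\<sigma>\<in>embeddings E M. \<forall>x\<in>M. \<sigma> x \<in> M"
    and y: "y \<in> M"
  shows "field_norm E M (S y) = S (field_norm E M y)"
proof -
  interpret S: field_hom M S by (rule S)
  define T where "T = the_inv_into M S"
  note T = field_hom_the_inv_into[OF S(1,2), folded T_def]
  have TE: "T ` E \<subseteq> E"
  proof (rule image_subsetI)
    fix x assume "x \<in> E"
    then obtain z where "z \<in> E" "x = S z" using S(3) by blast
    thus "T x \<in> E" using T(3) M(2) by auto
  qed
  have SM: "S x \<in> M" and TM: "T x \<in> M" if "x \<in> M" for x using that S(2) T(2) by blast+
  have bij: "bij_betw (\<lambda>\<sigma>. restrict (\<lambda>x. S (\<sigma> (T x))) M) (embeddings E M) (embeddings E M)"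
  proof (rule bij_betwI[where g = "\<lambda>\<sigma>. restrict (\<lambda>x. T (\<sigma> (S x))) M"])
    show "(\<lambda>\<sigma>. restrict (\<lambda>x. S (\<sigma> (T x))) M) \<in> embeddings E M \<rightarrow> embeddings E M"
      using embeddings_conj[of M E S T, OF M S(1) T(1,2) TE T(4) stable] by blast
    show "(\<lambda>\<sigma>. restrict (\<lambda>x. T (\<sigma> (S x))) M) \<in> embeddings E M \<rightarrow> embeddings E M"
      using embeddings_conj[of M E T S, OF M T(1) S(1,2) equalityD1[OF S(3)] T(3) stable] by blast
    show "restrict (\<lambda>x. T (restrict (\<lambda>x. S (\<sigma> (T x))) M (S x))) M = \<sigma>" if "\<sigma> \<in> embeddings E M" for \<sigma>
    proof (rule extensionalityI)
      show "\<sigma> \<in> extensional M" using that by (simp add: embeddings_iff)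
    qed (use SM T(3) bspec[OF stable that] in auto)
    show "restrict (\<lambda>x. S (restrict (\<lambda>x. T (\<sigma> (S x))) M (T x))) M = \<sigma>" if "\<sigma> \<in> embeddings E M" for \<sigma>
    proof (rule extensionalityI)
      show "\<sigma> \<in> extensional M" using that by (simp add: embeddings_iff)
    qed (use TM T(4) bspec[OF stable that] in auto)
  qed
  have "field_norm E M (S y) = (\<Prod>\<sigma>\<in>embeddings E M. restrict (\<lambda>x. S (\<sigma> (T x))) M (S y))"
    unfolding field_norm_def using prod.reindex_bij_betw[OF bij, of "\<lambda>\<sigma>. \<sigma> (S y)"] by simp
  also have "\<dots> = (\<Prod>\<sigma>\<in>embeddings E M. S (\<sigma> y))"
    using y SM T(3) by (intro prod.cong) auto
  also have "\<dots> = S (field_norm E M y)"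
    unfolding field_norm_def using stable y by (intro S.hom_prod[symmetric]) blast
  finally show ?thesis .
qed

text \<open>For surjectivity, \<open>S\<close> injects the finite root set of a rational polynomial
  into itself and so permutes it.\<close>

lemma galois_extension_image:
  assumes gal: "galois_extension \<rat> L" and S: "field_hom M S" "L \<subseteq> M"
  shows "S ` L = L"
proof
  interpret S: field_hom M S by (rule S)
  interpret Q: subfld \<rat> by (rule subfld_Rats)
  show sub: "S ` L \<subseteq> L"
    using galois_extension_normal[OF gal _ S] by auto
  show "L \<subseteq> S ` L"
  proof
    fix z assume "z \<in> L"
    then obtain p where p: "p \<in> Q.polys" "p \<noteq> 0" "poly p z = 0" and roots: "\<And>y. poly p y = 0 \<Longrightarrow> y \<in> L"
      using galois_extension_splits[OF gal] by metis
    let ?R = "{y. poly p y = 0}"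
    have pM: "p \<in> S.polys" "map_poly S p = p"
      using p(1) S.Rats_subset by (auto simp: S.polys_def Q.polys_def poly_eq_iff)
    have RM: "?R \<subseteq> M" using roots S(2) by auto
    have "S ` ?R \<subseteq> ?R"
    proof (rule image_subsetI)
      fix y assume y: "y \<in> ?R"
      hence "y \<in> M" using RM by blast
      hence "S (poly p y) = poly p (S y)" using S.hom_poly[OF pM(1), of y] pM(2) by simp
      thus "S y \<in> ?R" using y by simp
    qed
    moreover have "inj_on S ?R" using S.hom_inj RM by (rule inj_on_subset)
    ultimately have "S ` ?R = ?R" using poly_roots_finite[OF p(2)] by (simp add: endo_inj_surj)
    hence "z \<in> S ` ?R" using p(3) by blast
    thus "z \<in> S ` L" using roots by blast
  qed
qed

lemma compositum_incl: "E \<subseteq> compositum E L" "L \<subseteq> compositum E L"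
  unfolding compositum_def by (simp_all add: generate_field.incl subset_iff)

text \<open>Minimality of the compositum gives both inclusions: the elements that \<open>S\<close>
  keeps inside, and the image of \<open>S\<close>, are subfields containing \<open>E\<close> and
  \<open>L\<close>.\<close>

lemma compositum_image:
  assumes S: "field_hom (compositum E L) S" "S ` E = E" "S ` L = L"
  shows "S ` compositum E L = compositum E L"
proof -
  let ?M = "compositum E L"
  interpret S: field_hom ?M S by (rule S)
  have gen: "?M \<subseteq> F" if "subfield F CC" "E \<subseteq> F" "L \<subseteq> F" for F
    unfolding compositum_def using that by (intro field.generate_field_min_subfield1[OF CC_field]) auto
  note EL = compositum_incl(1)[of E L] compositum_incl(2)[of L E]
  have "subfield {x \<in> ?M. S x \<in> ?M} CC" unfolding subfield_CC_iff by auto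
  hence "?M \<subseteq> {x \<in> ?M. S x \<in> ?M}" using EL S(2,3) by (intro gen) auto
  moreover have "?M \<subseteq> S ` ?M"
    using S.image_subfld image_mono[OF EL(1), of S] image_mono[OF EL(2), of S] S(2,3)
    by (intro gen) (auto simp: subfld_def)
  ultimately show ?thesis by blast
qed

text \<open>An automorphism of \<open>E\<close> extends to the compositum, and conjugation with the extension permutes
  the embeddings that occur in the norm.\<close>

lemma norm_image_stable:
  assumes E: "subfield E CC" and f: "field_hom E f" "f ` E = E"
    and L: "galois_extension \<rat> L" "ring.dimension CC d \<rat> L"
    and u: "u \<in> E" "u \<in> field_norm E (compositum E L) ` (compositum E L - {0})"
  shows "f u \<in> field_norm E (compositum E L) ` (compositum E L - {0})"
proof -
  let ?M = "compositum E L"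
  note EL = compositum_incl(1)[of E L] compositum_incl(2)[of L E]
  obtain g where g: "field_hom ?M g" and gf: "\<And>y. y \<in> E \<Longrightarrow> g y = f y"
    using extend_compositum[OF f(1) L] by blast
  interpret g: field_hom ?M g by (rule g)
  have gE: "g ` E = E" using gf f(2) by auto
  have gM: "g ` ?M = ?M"
    using g gE galois_extension_image[OF L(1) g EL(2)] by (rule compositum_image)
  have stable: "\<forall>\<sigma>\<in>embeddings E ?M. \<forall>x\<in>?M. \<sigma> x \<in> ?M"
  proof (intro ballI)
    fix \<sigma> x assume \<sigma>: "\<sigma> \<in> embeddings E ?M" "x \<in> ?M"
    have hom: "field_hom ?M \<sigma>" using embeddings_field_hom[OF \<sigma>(1) g.subfield] .
    have "\<sigma> ` E = E" using \<sigma>(1) by (auto simp: embeddings_iff)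
    hence "\<sigma> ` ?M = ?M" using compositum_image[OF hom _ galois_extension_image[OF L(1) hom EL(2)]] by blast
    thus "\<sigma> x \<in> ?M" using \<sigma>(2) by blast
  qed
  obtain y where y: "y \<in> ?M" "y \<noteq> 0" "u = field_norm E ?M y" using u(2) by auto
  have "f u = g (field_norm E ?M y)" using gf[OF u(1)] y by simp
  also have "\<dots> = field_norm E ?M (g y)"
    using field_norm_equivariant[of ?M E g, OF g.subfield EL(1) g gM gE stable y(1)] by simp
  finally show ?thesis using y gM by (intro image_eqI[of _ _ "g y"]) auto
qed

section \<open>Unit classes\<close>

text \<open>Describes units without ring structure: the inverse lies in a subfield automatically, so
  only its integrality has to be required.\<close>

definition unit_set :: "complex set \<Rightarrow> complex set" where
  "unit_set E = {u \<in> E. u \<noteq> 0 \<and> algebraic_int u \<and> algebraic_int (inverse u)}"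

context subfld
begin

lemma unit_group_carrier: "carrier (unit_group E) = unit_set E"
proof -
  have "u \<noteq> 0 \<and> inverse u = v" if "v * u = 1" for u v :: complex
    using that by (metis inverse_unique mult.commute mult_zero_right zero_neq_one)
  thus ?thesis
    by (auto simp: unit_group_def units_of_def Units_def ring_of_integers_def unit_set_def)
qed

lemma unit_group_simps: "x \<otimes>\<^bsub>unit_group E\<^esub> y = x * y" "\<one>\<^bsub>unit_group E\<^esub> = 1"
  by (simp_all add: unit_group_def units_of_def ring_of_integers_def)

lemma unit_set_1: "1 \<in> unit_set E"
  by (simp add: unit_set_def algebraic_int_1)

lemma unit_set_mult: "u \<in> unit_set E \<Longrightarrow> v \<in> unit_set E \<Longrightarrow> u * v \<in> unit_set E"
  by (auto simp: unit_set_def intro: algebraic_int_mult)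

lemma unit_set_inverse: "u \<in> unit_set E \<Longrightarrow> inverse u \<in> unit_set E"
  by (auto simp: unit_set_def)

lemma unit_set_power: "u \<in> unit_set E \<Longrightarrow> u ^ k \<in> unit_set E"
  by (induction k) (auto simp: unit_set_1 unit_set_mult)

lemma comm_group_unit_group: "comm_group (unit_group E)"
  by (rule comm_groupI, unfold unit_group_carrier unit_group_simps)
     (auto simp: unit_set_1 unit_set_mult mult_ac unit_set_inverse unit_set_def
       intro!: bexI[of _ "inverse _"] intro: algebraic_int_mult)

lemma unit_group_pow: "u [^]\<^bsub>unit_group E\<^esub> (k::nat) = u ^ k"
proof -
  interpret U: comm_group "unit_group E" by (rule comm_group_unit_group)
  show ?thesis by (induction k) (simp_all add: unit_group_simps mult.commute)
qed

lemma powers_unit_group: "powers (unit_group E) l = (\<lambda>u. u ^ l) ` unit_set E"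
  by (simp add: powers_def unit_group_pow unit_group_carrier)

lemma subgroup_powers: "subgroup (powers (unit_group E) l) (unit_group E)"
proof -
  interpret U: comm_group "unit_group E" by (rule comm_group_unit_group)
  show ?thesis
  proof (rule U.subgroupI)
    show "powers (unit_group E) l \<subseteq> carrier (unit_group E)"
      by (auto simp: powers_unit_group unit_group_carrier unit_set_power)
    show "powers (unit_group E) l \<noteq> {}" using unit_set_1 by (auto simp: powers_unit_group)
    show "inv\<^bsub>unit_group E\<^esub> a \<in> powers (unit_group E) l" if "a \<in> powers (unit_group E) l" for a
      using that by (auto simp: powers_def U.nat_pow_inv[symmetric])
    show "a \<otimes>\<^bsub>unit_group E\<^esub> b \<in> powers (unit_group E) l"
      if "a \<in> powers (unit_group E) l" "b \<in> powers (unit_group E) l" for a b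
      using that by (auto simp: powers_def U.pow_mult_distrib[OF U.m_comm, symmetric])
  qed
qed

lemma comm_group_unit_classes: "comm_group (unit_classes l E)"
  unfolding unit_classes_def
  by (rule comm_group.abelian_FactGroup[OF comm_group_unit_group subgroup_powers])

definition unit_class :: "nat \<Rightarrow> complex \<Rightarrow> complex set" where
  "unit_class l u = powers (unit_group E) l #>\<^bsub>unit_group E\<^esub> u"

lemma unit_class_eq_image: "unit_class l u = (\<lambda>v. v ^ l * u) ` unit_set E"
  by (auto simp: unit_class_def r_coset_def powers_unit_group unit_group_simps)

lemma unit_classes_carrier: "carrier (unit_classes l E) = unit_class l ` unit_set E"
  by (auto simp: unit_classes_def FactGroup_def RCOSETS_def unit_group_carrier unit_class_def)

lemma unit_classes_mult:
  assumes "u \<in> unit_set E" "v \<in> unit_set E"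
  shows "unit_class l u \<otimes>\<^bsub>unit_classes l E\<^esub> unit_class l v = unit_class l (u * v)"
proof -
  interpret U: comm_group "unit_group E" by (rule comm_group_unit_group)
  interpret P: normal "powers (unit_group E) l" "unit_group E"
    using U.subgroup_imp_normal[OF subgroup_powers] .
  show ?thesis
    using P.rcos_sum[of u v] assms
    by (simp add: unit_classes_def FactGroup_def unit_class_def unit_group_carrier unit_group_simps)
qed

lemma unit_class_self: "u \<in> unit_class l u"
  unfolding unit_class_eq_image using unit_set_1 by (intro image_eqI[of _ _ 1]) auto

lemma unit_class_eq_iff:
  assumes "u \<in> unit_set E" "v \<in> unit_set E"
  shows "unit_class l u = unit_class l v \<longleftrightarrow> u \<in> unit_class l v"
proof
  interpret U: comm_group "unit_group E" by (rule comm_group_unit_group)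
  show "unit_class l u = unit_class l v" if "u \<in> unit_class l v"
    using U.repr_independence[of u "powers (unit_group E) l" v] that assms subgroup_powers
    by (simp add: unit_class_def unit_group_carrier)
qed (use unit_class_self in blast)

lemma unit_class_power:
  assumes "v \<in> unit_set E"
  shows "unit_class l (v ^ l) = \<one>\<^bsub>unit_classes l E\<^esub>"
proof -
  interpret U: comm_group "unit_group E" by (rule comm_group_unit_group)
  have "powers (unit_group E) l #>\<^bsub>unit_group E\<^esub> v ^ l = powers (unit_group E) l"
    using assms by (intro subgroup.rcos_const[OF subgroup_powers U.is_group]) (auto simp: powers_unit_group)
  thus ?thesis by (simp add: unit_class_def unit_classes_def FactGroup_def)
qed

lemma one_unit_classes: "\<one>\<^bsub>unit_classes l E\<^esub> = unit_class l 1"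
  using unit_class_power[OF unit_set_1] by simp

lemma unit_class_one_iff:
  assumes "u \<in> unit_set E"
  shows "unit_class l u = \<one>\<^bsub>unit_classes l E\<^esub> \<longleftrightarrow> (\<exists>v\<in>unit_set E. u = v ^ l)"
  unfolding one_unit_classes unit_class_eq_iff[OF assms unit_set_1]
  by (auto simp: unit_class_eq_image)

lemma unit_class_nat_pow:
  assumes "u \<in> unit_set E"
  shows "unit_class l u [^]\<^bsub>unit_classes l E\<^esub> (k::nat) = unit_class l (u ^ k)"
proof -
  interpret C: comm_group "unit_classes l E" by (rule comm_group_unit_classes)
  show ?thesis using assms
    by (induction k) (simp_all add: one_unit_classes unit_classes_mult unit_set_power mult.commute)
qed

text \<open>Classes are cosets, that is sets of numbers, so an automorphism acts on them by taking
  direct images.\<close>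

lemma unit_class_image:
  assumes "field_hom E f" "f ` unit_set E = unit_set E" "u \<in> unit_set E"
  shows "f ` unit_class l u = unit_class l (f u)"
proof -
  interpret f: field_hom E f by (rule assms)
  have "f ` unit_class l u = (\<lambda>v. f v ^ l * f u) ` unit_set E"
    unfolding unit_class_eq_image image_image using assms(3)
    by (intro image_cong) (auto simp: unit_set_def)
  also have "\<dots> = (\<lambda>v. v ^ l * f u) ` (f ` unit_set E)" by (simp add: image_image)
  finally show ?thesis by (simp add: assms(2) unit_class_eq_image)
qed

end

section \<open>Relative units\<close>

text \<open>\<open>E\<close> and \<open>F\<close> stand for consecutive layers and \<open>Nr\<close>
  for the norms from above. \<open>Nr\<close> is only a multiplicative set: inverses of classes will
  be represented by (l-1)-th powers. \<open>nontrivial\<close> makes the norm to \<open>F\<close> a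
  product of two conjugates.\<close>

locale relative_units = dihedral_field E s n for E s n +
  fixes l :: nat and F Nr :: "complex set"
  assumes n: "n \<ge> 2" and l: "Factorial_Ring.prime l" and l_mod: "l mod 8 = 3 \<or> l mod 8 = 5"
    and F: "subfield F CC" "F = {x \<in> E. (s ^^ 2 ^ (n - 1)) x = x}"
    and nontrivial: "\<exists>x\<in>E. (s ^^ 2 ^ (n - 1)) x \<noteq> x"
    and Nr_1: "1 \<in> Nr"
    and Nr_mult: "u \<in> Nr \<Longrightarrow> v \<in> Nr \<Longrightarrow> u * v \<in> Nr"
    and Nr_s: "u \<in> E \<Longrightarrow> u \<in> Nr \<Longrightarrow> s u \<in> Nr"
    and Nr_cnj: "u \<in> E \<Longrightarrow> u \<in> Nr \<Longrightarrow> cnj u \<in> Nr"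
begin

definition tau :: "complex \<Rightarrow> complex" where
  "tau = s ^^ 2 ^ (n - 1)"

sublocale F: subfld F by (rule subfld.intro) (rule F)

sublocale tau: field_hom E tau unfolding tau_def by (rule hom_funpow)

sublocale cnj: field_hom E cnj by (rule field_hom_cnj) (rule subfld_axioms)

lemma tau_closed: "x \<in> E \<Longrightarrow> tau x \<in> E"
  unfolding tau_def by (rule funpow_closed)

lemma tau_tau: "x \<in> E \<Longrightarrow> tau (tau x) = x"
proof -
  assume "x \<in> E"
  moreover have "(2::nat) ^ (n - 1) + 2 ^ (n - 1) = 2 ^ n" using n by (cases n) auto
  ultimately show ?thesis using s_period by (simp add: tau_def funpow_funpow)
qed

lemma F_iff: "x \<in> F \<longleftrightarrow> x \<in> E \<and> tau x = x"
  by (simp add: F tau_def)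

lemma norm_in_F: "x \<in> E \<Longrightarrow> x * tau x \<in> F"
  by (simp add: F_iff tau_closed tau_tau mult.commute)

lemma tau_s: "tau (s x) = s (tau x)"
  unfolding tau_def by (rule funpow_swap1[symmetric])

lemma s_funpow_cnj: "x \<in> E \<Longrightarrow> (s ^^ k) (cnj ((s ^^ k) x)) = cnj x"
proof (induction k arbitrary: x)
  case (Suc k)
  have "(s ^^ Suc k) (cnj ((s ^^ Suc k) x)) = s ((s ^^ k) (cnj ((s ^^ k) (s x))))"
    by (simp add: funpow_swap1)
  thus ?case using Suc s_closed s_cnj_s by simp
qed simp

text \<open>The dihedral relation reads tau cnj tau = cnj, and for the involution \<open>tau\<close>
  this means that it commutes with \<open>cnj\<close>.\<close>

lemma tau_cnj: "x \<in> E \<Longrightarrow> tau (cnj x) = cnj (tau x)"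
  using s_funpow_cnj[of x "2 ^ (n - 1)"] tau_tau[of "cnj (tau x)"] tau_closed cnj_closed
  by (simp add: tau_def)

text \<open>An embedding over \<open>F\<close> sends \<open>x\<close> to a root of \<open>(X - x) (X - tau x)\<close>; by additivity the choice
  of the root does not depend on \<open>x\<close>.\<close>

lemma embeddings_F: "embeddings F E = {restrict id E, restrict tau E}"
proof (intro equalityI subsetI)
  fix \<sigma> assume "\<sigma> \<in> {restrict id E, restrict tau E}"
  thus "\<sigma> \<in> embeddings F E" by (auto simp: embeddings_iff F_iff tau_closed)
next
  fix \<sigma> assume \<sigma>: "\<sigma> \<in> embeddings F E"
  interpret \<sigma>: field_hom E \<sigma> using embeddings_field_hom[OF \<sigma> subfield] .
  have root: "\<sigma> x = x \<or> \<sigma> x = tau x" if x: "x \<in> E" for x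
  proof -
    have "x + tau x \<in> F" "x * tau x \<in> F" using x by (simp_all add: F_iff tau_closed tau_tau add.commute mult.commute)
    hence "\<sigma> (x + tau x) = x + tau x" "\<sigma> (x * tau x) = x * tau x" using \<sigma> by (auto simp: embeddings_iff)
    hence 1: "\<sigma> (tau x) = x + tau x - \<sigma> x" and 2: "\<sigma> x * \<sigma> (tau x) = x * tau x"
      using x by (auto simp: tau_closed algebra_simps)
    have "(\<sigma> x - x) * (\<sigma> x - tau x) = 0" using 2 unfolding 1 by (simp add: algebra_simps)
    thus ?thesis by simp
  qed
  have "(\<forall>x\<in>E. \<sigma> x = x) \<or> (\<forall>x\<in>E. \<sigma> x = tau x)"
  proof (rule ccontr)
    assume "\<not> ?thesis"
    then obtain x y where x: "x \<in> E" "\<sigma> x \<noteq> x" and y: "y \<in> E" "\<sigma> y \<noteq> tau y" by blast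
    have "\<sigma> x = tau x" "\<sigma> y = y" using root[OF x(1)] root[OF y(1)] x y by auto
    thus False using root[of "x + y"] x y by auto
  qed
  moreover have "\<sigma> \<in> extensional E" using \<sigma> by (simp add: embeddings_iff)
  ultimately have "\<sigma> = restrict id E \<or> \<sigma> = restrict tau E"
    by (auto simp: fun_eq_iff extensional_def)
  thus "\<sigma> \<in> {restrict id E, restrict tau E}" by simp
qed

lemma field_norm_F: "x \<in> E \<Longrightarrow> field_norm F E x = x * tau x"
proof -
  assume x: "x \<in> E"
  obtain y where y: "y \<in> E" "tau y \<noteq> y" using nontrivial by (auto simp: tau_def)
  \<comment> \<open>The norm is a product over a set, so the two embeddings must be distinct to
    contribute two factors.\<close>
  have "restrict id E y \<noteq> restrict tau E y" using y by simp
  hence "restrict id E \<noteq> restrict tau E" by metis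
  thus ?thesis using x by (simp add: field_norm_def embeddings_F)
qed

lemma s_unit_set: "u \<in> unit_set E \<Longrightarrow> s u \<in> unit_set E"
  using algebraic_int_s[of "inverse u"] by (auto simp: unit_set_def s_closed algebraic_int_s)

lemma cnj_unit_set: "u \<in> unit_set E \<Longrightarrow> cnj u \<in> unit_set E"
  using algebraic_int_cnj[of "inverse u"] by (auto simp: unit_set_def cnj_closed)

lemma funpow_unit_set: "u \<in> unit_set E \<Longrightarrow> (s ^^ k) u \<in> unit_set E"
  by (induction k) (auto simp: s_unit_set)

lemma tau_unit_set: "u \<in> unit_set E \<Longrightarrow> tau u \<in> unit_set E"
  unfolding tau_def by (rule funpow_unit_set)

lemma s_image_unit_set: "s ` unit_set E = unit_set E"
proof
  show "unit_set E \<subseteq> s ` unit_set E"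
  proof
    fix u assume u: "u \<in> unit_set E"
    obtain m where m: "(2::nat) ^ n = Suc m" by (metis not0_implies_Suc power_not_zero zero_neq_numeral)
    have "u = s ((s ^^ m) u)" using s_period[of u] u by (simp add: m unit_set_def)
    thus "u \<in> s ` unit_set E" using funpow_unit_set[OF u] by blast
  qed
qed (use s_unit_set in auto)

lemma cnj_image_unit_set: "cnj ` unit_set E = unit_set E"
  using cnj_unit_set by (metis complex_cnj_cnj image_eqI image_subset_iff subsetI subset_antisym)

lemma unit_set_F: "unit_set F \<subseteq> unit_set E"
  by (auto simp: unit_set_def F_iff)

text \<open>Representatives of the relative classes. The \<open>l\<close>-th root of the norm is
  required among the units of \<open>F\<close>, as the kernel in the classes of \<open>F\<close>
  demands.\<close>

definition rel :: "complex set" where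
  "rel = {u \<in> unit_set E. \<exists>v\<in>unit_set F. u * tau u = v ^ l}"

lemma relative_classes_eq: "relative_classes l F E = unit_class l ` rel"
proof -
  have norm: "norm_on_classes l F E (unit_class l u) = F.unit_class l (u * tau u)" if u: "u \<in> unit_set E" for u
  proof -
    \<comment> \<open>Multiplying the representative by \<open>v ^ l\<close> multiplies the norm by
      the \<open>l\<close>-th power of \<open>v * tau v\<close>, so only one class occurs and
      \<open>the_elem\<close> returns it.\<close>
    have "F.unit_class l (field_norm F E w) = F.unit_class l (u * tau u)" if w: "w \<in> unit_class l u" for w
    proof -
      obtain v where v: "v \<in> unit_set E" "w = v ^ l * u" using w by (auto simp: unit_class_eq_image)
      have E: "u \<in> E" "v \<in> E" "w \<in> E" using u v by (auto simp: unit_set_def)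
      have NF: "x * tau x \<in> unit_set F" if "x \<in> unit_set E" for x
        using that unit_set_mult[OF that tau_unit_set[OF that]] norm_in_F[of x] by (simp add: unit_set_def)
      have wU: "w \<in> unit_set E" using v u by (simp add: unit_set_mult unit_set_power)
      have "w * tau w = (v * tau v) ^ l * (u * tau u)" using v E by (simp add: power_mult_distrib mult_ac)
      hence "w * tau w \<in> F.unit_class l (u * tau u)" using NF[OF v(1)] by (auto simp: F.unit_class_eq_image)
      thus ?thesis using F.unit_class_eq_iff[OF NF[OF wU] NF[OF u]] field_norm_F[OF E(3)] by simp
    qed
    moreover have "unit_class l u \<noteq> {}" using unit_class_self by blast
    ultimately have "(\<lambda>w. F.unit_class l (field_norm F E w)) ` unit_class l u = {F.unit_class l (u * tau u)}"
      by auto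
    thus ?thesis by (simp add: norm_on_classes_def F.unit_class_def[symmetric])
  qed
  have NF: "u * tau u \<in> unit_set F" if "u \<in> unit_set E" for u
    using that unit_set_mult[OF that tau_unit_set[OF that]] norm_in_F[of u] by (simp add: unit_set_def)
  have "norm_on_classes l F E (unit_class l u) = \<one>\<^bsub>unit_classes l F\<^esub> \<longleftrightarrow> (\<exists>v\<in>unit_set F. u * tau u = v ^ l)"
    if "u \<in> unit_set E" for u
    unfolding norm[OF that] by (rule F.unit_class_one_iff[OF NF[OF that]])
  thus ?thesis
    unfolding relative_classes_def kernel_def unit_classes_carrier rel_def by blast
qed

lemma rel_class:
  assumes "u \<in> rel" "v \<in> unit_class l u"
  shows "v \<in> rel"
proof -
  obtain w where w: "w \<in> unit_set E" "v = w ^ l * u" using assms by (auto simp: unit_class_eq_image)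
  obtain x where x: "x \<in> unit_set F" "u * tau u = x ^ l" using assms by (auto simp: rel_def)
  have u: "u \<in> unit_set E" using assms by (simp add: rel_def)
  have NF: "w * tau w \<in> unit_set F"
    using w unit_set_mult[OF w(1) tau_unit_set[OF w(1)]] norm_in_F[of w] by (simp add: unit_set_def)
  have "v * tau v = (w * tau w) ^ l * (u * tau u)"
    using w u by (simp add: unit_set_def power_mult_distrib mult_ac)
  hence "v * tau v = (w * tau w * x) ^ l" by (simp add: x power_mult_distrib)
  moreover have "w * tau w * x \<in> unit_set F" using NF x by (simp add: F.unit_set_mult)
  moreover have "v \<in> unit_set E" using w u by (simp add: unit_set_mult unit_set_power)
  ultimately show ?thesis by (auto simp: rel_def)
qed

lemma rel_1: "1 \<in> rel"
  using unit_set_1 F.unit_set_1 by (auto simp: rel_def intro!: bexI[of _ 1])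

lemma rel_mult: "u \<in> rel \<Longrightarrow> v \<in> rel \<Longrightarrow> u * v \<in> rel"
proof -
  assume u: "u \<in> rel" and v: "v \<in> rel"
  obtain x where x: "x \<in> unit_set F" "u * tau u = x ^ l" using u by (auto simp: rel_def)
  obtain y where y: "y \<in> unit_set F" "v * tau v = y ^ l" using v by (auto simp: rel_def)
  have E: "u \<in> unit_set E" "v \<in> unit_set E" using u v by (auto simp: rel_def)
  have "(u * v) * tau (u * v) = (u * tau u) * (v * tau v)" using E by (simp add: unit_set_def mult_ac)
  hence "(u * v) * tau (u * v) = (x * y) ^ l" by (simp add: x y power_mult_distrib)
  thus ?thesis using E x y by (auto simp: rel_def unit_set_mult intro!: bexI[of _ "x * y"] F.unit_set_mult)
qed

lemma rel_image:
  assumes f: "field_hom E f" "\<And>x. x \<in> unit_set E \<Longrightarrow> f x \<in> unit_set E" "\<And>x. x \<in> E \<Longrightarrow> tau (f x) = f (tau x)"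
    and u: "u \<in> rel"
  shows "f u \<in> rel"
proof -
  interpret f: field_hom E f by (rule f)
  obtain x where x: "x \<in> unit_set F" "u * tau u = x ^ l" using u by (auto simp: rel_def)
  have E: "u \<in> unit_set E" "x \<in> unit_set E" using u x unit_set_F by (auto simp: rel_def)
  have uE: "u \<in> E" "x \<in> E" using E by (auto simp: unit_set_def)
  have "f u * tau (f u) = f (u * tau u)" using f(3) uE by (simp add: tau_closed)
  also have "\<dots> = f x ^ l" using uE by (simp add: x)
  finally have "f u * tau (f u) = f x ^ l" .
  moreover have "f x \<in> unit_set F"
    using f(2)[OF E(2)] f(3)[OF uE(2)] x(1) by (auto simp: unit_set_def F_iff)
  ultimately show ?thesis using f(2)[OF E(1)] by (auto simp: rel_def)
qed

lemma rel_s: "u \<in> rel \<Longrightarrow> s u \<in> rel"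
  by (rule rel_image) (auto intro: field_hom_axioms s_unit_set simp: tau_s)

lemma rel_cnj: "u \<in> rel \<Longrightarrow> cnj u \<in> rel"
  by (rule rel_image) (auto intro: cnj.field_hom_axioms cnj_unit_set simp: tau_cnj)

text \<open>Units of relative norm exactly 1: on them \<open>tau\<close> is inversion in the field
  itself and not merely modulo \<open>l\<close>-th powers, so their logarithms come in opposite
  pairs.\<close>

definition anti :: "complex set" where
  "anti = {u \<in> unit_set E. u * tau u = 1}"

lemma odd_l: "odd l" using l_mod by presburger

text \<open>A class whose norm is the class of \<open>v ^ l\<close> contains a power of \<open>u / tau u = u ^ 2 / v ^ l\<close>.\<close>

lemma rel_anti:
  assumes u: "u \<in> rel"
  shows "\<exists>w\<in>anti. unit_class l w = unit_class l u"
proof -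
  obtain v where v: "v \<in> unit_set F" "u * tau u = v ^ l" using u by (auto simp: rel_def)
  have uU: "u \<in> unit_set E" and vU: "v \<in> unit_set E" using u v unit_set_F by (auto simp: rel_def)
  have E: "u \<in> E" "v \<in> E" "u \<noteq> 0" "v \<noteq> 0" "tau u \<in> E" "tau u \<noteq> 0"
    using uU vU tau_unit_set[OF uU] by (auto simp: unit_set_def)
  \<comment> \<open>\<open>k\<close> is the inverse of 2 modulo \<open>l\<close>, so that u^(2k) is
    in the class of \<open>u\<close>.\<close>
  define k where "k = (l + 1) div 2"
  have k: "2 * k = l + 1" using odd_l by (simp add: k_def)
  define w where "w = (u * inverse (tau u)) ^ k"
  have wU: "w \<in> unit_set E"
    unfolding w_def by (intro unit_set_power unit_set_mult unit_set_inverse uU tau_unit_set)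
  have "w * tau w = (u * inverse (tau u) * (tau u * inverse u)) ^ k"
    using E by (simp add: w_def tau_tau power_mult_distrib)
  also have "u * inverse (tau u) * (tau u * inverse u) = 1" using E(3,6) by (simp add: field_simps)
  finally have "w * tau w = 1" by simp
  moreover have "unit_class l w = unit_class l u"
  proof (rule unit_class_eq_iff[OF wU uU, THEN iffD2])
    have "inverse (tau u) = u * inverse (v ^ l)" using v(2) E by (simp add: field_simps)
    hence "w = (u * u) ^ k * inverse v ^ (l * k)"
      by (simp add: w_def power_mult_distrib power_mult power_inverse)
    also have "(u * u) ^ k = u ^ (l + 1)" by (simp add: power2_eq_square[symmetric] power_mult[symmetric] k del: power_Suc)
    finally have "w = (u * inverse v ^ k) ^ l * u" by (simp add: power_mult_distrib power_mult mult.commute[of l k] mult_ac)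
    moreover have "u * inverse v ^ k \<in> unit_set E" by (intro unit_set_mult unit_set_power unit_set_inverse uU vU)
    ultimately show "w \<in> unit_class l u" unfolding unit_class_eq_image by blast
  qed
  ultimately show ?thesis using wU by (auto simp: anti_def)
qed

text \<open>Complex conjugation inverts roots of unity, hence so does \<open>s cnj s\<close>; this makes \<open>s\<^sup>2\<close>, and with
  it \<open>tau\<close>, trivial on them.\<close>

lemma anti_torsion:
  assumes u: "u \<in> anti" "u ^ l = 1"
  shows "u = 1"
proof -
  have uE: "u \<in> E" "u \<noteq> 0" using u by (auto simp: anti_def unit_set_def)
  have "l > 0" using odd_l by (rule odd_pos)
  have norm1: "cnj z = inverse z" if "z ^ l = 1" for z
  proof -
    have "cmod z ^ l = 1" using that by (metis norm_one norm_power)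
    hence "cmod z ^ l = 1 ^ l" by simp
    hence "cmod z = 1" using \<open>l > 0\<close> by (intro power_eq_imp_eq_base[of _ l 1]) simp_all
    hence "z * cnj z = 1" by (simp add: complex_norm_square[symmetric])
    thus ?thesis by (metis inverse_unique)
  qed
  have ss: "s (s z) = z" if z: "z \<in> E" "z ^ l = 1" for z
  proof -
    have "s z ^ l = 1" using hom_power[OF z(1), of l] z(2) by simp
    hence "s (inverse (s z)) = inverse z" using s_cnj_s[OF z(1)] norm1[of "s z"] norm1[OF z(2)] by simp
    thus ?thesis using z(1) s_closed by simp
  qed
  have "(s ^^ (2 * j)) u = u" for j using ss[OF uE(1) u(2)] by (induction j) auto
  moreover have "(2::nat) ^ (n - 1) = 2 * 2 ^ (n - 2)"
  proof -
    obtain m where "n = m + 2" using n le_iff_add[of 2 n] by (auto simp: add.commute)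
    thus ?thesis by simp
  qed
  ultimately have "tau u = u" by (simp add: tau_def)
  hence "u ^ 2 = 1" using u(1) by (simp add: anti_def power2_eq_square)
  moreover obtain k where "l = 2 * k + 1" using odd_l by (auto elim: oddE)
  ultimately show ?thesis using u(2) by (simp add: power_mult)
qed

text \<open>The rotations with index at least 2^(n-1) take values inverse to those of the first
  half. A bound on half of the logarithms, in absolute value, therefore bounds all conjugates, and
  finiteness follows.\<close>

lemma discrete_logs_anti: "discrete_logs anti (\<lambda>k u. ln (cmod ((s ^^ k) u))) (2 ^ (n - 1))"
proof
  have E: "u \<in> E" "u \<noteq> 0" "(s ^^ k) u \<noteq> 0" if "u \<in> anti" for u k
    using that funpow_unit_set[of u k] by (auto simp: anti_def unit_set_def)
  show "1 \<in> anti" by (simp add: anti_def unit_set_1)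
  show "0 \<notin> anti" by (simp add: anti_def)
  show "u * v \<in> anti" if "u \<in> anti" "v \<in> anti" for u v
    using that E(1)[OF that(1)] E(1)[OF that(2)] by (simp add: anti_def unit_set_mult mult_ac) (metis mult.left_commute mult.right_neutral)
  show "inverse u \<in> anti" if "u \<in> anti" for u
    using that E[OF that] by (simp add: anti_def unit_set_inverse flip: inverse_mult_distrib)
  show "ln (cmod ((s ^^ k) (u * v))) = ln (cmod ((s ^^ k) u)) + ln (cmod ((s ^^ k) v))"
    if "u \<in> anti" "v \<in> anti" for k u v
  proof -
    interpret sk: field_hom E "s ^^ k" by (rule hom_funpow)
    show ?thesis using E[OF that(1)] E[OF that(2)] by (simp add: norm_mult ln_mult)
  qed
  fix B :: real
  have "{u \<in> anti. \<forall>k<2 ^ (n - 1). \<bar>ln (cmod ((s ^^ k) u))\<bar> \<le> B}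
    \<subseteq> {u \<in> E. algebraic_int u \<and> (\<forall>k<2 ^ n. cmod ((s ^^ k) u) \<le> exp B)}"
  proof (rule subsetI)
    fix u assume "u \<in> {u \<in> anti. \<forall>k<2 ^ (n - 1). \<bar>ln (cmod ((s ^^ k) u))\<bar> \<le> B}"
    hence u: "u \<in> anti" and B: "\<And>k. k < 2 ^ (n - 1) \<Longrightarrow> \<bar>ln (cmod ((s ^^ k) u))\<bar> \<le> B" by auto
    have le: "cmod z \<le> exp B \<and> cmod (inverse z) \<le> exp B" if z: "z \<noteq> 0" "\<bar>ln (cmod z)\<bar> \<le> B" for z
    proof -
      have "cmod z = exp (ln (cmod z))" "cmod (inverse z) = exp (- ln (cmod z))"
        using z(1) by (simp_all add: exp_minus norm_inverse)
      thus ?thesis using z(2) by (metis abs_le_D1 abs_le_D2 exp_le_cancel_iff)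
    qed
    have "cmod ((s ^^ k) u) \<le> exp B" if k: "k < 2 ^ n" for k
    proof (cases "k < 2 ^ (n - 1)")
      case True
      thus ?thesis using le B E(3)[OF u] by blast
    next
      case False
      define j where "j = k - 2 ^ (n - 1)"
      interpret sj: field_hom E "s ^^ j" by (rule hom_funpow)
      have "(2::nat) ^ n = 2 ^ (n - 1) + 2 ^ (n - 1)" using n by (cases n) auto
      hence j: "k = j + 2 ^ (n - 1)" "j < 2 ^ (n - 1)" using False k by (auto simp: j_def)
      have "tau u = inverse u" using u inverse_unique[of u "tau u"] by (simp add: anti_def)
      hence "(s ^^ k) u = inverse ((s ^^ j) u)"
        using E(1)[OF u] by (simp add: j(1) tau_def flip: funpow_funpow)
      thus ?thesis using le[OF E(3)[OF u] B[OF j(2)]] by simp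
    qed
    thus "u \<in> {u \<in> E. algebraic_int u \<and> (\<forall>k<2 ^ n. cmod ((s ^^ k) u) \<le> exp B)}"
      using u by (simp add: anti_def unit_set_def)
  qed
  thus "finite {u \<in> anti. \<forall>k<2 ^ (n - 1). \<bar>ln (cmod ((s ^^ k) u))\<bar> \<le> B}"
    using finite_bounded_conjugates by (rule finite_subset)
qed

text \<open>Representatives of norm 1 that lie in different classes cannot differ by an
  \<open>l\<close>-th power of a unit of norm 1. Arguing with arbitrary finite sets of classes
  yields finiteness together with the bound.\<close>

lemma card_relative_classes:
  "finite (unit_class l ` rel) \<and> card (unit_class l ` rel) \<le> l ^ 2 ^ (n - 1)"
proof (rule finite_if_finite_subsets_card_bdd)
  interpret A: discrete_logs anti "\<lambda>k u. ln (cmod ((s ^^ k) u))" "2 ^ (n - 1)" by (rule discrete_logs_anti)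
  fix V assume V: "V \<subseteq> unit_class l ` rel" "finite V"
  have "\<forall>c\<in>V. \<exists>w\<in>anti. unit_class l w = c" using V(1) rel_anti by blast
  then obtain t where t: "\<And>c. c \<in> V \<Longrightarrow> t c \<in> anti \<and> unit_class l (t c) = c" by metis
  have "inj_on t V" using t by (metis inj_onI)
  hence "card V = card (t ` V)" by (simp add: card_image)
  also have "\<dots> \<le> l ^ 2 ^ (n - 1)"
  proof (rule A.card_distinct_classes_le)
    show "l \<ge> 2" using l by (rule prime_ge_2_nat)
    show "u = 1" if "u \<in> anti" "u ^ l = 1" for u using that by (rule anti_torsion)
    show "finite (t ` V)" "t ` V \<subseteq> anti" using V t by auto
    fix x y v assume x: "x \<in> t ` V" and y: "y \<in> t ` V" and v: "v \<in> anti" and xy: "x = y * v ^ l"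
    have U: "x \<in> unit_set E" "y \<in> unit_set E" "v \<in> unit_set E" using x y v t by (auto simp: anti_def)
    have "x \<in> unit_class l y" using U xy by (auto simp: unit_class_eq_image mult.commute)
    hence "unit_class l x = unit_class l y" using unit_class_eq_iff[OF U(1,2)] by simp
    thus "x = y" using x y t by auto
  qed
  finally show "card V \<le> l ^ 2 ^ (n - 1)" .
qed

end

section \<open>Relative classes containing norms\<close>

context relative_units
begin

definition norm_classes :: "complex set set" where
  "norm_classes = unit_class l ` (rel \<inter> Nr)"

lemma rel_unit_set: "u \<in> rel \<Longrightarrow> u \<in> unit_set E"
  by (simp add: rel_def)

lemma norm_classes_eq: "norm_classes = {c \<in> relative_classes l F E. \<exists>u\<in>c. u \<in> Nr}"
proof (intro equalityI subsetI)
  fix c assume "c \<in> norm_classes"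
  thus "c \<in> {c \<in> relative_classes l F E. \<exists>u\<in>c. u \<in> Nr}"
    using unit_class_self by (auto simp: norm_classes_def relative_classes_eq)
next
  fix c assume "c \<in> {c \<in> relative_classes l F E. \<exists>u\<in>c. u \<in> Nr}"
  then obtain u v where u: "u \<in> rel" "c = unit_class l u" and v: "v \<in> c" "v \<in> Nr"
    by (auto simp: relative_classes_eq)
  have "v \<in> rel" using rel_class u v by blast
  moreover have "unit_class l v = c"
    using unit_class_eq_iff[OF rel_unit_set[OF \<open>v \<in> rel\<close>] rel_unit_set[OF u(1)]] u v by simp
  ultimately show "c \<in> norm_classes" using v by (auto simp: norm_classes_def)
qed

lemma rel_Nr_power: "u \<in> rel \<inter> Nr \<Longrightarrow> u ^ k \<in> rel \<inter> Nr"
  by (induction k) (auto simp: rel_1 Nr_1 rel_mult Nr_mult)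

lemma subgroup_norm_classes: "subgroup norm_classes (unit_classes l E)"
proof -
  interpret C: comm_group "unit_classes l E" by (rule comm_group_unit_classes)
  show ?thesis
  proof (rule C.subgroupI)
    show "norm_classes \<subseteq> carrier (unit_classes l E)"
      using rel_unit_set by (auto simp: norm_classes_def unit_classes_carrier)
    show "norm_classes \<noteq> {}" using rel_1 Nr_1 by (auto simp: norm_classes_def)
    fix a assume "a \<in> norm_classes"
    then obtain u where u: "u \<in> rel" "u \<in> Nr" "a = unit_class l u" by (auto simp: norm_classes_def)
    have uU: "u \<in> unit_set E" using u rel_unit_set by blast
    have "l \<noteq> 0" using odd_l by (metis even_zero)
    \<comment> \<open>This power stays in the multiplicative set \<open>Nr\<close> and represents
      the inverse class.\<close>
    hence "u ^ (l - 1) * u = u ^ l" by (simp add: power_eq_if)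
    hence "unit_class l (u ^ (l - 1)) \<otimes>\<^bsub>unit_classes l E\<^esub> a = \<one>\<^bsub>unit_classes l E\<^esub>"
      using uU by (simp add: u unit_classes_mult unit_set_power unit_class_power)
    moreover have "unit_class l (u ^ (l - 1)) \<in> carrier (unit_classes l E)" "a \<in> carrier (unit_classes l E)"
      using uU u by (auto simp: unit_classes_carrier unit_set_power)
    ultimately have "inv\<^bsub>unit_classes l E\<^esub> a = unit_class l (u ^ (l - 1))"
      by (intro C.inv_equality)
    thus "inv\<^bsub>unit_classes l E\<^esub> a \<in> norm_classes"
      using rel_Nr_power[of u "l - 1"] u by (auto simp: norm_classes_def)
    fix b assume "b \<in> norm_classes"
    then obtain v where v: "v \<in> rel" "v \<in> Nr" "b = unit_class l v" by (auto simp: norm_classes_def)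
    show "a \<otimes>\<^bsub>unit_classes l E\<^esub> b \<in> norm_classes"
      using u v by (auto simp: norm_classes_def unit_classes_mult rel_unit_set rel_mult Nr_mult)
  qed
qed

lemma s_class: "u \<in> unit_set E \<Longrightarrow> s ` unit_class l u = unit_class l (s u)"
  using field_hom_axioms s_image_unit_set by (rule unit_class_image)

lemma cnj_class: "u \<in> unit_set E \<Longrightarrow> cnj ` unit_class l u = unit_class l (cnj u)"
  using cnj.field_hom_axioms cnj_image_unit_set by (rule unit_class_image)

lemma funpow_s_class: "u \<in> unit_set E \<Longrightarrow> ((`) s ^^ k) (unit_class l u) = unit_class l ((s ^^ k) u)"
  by (induction k) (simp_all add: s_class funpow_unit_set)

lemma dihedral_module_norm_classes:
  "dihedral_module ((unit_classes l E)\<lparr>carrier := norm_classes\<rparr>) l n ((`) s) ((`) cnj)"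
proof -
  interpret C: comm_group "unit_classes l E" by (rule comm_group_unit_classes)
  let ?G = "(unit_classes l E)\<lparr>carrier := norm_classes\<rparr>"
  have grp: "group ?G" by (rule subgroup.subgroup_is_group[OF subgroup_norm_classes C.is_group])
  have "norm_classes \<subseteq> carrier (unit_classes l E)" using subgroup_norm_classes by (rule subgroup.subset)
  hence comm: "comm_group ?G" using C.m_comm by (intro group.group_comm_groupI[OF grp]) auto
  interpret G: comm_group ?G by (rule comm)
  have W: "\<exists>u. u \<in> rel \<and> u \<in> Nr \<and> u \<in> unit_set E \<and> u \<in> E \<and> x = unit_class l u" if "x \<in> norm_classes" for x
    using that rel_unit_set by (auto simp: norm_classes_def unit_set_def)
  have closed: "unit_class l u \<in> norm_classes" if "u \<in> rel" "u \<in> Nr" for u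
    using that by (auto simp: norm_classes_def)
  show ?thesis
  proof (intro dihedral_module.intro comm dihedral_module_axioms.intro)
    have "norm_classes \<subseteq> unit_class l ` rel" by (auto simp: norm_classes_def)
    thus "finite (carrier ?G)" using card_relative_classes finite_subset by auto
    show "Factorial_Ring.prime l" "l mod 8 = 3 \<or> l mod 8 = 5" "2 \<le> n" by (fact l l_mod n)+
    show "(`) s \<in> hom ?G ?G"
    proof (rule homI)
      fix x y assume x: "x \<in> carrier ?G" and y: "y \<in> carrier ?G"
      obtain u where u: "u \<in> rel" "u \<in> Nr" "u \<in> unit_set E" "u \<in> E" "x = unit_class l u" using W x by auto
      obtain v where v: "v \<in> rel" "v \<in> Nr" "v \<in> unit_set E" "v \<in> E" "y = unit_class l v" using W y by auto
      show "s ` x \<in> carrier ?G" using u by (simp add: s_class closed rel_s Nr_s)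
      show "s ` (x \<otimes>\<^bsub>?G\<^esub> y) = s ` x \<otimes>\<^bsub>?G\<^esub> s ` y"
        using u v by (simp add: s_class unit_classes_mult unit_set_mult s_unit_set)
    qed
    show "(`) cnj \<in> hom ?G ?G"
    proof (rule homI)
      fix x y assume x: "x \<in> carrier ?G" and y: "y \<in> carrier ?G"
      obtain u where u: "u \<in> rel" "u \<in> Nr" "u \<in> unit_set E" "u \<in> E" "x = unit_class l u" using W x by auto
      obtain v where v: "v \<in> rel" "v \<in> Nr" "v \<in> unit_set E" "v \<in> E" "y = unit_class l v" using W y by auto
      show "cnj ` x \<in> carrier ?G" using u by (simp add: cnj_class closed rel_cnj Nr_cnj)
      show "cnj ` (x \<otimes>\<^bsub>?G\<^esub> y) = cnj ` x \<otimes>\<^bsub>?G\<^esub> cnj ` y"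
        using u v by (simp add: cnj_class unit_classes_mult unit_set_mult cnj_unit_set)
    qed
    fix x assume x: "x \<in> carrier ?G"
    obtain u where u: "u \<in> rel" "u \<in> Nr" "u \<in> unit_set E" "u \<in> E" "x = unit_class l u" using W x by auto
    show "x [^]\<^bsub>?G\<^esub> l = \<one>\<^bsub>?G\<^esub>"
    proof -
      have "x [^]\<^bsub>?G\<^esub> l = x [^]\<^bsub>unit_classes l E\<^esub> l" by (simp add: nat_pow_def)
      also have "\<dots> = \<one>\<^bsub>unit_classes l E\<^esub>" using u by (simp add: unit_class_nat_pow unit_class_power)
      finally show ?thesis by simp
    qed
    show "((`) s ^^ 2 ^ (n - 1)) x = inv\<^bsub>?G\<^esub> x"
    proof -
      \<comment> \<open>The root \<open>v\<close> is also a unit of \<open>E\<close>, so the norm of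
        \<open>u\<close> has trivial class there and \<open>tau\<close> inverts the class of
        \<open>u\<close>.\<close>
      obtain v where v: "v \<in> unit_set F" "u * tau u = v ^ l" using u by (auto simp: rel_def)
      have "v \<in> unit_set E" using v unit_set_F by blast
      hence "unit_class l (tau u) \<otimes>\<^bsub>unit_classes l E\<^esub> x = \<one>\<^bsub>unit_classes l E\<^esub>"
        using u v by (simp add: unit_classes_mult tau_unit_set unit_class_power mult.commute)
      moreover have "unit_class l (tau u) \<in> norm_classes"
      proof -
        have "(s ^^ k) u \<in> rel \<inter> Nr" for k
          using u by (induction k) (auto simp: rel_s intro!: Nr_s dest: rel_unit_set simp: unit_set_def)
        thus ?thesis using closed by (simp add: tau_def)
      qed
      ultimately have "inv\<^bsub>?G\<^esub> x = unit_class l (tau u)"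
        using x by (intro G.inv_equality) auto
      thus ?thesis using u by (simp add: funpow_s_class tau_def)
    qed
    show "cnj ` (cnj ` x) = x" by (simp add: image_image)
    show "cnj ` (s ` (cnj ` (s ` x))) = x"
      using u by (simp add: s_class cnj_class s_unit_set cnj_unit_set cnj_inverts)
  qed
qed

theorem norm_classes_dichotomy:
  "norm_classes = relative_classes l F E \<or> norm_classes = {\<one>\<^bsub>unit_classes l E\<^esub>}"
proof -
  let ?G = "(unit_classes l E)\<lparr>carrier := norm_classes\<rparr>"
  interpret D: dihedral_module ?G l n "(`) s" "(`) cnj" by (rule dihedral_module_norm_classes)
  obtain e where "order ?G = l ^ (2 ^ (n - 1) * e)" using D.order_eq_power by blast
  hence card: "card norm_classes = l ^ (2 ^ (n - 1) * e)" by (simp add: order_def)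
  have one: "\<one>\<^bsub>unit_classes l E\<^esub> \<in> norm_classes" using subgroup_norm_classes by (rule subgroup.one_closed)
  show ?thesis
  proof (cases "e = 0")
    case True
    hence "card norm_classes = 1" using card by simp
    thus ?thesis using one by (metis card_1_singletonE singletonD)
  next
    case False
    have "norm_classes \<subseteq> relative_classes l F E" using norm_classes_eq by blast
    moreover have "card (relative_classes l F E) \<le> card norm_classes"
    proof -
      have "l ^ (2 ^ (n - 1)) \<le> l ^ (2 ^ (n - 1) * e)"
        using False prime_gt_0_nat[OF l] by (intro power_increasing) auto
      thus ?thesis using card_relative_classes by (simp add: card relative_classes_eq)
    qed
    moreover have "finite (relative_classes l F E)" using card_relative_classes by (simp add: relative_classes_eq)
    ultimately show ?thesis using card_seteq by blast
  qed
qed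

end

text \<open>A trivial action would make the two layers equal as fixed fields, although their degrees
  over \<open>K0\<close> are 2^m and 2^(m+1).\<close>

lemma (in anticyclotomic_action) layer_gen_nontrivial:
  assumes "is_layer K0 Kinf m M" "is_layer K0 Kinf (Suc m) M'"
  shows "\<exists>x\<in>M'. (gen ^^ 2 ^ m) x \<noteq> x"
proof (rule ccontr)
  assume no: "\<not> ?thesis"
  have M: "M = layer m" "M' = layer (Suc m)" using assms is_layer_eq by auto
  have "layer (Suc m) \<subseteq> layer m"
    using layer_iff[of _ m 1] no by (auto simp: M)
  hence "M = M'" using layer_mono[of m 1] by (auto simp: M)
  hence "ring.dimension CC (2 ^ m) K0 M" "ring.dimension CC (2 ^ Suc m) K0 M"
    using assms by (auto simp: is_layer_def extension_degree_def)
  hence "(2::nat) ^ m = 2 ^ Suc m" by (rule ring.dimension_is_inj[OF CC_ring K0(2)])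
  thus False by simp
qed

theorem theorem4p2:
  fixes n l :: nat and K0 Kinf L Ln :: "complex set" and K :: "nat \<Rightarrow> complex set"
  assumes "n \<ge> 2"
    and "Factorial_Ring.prime l" and "l mod 8 = 3 \<or> l mod 8 = 5"
    and "K0 = adjoin \<rat> {\<i>}"
    and "anticyclotomic_Z2_extension K0 Kinf"
    and "\<And>m. is_layer K0 Kinf m (K m)"
    and "cyclic_extension \<rat> L l"
    and "\<And>p. Factorial_Ring.prime p \<Longrightarrow> ramified p L \<Longrightarrow> p mod 4 = 3"
    and "\<not> ramified l L"
    and "Ln = compositum (K n) L"
  shows "(\<forall>c \<in> relative_classes l (K (n - 1)) (K n). represented_by_norm (K n) Ln c) \<or>
    {c \<in> relative_classes l (K (n - 1)) (K n). represented_by_norm (K n) Ln c}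
      = {\<one>\<^bsub>unit_classes l (K n)\<^esub>}"
proof -
  obtain act where "anticyclotomic_action Kinf K0 act"
    using anticyclotomic_actionI assms(4,5) by blast
  then interpret A: anticyclotomic_action Kinf K0 act .
  have n: "n = Suc (n - 1)" using assms(1) by simp
  have K: "K m = A.layer m" for m using A.is_layer_eq assms(6) by blast
  define Nr where "Nr = field_norm (K n) Ln ` (Ln - {0})"
  have L: "galois_extension \<rat> L" "ring.dimension CC l \<rat> L"
    using assms(7) by (auto simp: cyclic_extension_def extension_degree_def)
  interpret dihedral_field "K n" A.gen n unfolding K by (rule A.dihedral_field_layer)
  have Ln: "subfield Ln CC" unfolding assms(10) compositum_def
    by (rule field.generate_field_is_subfield[OF CC_field]) simp
  interpret Ln: subfld Ln by (rule subfld.intro) (rule Ln)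
  have Nr_stable: "f u \<in> Nr" if "field_hom (K n) f" "f ` K n = K n" "u \<in> K n" "u \<in> Nr" for f u
    using norm_image_stable[OF subfield that(1,2) L that(3)] that(4) by (simp add: Nr_def assms(10))
  \<comment> \<open>The same automorphism \<open>A.gen\<close> serves every layer: on
    \<open>K n\<close> it has period 2^n, and its power of exponent 2^(n-1) has
    \<open>K (n - 1)\<close> as fixed field.\<close>
  interpret relative_units "K n" A.gen n l "K (n - 1)" Nr
  proof (intro relative_units.intro relative_units_axioms.intro)
    show "dihedral_field (K n) A.gen n" by (rule dihedral_field_axioms)
    show "2 \<le> n" "Factorial_Ring.prime l" "l mod 8 = 3 \<or> l mod 8 = 5" by (fact assms)+
    show "subfield (K (n - 1)) CC" unfolding K by (rule A.layer_subfield)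
    show "K (n - 1) = {x \<in> K n. (A.gen ^^ 2 ^ (n - 1)) x = x}"
      using A.layer_iff[of _ "n - 1" 1] A.layer_mono[of "n - 1" 1] n by (auto simp: K)
    show "\<exists>x\<in>K n. (A.gen ^^ 2 ^ (n - 1)) x \<noteq> x"
      using A.layer_gen_nontrivial[of "n - 1" "K (n - 1)" "K n"] assms(6)[of "n - 1"] assms(6)[of n] n by simp
    show "1 \<in> Nr" unfolding Nr_def by (rule image_eqI[of _ _ 1]) (simp_all add: field_norm_1)
    show "u * v \<in> Nr" if u: "u \<in> Nr" and v: "v \<in> Nr" for u v
    proof -
      obtain x where x: "x \<in> Ln - {0}" "u = field_norm (K n) Ln x" using u by (auto simp: Nr_def)
      obtain y where y: "y \<in> Ln - {0}" "v = field_norm (K n) Ln y" using v by (auto simp: Nr_def)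
      show ?thesis unfolding Nr_def
        by (rule image_eqI[of _ _ "x * y"]) (use x y in \<open>auto simp: field_norm_mult[OF Ln]\<close>)
    qed
    show "A.gen u \<in> Nr" if "u \<in> K n" "u \<in> Nr" for u
      using Nr_stable[OF field_hom_axioms s_image_E] that by blast
    show "cnj u \<in> Nr" if "u \<in> K n" "u \<in> Nr" for u
      using Nr_stable[OF field_hom_cnj[OF subfld_axioms] cnj_image_E] that by blast
  qed
  have "norm_classes = {c \<in> relative_classes l (K (n - 1)) (K n). represented_by_norm (K n) Ln c}"
    using norm_classes_eq by (simp only: represented_by_norm_def Nr_def)
  thus ?thesis using norm_classes_dichotomy by blast
qed

end
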